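(* Let $k\ge1$ and let $n=2r$ be even with $n\ge 4k$. There are no compact embedded hypersurfaces (without boundary) in $\mathbb{R}^{n+1}$ which, with the induced Riemannian metric $g$, are $(2k)$-anti-Thorpe, i.e. satisfy $\star(g^{r-2k}R^k)=-g^{r-2k}R^k$. Moreover, the round sphere is the only compact embedded hypersurface in $\mathbb{R}^{n+1}$ which, with the induced metric $g$, is $(2k)$-Thorpe, i.e. satisfies $\star(g^{r-2k}R^k)=g^{r-2k}R^k$.
   Context: Double forms: for a Euclidean space $(V,g)$ of dimension $n$, a $(p,q)$ double form is an element of $\Lambda^pV^*\otimes\Lambda^qV^*$. The exterior product of double forms is $(\alpha_1\otimes\beta_1)(\alpha_2\otimes\beta_2)=(\alpha_1\wedge\alpha_2)\otimes(\beta_1\wedge\beta_2)$, and powers are taken for this product. The metric $g=\sum e^i\otimes e^i$ (with $(e^i)$ an orthonormal basis of $V^*$) is a $(1,1)$ double form. The (double) Hodge star is defined by $\star(\theta_1\otimes\theta_2)=(\star\theta_1)\otimes(\star\theta_2)$. On a Riemannian manifold these notions are applied fibrewise. The Riemann curvature tensor $R$ of the hypersurface is viewed as a symmetric $(2,2)$ double form, with sign such that $R(x\wedge y;x\wedge y)$ is the sectional curvature for orthonormal $x,y$; $R^k$ is its $k$-th exterior power, a $(2k,2k)$ double form.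
   Formalization: In the Thorpe uniqueness claim the compact embedded hypersurface is assumed connected, since a disjoint union of round spheres is also (2k)-Thorpe; hypersurfaces are taken smooth and nonempty, and a round sphere may have any centre and radius. *)

theory Defs
  imports "HOL-Analysis.Analysis"
begin

section \<open>Smooth maps\<close>

text \<open>Only meaningful for open \<open>S\<close>; \<open>Ck_on k S f\<close> says that \<open>f\<close> is of class $C^k$ on \<open>S\<close>.\<close>

primrec Ck_on :: "nat \<Rightarrow> 'a::real_normed_vector set \<Rightarrow> ('a \<Rightarrow> 'b::real_normed_vector) \<Rightarrow> bool" where
  "Ck_on 0 S f \<longleftrightarrow> continuous_on S f"
| "Ck_on (Suc k) S f \<longleftrightarrow> (\<forall>x\<in>S. f differentiable (at x)) \<and>
     (\<forall>v. Ck_on k S (\<lambda>x. frechet_derivative f (at x) v))"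

definition smooth_on :: "'a::real_normed_vector set \<Rightarrow> ('a \<Rightarrow> 'b::real_normed_vector) \<Rightarrow> bool" where
  "smooth_on S f \<longleftrightarrow> (\<forall>k. Ck_on k S f)"

section \<open>Embedded hypersurfaces of a Euclidean space\<close>

text \<open>Embedded submanifolds of codimension 1 and without boundary, given by slice charts:
  \<open>M\<close> is locally carried to a linear hyperplane by a diffeomorphism between open sets of
  the ambient space.\<close>

definition embedded_hypersurface :: "'a::euclidean_space set \<Rightarrow> bool" where
  "embedded_hypersurface M \<longleftrightarrow>
     (\<forall>p\<in>M. \<exists>U V H. \<exists>\<phi> \<psi> :: 'a \<Rightarrow> 'a. open U \<and> p \<in> U \<and> open V \<and>
        homeomorphism U V \<phi> \<psi> \<and> smooth_on U \<phi> \<and> smooth_on V \<psi> \<and>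
        subspace H \<and> Suc (dim H) = DIM('a) \<and> \<phi> ` (M \<inter> U) = V \<inter> H)"

definition tangent_space :: "'a::euclidean_space set \<Rightarrow> 'a \<Rightarrow> 'a set" where
  "tangent_space M p = {v. \<exists>\<epsilon>>0. \<exists>\<gamma>::real \<Rightarrow> 'a. smooth_on {-\<epsilon><..<\<epsilon>} \<gamma> \<and>
     \<gamma> ` {-\<epsilon><..<\<epsilon>} \<subseteq> M \<and> \<gamma> 0 = p \<and> (\<gamma> has_vector_derivative v) (at 0)}"

text \<open>Functions and vector fields on \<open>M\<close> are total functions of the ambient space, of which
  only the values on \<open>M\<close> matter.\<close>

definition smooth_map :: "'a::euclidean_space set \<Rightarrow> ('a \<Rightarrow> 'b::real_normed_vector) \<Rightarrow> bool" where
  "smooth_map M f \<longleftrightarrow>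
     (\<forall>p\<in>M. \<exists>U F. open U \<and> p \<in> U \<and> smooth_on U F \<and> (\<forall>q\<in>M \<inter> U. F q = f q))"

definition tangent_field :: "'a::euclidean_space set \<Rightarrow> ('a \<Rightarrow> 'a) \<Rightarrow> bool" where
  "tangent_field M X \<longleftrightarrow> smooth_map M X \<and> (\<forall>p\<in>M. X p \<in> tangent_space M p)"

text \<open>The derivative $X f$ of a function along a tangent field. A Frechet derivative within
  \<open>M\<close> is not unique as a linear map on the ambient space, but its values on tangent vectors
  are: they are the derivatives of \<open>f\<close> along curves in \<open>M\<close>.\<close>

definition deriv_along ::
  "'a::euclidean_space set \<Rightarrow> ('a \<Rightarrow> 'a) \<Rightarrow> ('a \<Rightarrow> 'b::real_normed_vector) \<Rightarrow> 'a \<Rightarrow> 'b" where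
  "deriv_along M X f p = frechet_derivative f (at p within M) (X p)"

definition lie_bracket ::
  "'a::euclidean_space set \<Rightarrow> ('a \<Rightarrow> 'a) \<Rightarrow> ('a \<Rightarrow> 'a) \<Rightarrow> 'a \<Rightarrow> 'a" where
  "lie_bracket M X Y p = deriv_along M X Y p - deriv_along M Y X p"

section \<open>The Levi-Civita connection of the induced metric and its curvature\<close>

text \<open>The induced metric on \<open>tangent_space M p\<close> is the ambient inner product.\<close>

definition is_levi_civita ::
  "'a::euclidean_space set \<Rightarrow> (('a \<Rightarrow> 'a) \<Rightarrow> ('a \<Rightarrow> 'a) \<Rightarrow> 'a \<Rightarrow> 'a) \<Rightarrow> bool" where
  "is_levi_civita M D \<longleftrightarrow>
     (\<forall>X Y. tangent_field M X \<longrightarrow> tangent_field M Y \<longrightarrow> tangent_field M (D X Y)) \<and>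
     (\<forall>X X' Y. tangent_field M X \<longrightarrow> tangent_field M X' \<longrightarrow> tangent_field M Y \<longrightarrow>
        (\<forall>p\<in>M. D (\<lambda>q. X q + X' q) Y p = D X Y p + D X' Y p)) \<and>
     (\<forall>f X Y. smooth_map M (f :: 'a \<Rightarrow> real) \<longrightarrow> tangent_field M X \<longrightarrow> tangent_field M Y \<longrightarrow>
        (\<forall>p\<in>M. D (\<lambda>q. f q *\<^sub>R X q) Y p = f p *\<^sub>R D X Y p)) \<and>
     (\<forall>X Y Y'. tangent_field M X \<longrightarrow> tangent_field M Y \<longrightarrow> tangent_field M Y' \<longrightarrow>
        (\<forall>p\<in>M. D X (\<lambda>q. Y q + Y' q) p = D X Y p + D X Y' p)) \<and>
     (\<forall>f X Y. smooth_map M (f :: 'a \<Rightarrow> real) \<longrightarrow> tangent_field M X \<longrightarrow> tangent_field M Y \<longrightarrow>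
        (\<forall>p\<in>M. D X (\<lambda>q. f q *\<^sub>R Y q) p = deriv_along M X f p *\<^sub>R Y p + f p *\<^sub>R D X Y p)) \<and>
     (\<forall>X Y. tangent_field M X \<longrightarrow> tangent_field M Y \<longrightarrow>
        (\<forall>p\<in>M. D X Y p - D Y X p = lie_bracket M X Y p)) \<and>
     (\<forall>X Y Z. tangent_field M X \<longrightarrow> tangent_field M Y \<longrightarrow> tangent_field M Z \<longrightarrow>
        (\<forall>p\<in>M. deriv_along M X (\<lambda>q. Y q \<bullet> Z q) p = D X Y p \<bullet> Z p + Y p \<bullet> D X Z p))"

text \<open>Unique, for a hypersurface \<open>M\<close>, as far as its values on \<open>M\<close> for tangent fields are
  concerned.\<close>

definition levi_civita ::
  "'a::euclidean_space set \<Rightarrow> ('a \<Rightarrow> 'a) \<Rightarrow> ('a \<Rightarrow> 'a) \<Rightarrow> 'a \<Rightarrow> 'a" where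
  "levi_civita M = (SOME D. is_levi_civita M D)"

definition curvature_field ::
  "'a::euclidean_space set \<Rightarrow> ('a \<Rightarrow> 'a) \<Rightarrow> ('a \<Rightarrow> 'a) \<Rightarrow> ('a \<Rightarrow> 'a) \<Rightarrow> 'a \<Rightarrow> 'a" where
  "curvature_field M X Y Z =
     (let D = levi_civita M in
        (\<lambda>p. D X (D Y Z) p - D Y (D X Z) p - D (lie_bracket M X Y) Z p))"

text \<open>The curvature is tensorial, so its value on tangent vectors at \<open>p\<close> may be computed with
  any choice of tangent fields extending them.\<close>

definition field_ext :: "'a::euclidean_space set \<Rightarrow> 'a \<Rightarrow> 'a \<Rightarrow> 'a \<Rightarrow> 'a" where
  "field_ext M p x = (SOME X. tangent_field M X \<and> X p = x)"

definition curvature ::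
  "'a::euclidean_space set \<Rightarrow> 'a \<Rightarrow> 'a \<Rightarrow> 'a \<Rightarrow> 'a \<Rightarrow> 'a" where
  "curvature M p x y z =
     curvature_field M (field_ext M p x) (field_ext M p y) (field_ext M p z) p"

section \<open>Double forms\<close>

text \<open>A \<open>(p,q)\<close> double form on \<open>V\<close> is represented by the function of two lists of vectors of
  \<open>V\<close> which is multilinear and alternating in the entries of each list when the lists have
  lengths \<open>p\<close> and \<open>q\<close>, and which is zero on lists of other lengths.\<close>

type_synonym 'a ext_form = "'a list \<Rightarrow> real"
type_synonym 'a double_form = "'a list \<Rightarrow> 'a list \<Rightarrow> real"

text \<open>The sign of the shuffle which moves the positions in \<open>I\<close> in front of the others.\<close>

definition shuffle_sign :: "nat \<Rightarrow> nat set \<Rightarrow> real" where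
  "shuffle_sign m I = (- 1) ^ card {(i, j). i \<in> I \<and> j \<in> {..<m} - I \<and> j < i}"

text \<open>The bilinear extension of
  $(\alpha_1\otimes\beta_1)(\alpha_2\otimes\beta_2) =
   (\alpha_1\wedge\alpha_2)\otimes(\beta_1\wedge\beta_2)$,
  with the wedge product $(\alpha\wedge\beta)(x) = \sum_I \pm\alpha(x_I)\beta(x_{I^c})$
  over shuffles. Subsets of the wrong size contribute zero, so that no degrees
  need to be given.\<close>

definition dmult :: "'a double_form \<Rightarrow> 'a double_form \<Rightarrow> 'a double_form" where
  "dmult \<omega> \<eta> = (\<lambda>xs ys. \<Sum>I\<in>Pow {..<length xs}. \<Sum>J\<in>Pow {..<length ys}.
     shuffle_sign (length xs) I * shuffle_sign (length ys) J *
     \<omega> (nths xs I) (nths ys J) * \<eta> (nths xs (- I)) (nths ys (- J)))"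

definition dunit :: "'a double_form" where
  "dunit = (\<lambda>xs ys. if xs = [] \<and> ys = [] then 1 else 0)"

primrec dpower :: "'a double_form \<Rightarrow> nat \<Rightarrow> 'a double_form" where
  "dpower \<omega> 0 = dunit"
| "dpower \<omega> (Suc k) = dmult \<omega> (dpower \<omega> k)"

definition orthonormal_basis :: "'a::euclidean_space set \<Rightarrow> 'a list \<Rightarrow> bool" where
  "orthonormal_basis T e \<longleftrightarrow> distinct e \<and> pairwise orthogonal (set e) \<and>
     (\<forall>x\<in>set e. norm x = 1) \<and> span (set e) = T"

text \<open>The volume form $e^1\wedge\dots\wedge e^n$ of an orthonormal basis.\<close>

definition volume_form :: "'a::euclidean_space list \<Rightarrow> 'a ext_form" where
  "volume_form e xs =
     (if length xs = length e
      then \<Sum>\<pi> | \<pi> permutes {..<length e}.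
             of_int (sign \<pi>) * (\<Prod>i<length e. (e ! i) \<bullet> (xs ! \<pi> i))
      else 0)"

text \<open>The Hodge star for the orientation given by \<open>e\<close>: the linear map with
  $\star e^I = \mathrm{vol}(e_I, e_{I^c})\, e^{I^c}$ (\<open>I\<close> and its complement listed increasingly).
  The sum is over all \<open>I\<close>, but only those with \<open>card I + length xs = length e\<close> contribute.\<close>

definition hodge :: "'a::euclidean_space list \<Rightarrow> 'a ext_form \<Rightarrow> 'a ext_form" where
  "hodge e \<alpha> xs = (\<Sum>I\<in>Pow {..<length e}. \<alpha> (nths e I) * volume_form e (nths e I @ xs))"

text \<open>$\star(\theta_1\otimes\theta_2) = (\star\theta_1)\otimes(\star\theta_2)$, extended linearly:
  \<open>hodge\<close> acts on each of the two arguments. The result does not depend on the choice of the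
  orthonormal basis, since a change of orientation changes both signs.\<close>

definition double_hodge :: "'a::euclidean_space set \<Rightarrow> 'a double_form \<Rightarrow> 'a double_form" where
  "double_hodge T \<omega> =
     (let e = (SOME e. orthonormal_basis T e) in
        (\<lambda>xs ys. hodge e (\<lambda>as. hodge e (\<lambda>bs. \<omega> as bs) ys) xs))"

section \<open>Thorpe and anti-Thorpe hypersurfaces\<close>

definition metric_form :: "'a::euclidean_space double_form" where
  "metric_form xs ys = (case (xs, ys) of ([x], [y]) \<Rightarrow> x \<bullet> y | _ \<Rightarrow> 0)"

text \<open>The order of the last two arguments makes \<open>curvature_form M p [x, y] [x, y]\<close> the
  sectional curvature for orthonormal \<open>x\<close>, \<open>y\<close>.\<close>

definition curvature_form :: "'a::euclidean_space set \<Rightarrow> 'a \<Rightarrow> 'a double_form" where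
  "curvature_form M p xs ys =
     (case (xs, ys) of ([x, y], [z, w]) \<Rightarrow> curvature M p x y w \<bullet> z | _ \<Rightarrow> 0)"

text \<open>$g^{r-2k}R^k$ at \<open>p\<close>, an \<open>(r,r)\<close> double form if \<open>2 * k \<le> r\<close>.\<close>

definition thorpe_form :: "nat \<Rightarrow> nat \<Rightarrow> 'a::euclidean_space set \<Rightarrow> 'a \<Rightarrow> 'a double_form" where
  "thorpe_form r k M p =
     dmult (dpower metric_form (r - 2 * k)) (dpower (curvature_form M p) k)"

text \<open>The $(2k)$-Thorpe and $(2k)$-anti-Thorpe conditions for \<open>M\<close> of dimension \<open>2 * r\<close>.\<close>

definition thorpe :: "nat \<Rightarrow> nat \<Rightarrow> 'a::euclidean_space set \<Rightarrow> bool" where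
  "thorpe r k M \<longleftrightarrow> (\<forall>p\<in>M. \<forall>xs\<in>lists (tangent_space M p). \<forall>ys\<in>lists (tangent_space M p).
     double_hodge (tangent_space M p) (thorpe_form r k M p) xs ys = thorpe_form r k M p xs ys)"

definition anti_thorpe :: "nat \<Rightarrow> nat \<Rightarrow> 'a::euclidean_space set \<Rightarrow> bool" where
  "anti_thorpe r k M \<longleftrightarrow> (\<forall>p\<in>M. \<forall>xs\<in>lists (tangent_space M p). \<forall>ys\<in>lists (tangent_space M p).
     double_hodge (tangent_space M p) (thorpe_form r k M p) xs ys = - thorpe_form r k M p xs ys)"

end

theory Submission
  imports Defs
begin

text \<open>Let $h$ be the second fundamental form at a point, with principal curvatures $\lambda_i$ in an
  orthonormal basis $(f_i)$. By the Gauss equation $R = h^2/2$, so $g^{r-2k}R^k$ is diagonal in the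
  basis of the $f^I\otimes f^J$, and its entry at $I$ is a positive multiple of the elementary symmetric
  polynomial $e_{2k}(\lambda_I)$. As the double Hodge star exchanges the entries at $I$ and $I^c$, the
  (anti-)Thorpe condition reads $e_{2k}(\lambda_{I^c}) = \pm e_{2k}(\lambda_I)$ for $|I| = r$. At a point
  farthest from the origin $h$ is definite, which excludes the minus sign. For the plus sign,
  exchanging $i\in I$ with $j\notin I$ gives $(\lambda_i-\lambda_j)(e_{2k-1}(\lambda_A)+e_{2k-1}(\lambda_C)) = 0$
  with $A = I - i$ and $C = I^c - j$, so the hypersurface is umbilic wherever $h$ is definite. By the Codazzi equation the centre of
  curvature is then locally constant, and the set of points which are umbilic with a given centre
  is open and closed.\<close>

section \<open>Smooth maps\<close>

text \<open>The inequality 4k \<le> n, that is 2k \<le> r, makes the symmetric polynomials strict: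
  for curvatures of one sign, e_{2k} on r indices and e_{2k-1} on r - 1 indices are sums over
  nonempty families of terms of one sign. So it is definiteness together with the Thorpe equation
  that forces equal curvatures, and at first definiteness is known at a single point only. It
  spreads because an umbilic point of nonzero curvature is itself definite, and definiteness is an
  open condition. No global unit normal is available. All computations use local gradient fields
  \<open>N\<close> of arbitrary length and orientation, so every statement has to be insensitive to
  rescaling \<open>N\<close>. Two objects are given by Hilbert choice. For the Levi-Civita
  connection, existence and uniqueness are proved, so that it can be replaced by the projected
  ambient derivative. For the basis inside the Hodge star, every orientation sign turns out to enter
  squared. Being totally umbilic only places \<open>M\<close> inside a sphere; equality holds
  because \<open>M\<close> is open and closed in it. The converse requires slice charts for the
  sphere, obtained by inversion.\<close>

abbreviation fd :: "('a::real_normed_vector \<Rightarrow> 'b::real_normed_vector) \<Rightarrow> 'a \<Rightarrow> 'a \<Rightarrow> 'b" where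
  "fd f x \<equiv> frechet_derivative f (at x)"

lemma fd_eqI: "(f has_derivative f') (at x) \<Longrightarrow> fd f x = f'"
  by (metis frechet_derivative_at)

text \<open>Differentiability is not assumed: the derivative is a Hilbert choice, and both functions
  have the same candidates at \<open>x\<close>.\<close>

lemma fd_cong_open:
  assumes "open S" "x \<in> S" "\<And>y. y \<in> S \<Longrightarrow> f y = g y"
  shows "fd f x = fd g x"
proof -
  have "(f has_derivative f') (at x) \<longleftrightarrow> (g has_derivative f') (at x)" for f'
    using has_derivative_transform_within_open[of f f' x UNIV S g]
      has_derivative_transform_within_open[of g f' x UNIV S f] assms by auto
  then show ?thesis by (simp add: frechet_derivative_def)
qed

lemma Ck_on_cong:
  assumes "open S" "\<And>x. x \<in> S \<Longrightarrow> f x = g x"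
  shows "Ck_on k S f \<longleftrightarrow> Ck_on k S g"
  using assms(2)
proof (induction k arbitrary: f g)
  case 0
  then show ?case by (auto cong: continuous_on_cong)
next
  case (Suc k)
  have 1: "f differentiable at x \<longleftrightarrow> g differentiable at x" if "x \<in> S" for x
    using has_derivative_transform_within_open[of f _ x UNIV S g]
      has_derivative_transform_within_open[of g _ x UNIV S f] assms(1) Suc.prems that
    unfolding differentiable_def by auto
  have "fd f x = fd g x" if "x \<in> S" for x
    using fd_cong_open[OF assms(1) that] Suc.prems by blast
  then have "Ck_on k S (\<lambda>x. fd f x v) \<longleftrightarrow> Ck_on k S (\<lambda>x. fd g x v)" for v
    by (intro Suc.IH) auto
  then show ?case using 1 by auto
qed

lemma Ck_on_lower: "Ck_on (Suc k) S f \<Longrightarrow> Ck_on k S f"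
proof (induction k arbitrary: f)
  case 0
  then show ?case
    by (simp add: continuous_at_imp_continuous_on differentiable_imp_continuous_within)
next
  case (Suc k)
  then show ?case by simp
qed

lemma Ck_on_subset: "Ck_on k S f \<Longrightarrow> T \<subseteq> S \<Longrightarrow> Ck_on k T f"
  by (induction k arbitrary: f) (auto intro: continuous_on_subset)

lemma Ck_on_const: "Ck_on k S (\<lambda>x. c)"
  by (induction k arbitrary: c) auto

text \<open>Lets the closure rules below work with an explicit derivative instead of the chosen
  one.\<close>

lemma Ck_on_SucI:
  assumes "open S" "\<And>x. x \<in> S \<Longrightarrow> (f has_derivative f' x) (at x)" "\<And>v. Ck_on k S (\<lambda>x. f' x v)"
  shows "Ck_on (Suc k) S f"
proof -
  have "Ck_on k S (\<lambda>x. fd f x v)" for v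
    using assms(3)[of v] fd_eqI[OF assms(2)] Ck_on_cong[OF assms(1), of "\<lambda>x. f' x v" "\<lambda>x. fd f x v"] by simp
  then show ?thesis using assms(2)[THEN differentiableI] by simp
qed

lemma Ck_on_bounded_linear_compose:
  assumes "open S" "bounded_linear h" "Ck_on k S f"
  shows "Ck_on k S (\<lambda>x. h (f x))"
  using assms(3)
proof (induction k arbitrary: f)
  case 0
  then show ?case using assms(2) by (auto intro: bounded_linear.continuous_on)
next
  case (Suc k)
  have der: "((\<lambda>x. h (f x)) has_derivative (\<lambda>v. h (fd f x v))) (at x)" if "x \<in> S" for x
    using Suc.prems that by (intro bounded_linear.has_derivative[OF assms(2)])
      (simp add: frechet_derivative_works[symmetric])
  have "Ck_on k S (\<lambda>x. h (fd f x v))" for v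
    using Suc by auto
  with assms(1) der show ?case by (rule Ck_on_SucI)
qed

lemma Ck_on_add:
  assumes "open S" "Ck_on k S f" "Ck_on k S g"
  shows "Ck_on k S (\<lambda>x. f x + g x)"
  using assms(2,3)
proof (induction k arbitrary: f g)
  case 0
  then show ?case by (auto intro: continuous_on_add)
next
  case (Suc k)
  have der: "((\<lambda>x. f x + g x) has_derivative (\<lambda>v. fd f x v + fd g x v)) (at x)" if "x \<in> S" for x
    using Suc.prems that by (intro has_derivative_add) (auto simp: frechet_derivative_works)
  have "Ck_on k S (\<lambda>x. fd f x v + fd g x v)" for v
    using Suc by auto
  with assms(1) der show ?case by (rule Ck_on_SucI)
qed

lemma Ck_on_bilinear:
  assumes "open S" "bounded_bilinear b" "Ck_on k S f" "Ck_on k S g"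
  shows "Ck_on k S (\<lambda>x. b (f x) (g x))"
  using assms(3,4)
proof (induction k arbitrary: f g)
  case 0
  then show ?case using assms(2) by (auto intro: bounded_bilinear.continuous_on)
next
  case (Suc k)
  have der: "((\<lambda>x. b (f x) (g x)) has_derivative (\<lambda>v. b (f x) (fd g x v) + b (fd f x v) (g x))) (at x)"
    if "x \<in> S" for x
    using Suc.prems that
    by (intro bounded_bilinear.FDERIV[OF assms(2)]) (auto simp: frechet_derivative_works)
  have "Ck_on k S (\<lambda>x. b (f x) (fd g x v) + b (fd f x v) (g x))" for v
    using Suc.prems Ck_on_lower[OF Suc.prems(1)] Ck_on_lower[OF Suc.prems(2)]
    by (intro Ck_on_add[OF assms(1)] Suc.IH) auto
  with assms(1) der show ?case by (rule Ck_on_SucI)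
qed

lemma Ck_on_sum:
  assumes "open S" "\<And>i. i \<in> I \<Longrightarrow> Ck_on k S (f i)"
  shows "Ck_on k S (\<lambda>x. \<Sum>i\<in>I. f i x)"
  using assms(2)
  by (induction I rule: infinite_finite_induct) (auto intro: Ck_on_const Ck_on_add[OF assms(1)])

lemma linear_fd: "f differentiable at x \<Longrightarrow> linear (fd f x)"
  by (simp add: frechet_derivative_works has_derivative_linear)

text \<open>\<open>Ck_on\<close> controls derivatives in fixed directions only. Expanding in
  \<open>Basis\<close> is what gives access to directions that vary with the point.\<close>

lemma fd_expand:
  fixes v :: "'a::euclidean_space"
  assumes "f differentiable at x"
  shows "fd f x v = (\<Sum>b\<in>Basis. (v \<bullet> b) *\<^sub>R fd f x b)"
proof -
  interpret linear "fd f x" by (rule linear_fd[OF assms])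
  have "fd f x v = fd f x (\<Sum>b\<in>Basis. (v \<bullet> b) *\<^sub>R b)" by (simp add: euclidean_representation)
  then show ?thesis by (simp add: sum scaleR)
qed

text \<open>The chain rule differentiates \<open>g\<close> in a direction depending on
  \<open>x\<close>. After expansion in \<open>Basis\<close> only the functions
  \<open>\<lambda>y. fd g y b\<close> composed with \<open>f\<close> occur, and to these the
  induction hypothesis, general in \<open>g\<close>, applies.\<close>

lemma Ck_on_compose:
  fixes f :: "'a::real_normed_vector \<Rightarrow> 'b::euclidean_space" and g :: "'b \<Rightarrow> 'c::real_normed_vector"
  assumes "open S" "f ` S \<subseteq> T" "Ck_on k S f" "Ck_on k T g"
  shows "Ck_on k S (\<lambda>x. g (f x))"
  using assms(3,4)
proof (induction k arbitrary: g)
  case 0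
  then show ?case using assms(2) by (auto intro: continuous_on_compose2)
next
  case (Suc k)
  have der: "((\<lambda>x. g (f x)) has_derivative (\<lambda>v. fd g (f x) (fd f x v))) (at x)"
    if "x \<in> S" for x
  proof -
    have "f differentiable at x" "g differentiable at (f x)" using Suc.prems assms(2) that by auto
    then show ?thesis
      using diff_chain_at[of f "fd f x" x g "fd g (f x)"] by (simp add: frechet_derivative_works o_def)
  qed
  have "Ck_on k S (\<lambda>x. \<Sum>b\<in>Basis. (fd f x v \<bullet> b) *\<^sub>R fd g (f x) b)" for v
    using Suc.prems Ck_on_lower[OF Suc.prems(1)]
    by (intro Ck_on_sum Ck_on_bilinear[OF assms(1) bounded_bilinear_scaleR] Suc.IH assms(1)
        Ck_on_bounded_linear_compose[OF assms(1) bounded_linear_inner_left]) auto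
  moreover have "(\<Sum>b\<in>Basis. (fd f x v \<bullet> b) *\<^sub>R fd g (f x) b) = fd g (f x) (fd f x v)"
    if "x \<in> S" for x v
    using fd_expand[of g "f x" "fd f x v"] Suc.prems assms(2) that by auto
  ultimately have "Ck_on k S (\<lambda>x. fd g (f x) (fd f x v))" for v
    using Ck_on_cong[OF assms(1), of "\<lambda>x. \<Sum>b\<in>Basis. (fd f x v \<bullet> b) *\<^sub>R fd g (f x) b"
        "\<lambda>x. fd g (f x) (fd f x v)" k] by blast
  with assms(1) der show ?case by (rule Ck_on_SucI)
qed

lemma Ck_on_inverse:
  fixes f :: "'a::real_normed_vector \<Rightarrow> real"
  assumes "open S" "\<And>x. x \<in> S \<Longrightarrow> f x \<noteq> 0" "Ck_on k S f"
  shows "Ck_on k S (\<lambda>x. inverse (f x))"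
  using assms(3)
proof (induction k)
  case 0
  then show ?case using assms(2) by (auto intro: continuous_on_inverse)
next
  case (Suc k)
  have der: "((\<lambda>x. inverse (f x)) has_derivative (\<lambda>v. - (inverse (f x) * fd f x v * inverse (f x)))) (at x)"
    if "x \<in> S" for x
    using Suc.prems that assms(2) by (intro Deriv.has_derivative_inverse) (auto simp: frechet_derivative_works)
  have "Ck_on k S (\<lambda>x. inverse (f x))"
    using Suc.IH Ck_on_lower[OF Suc.prems] by blast
  then have "Ck_on k S (\<lambda>x. - (inverse (f x) * fd f x v * inverse (f x)))" for v
    using Suc.prems
    by (intro Ck_on_bounded_linear_compose[OF assms(1) bounded_linear_minus[OF bounded_linear_ident]]
       Ck_on_bilinear[OF assms(1) bounded_bilinear_mult]) auto
  with assms(1) der show ?case by (rule Ck_on_SucI)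
qed

lemma Ck_on_ident: "Ck_on k S (\<lambda>x. x)"
  by (cases k) (auto intro: Ck_on_const)

lemma smooth_on_cong: "open S \<Longrightarrow> (\<And>x. x \<in> S \<Longrightarrow> f x = g x) \<Longrightarrow> smooth_on S f \<longleftrightarrow> smooth_on S g"
  unfolding smooth_on_def using Ck_on_cong by blast

lemma smooth_on_subset: "smooth_on S f \<Longrightarrow> T \<subseteq> S \<Longrightarrow> smooth_on T f"
  unfolding smooth_on_def using Ck_on_subset by blast

lemma smooth_on_const: "smooth_on S (\<lambda>x. c)"
  by (simp add: smooth_on_def Ck_on_const)

lemma smooth_on_ident: "smooth_on S (\<lambda>x. x)"
  by (simp add: smooth_on_def Ck_on_ident)

lemma smooth_on_linear: "open S \<Longrightarrow> bounded_linear h \<Longrightarrow> smooth_on S f \<Longrightarrow> smooth_on S (\<lambda>x. h (f x))"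
  by (simp add: smooth_on_def Ck_on_bounded_linear_compose)

lemma smooth_on_minus: "open S \<Longrightarrow> smooth_on S f \<Longrightarrow> smooth_on S (\<lambda>x. - f x)"
  by (rule smooth_on_linear[OF _ bounded_linear_minus[OF bounded_linear_ident]])

lemma smooth_on_add: "open S \<Longrightarrow> smooth_on S f \<Longrightarrow> smooth_on S g \<Longrightarrow> smooth_on S (\<lambda>x. f x + g x)"
  by (simp add: smooth_on_def Ck_on_add)

lemma smooth_on_diff: "open S \<Longrightarrow> smooth_on S f \<Longrightarrow> smooth_on S g \<Longrightarrow> smooth_on S (\<lambda>x. f x - g x)"
  using smooth_on_add[of S f "\<lambda>x. - g x"] smooth_on_minus[of S g] by simp

lemma smooth_on_scaleR: "open S \<Longrightarrow> smooth_on S f \<Longrightarrow> smooth_on S g \<Longrightarrow> smooth_on S (\<lambda>x. f x *\<^sub>R g x)"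
  by (simp add: smooth_on_def Ck_on_bilinear[OF _ bounded_bilinear_scaleR])

lemma smooth_on_mult:
  fixes f g :: "'a::real_normed_vector \<Rightarrow> real"
  shows "open S \<Longrightarrow> smooth_on S f \<Longrightarrow> smooth_on S g \<Longrightarrow> smooth_on S (\<lambda>x. f x * g x)"
  by (simp add: smooth_on_def Ck_on_bilinear[OF _ bounded_bilinear_mult])

lemma smooth_on_inner: "open S \<Longrightarrow> smooth_on S f \<Longrightarrow> smooth_on S g \<Longrightarrow> smooth_on S (\<lambda>x. f x \<bullet> g x)"
  by (simp add: smooth_on_def Ck_on_bilinear[OF _ bounded_bilinear_inner])

lemma smooth_on_inverse:
  fixes f :: "'a::real_normed_vector \<Rightarrow> real"
  shows "open S \<Longrightarrow> (\<And>x. x \<in> S \<Longrightarrow> f x \<noteq> 0) \<Longrightarrow> smooth_on S f \<Longrightarrow> smooth_on S (\<lambda>x. inverse (f x))"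
  by (simp add: smooth_on_def Ck_on_inverse)

lemma smooth_on_divide:
  fixes f g :: "'a::real_normed_vector \<Rightarrow> real"
  shows "open S \<Longrightarrow> (\<And>x. x \<in> S \<Longrightarrow> g x \<noteq> 0) \<Longrightarrow> smooth_on S f \<Longrightarrow> smooth_on S g \<Longrightarrow>
    smooth_on S (\<lambda>x. f x / g x)"
  unfolding divide_inverse by (intro smooth_on_mult smooth_on_inverse)

lemma smooth_on_sum:
  "open S \<Longrightarrow> (\<And>i. i \<in> I \<Longrightarrow> smooth_on S (f i)) \<Longrightarrow> smooth_on S (\<lambda>x. \<Sum>i\<in>I. f i x)"
  by (simp add: smooth_on_def Ck_on_sum)

lemma smooth_on_compose:
  fixes f :: "'a::real_normed_vector \<Rightarrow> 'b::euclidean_space" and g :: "'b \<Rightarrow> 'c::real_normed_vector"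
  shows "open S \<Longrightarrow> f ` S \<subseteq> T \<Longrightarrow> smooth_on S f \<Longrightarrow> smooth_on T g \<Longrightarrow> smooth_on S (\<lambda>x. g (f x))"
  unfolding smooth_on_def using Ck_on_compose by blast

lemma smooth_on_fd: "smooth_on S f \<Longrightarrow> smooth_on S (\<lambda>x. fd f x v)"
  unfolding smooth_on_def by (metis Ck_on.simps(2))

lemma smooth_on_differentiable: "smooth_on S f \<Longrightarrow> x \<in> S \<Longrightarrow> f differentiable at x"
  unfolding smooth_on_def by (metis Ck_on.simps(2))

lemma smooth_on_has_derivative: "smooth_on S f \<Longrightarrow> x \<in> S \<Longrightarrow> (f has_derivative fd f x) (at x)"
  using smooth_on_differentiable frechet_derivative_works by blast

lemma smooth_on_continuous: "smooth_on S f \<Longrightarrow> continuous_on S f"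
  unfolding smooth_on_def by (metis Ck_on.simps(1))

lemma smooth_on_fd_field:
  fixes X :: "'a::euclidean_space \<Rightarrow> 'a"
  assumes "open S" "smooth_on S f" "smooth_on S X"
  shows "smooth_on S (\<lambda>x. fd f x (X x))"
proof -
  have "smooth_on S (\<lambda>x. \<Sum>b\<in>Basis. (X x \<bullet> b) *\<^sub>R fd f x b)"
    by (intro smooth_on_sum smooth_on_scaleR smooth_on_inner smooth_on_const smooth_on_fd assms)
  then show ?thesis
    by (subst smooth_on_cong[OF assms(1)]) (rule fd_expand, rule smooth_on_differentiable[OF assms(2)])
qed

section \<open>Rules for derivatives along vector fields\<close>

lemma fd_add: "f differentiable at x \<Longrightarrow> g differentiable at x \<Longrightarrow>
    fd (\<lambda>x. f x + g x) x v = fd f x v + fd g x v"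
  by (subst fd_eqI[OF has_derivative_add]) (auto simp: frechet_derivative_works)

lemma fd_diff: "f differentiable at x \<Longrightarrow> g differentiable at x \<Longrightarrow>
    fd (\<lambda>x. f x - g x) x v = fd f x v - fd g x v"
  by (subst fd_eqI[OF has_derivative_diff]) (auto simp: frechet_derivative_works)

lemma fd_scaleR: "f differentiable at x \<Longrightarrow> g differentiable at x \<Longrightarrow>
    fd (\<lambda>x. f x *\<^sub>R g x) x v = f x *\<^sub>R fd g x v + fd f x v *\<^sub>R g x"
  by (subst fd_eqI[OF has_derivative_scaleR]) (auto simp: frechet_derivative_works)

lemma fd_inner: "f differentiable at x \<Longrightarrow> g differentiable at x \<Longrightarrow>
    fd (\<lambda>x. f x \<bullet> g x) x v = f x \<bullet> fd g x v + fd f x v \<bullet> g x"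
  by (subst fd_eqI[OF has_derivative_inner]) (auto simp: frechet_derivative_works)

text \<open>The product rule for the pairing of the derivative of \<open>f\<close> with
  \<open>X\<close>: one term freezes the field, the other differentiates it.\<close>

lemma fd_fd_field:
  fixes X :: "'a::euclidean_space \<Rightarrow> 'a"
  assumes "open S" "smooth_on S f" "smooth_on S X" "x \<in> S"
  shows "fd (\<lambda>q. fd f q (X q)) x v = fd (\<lambda>q. fd f q (X x)) x v + fd f x (fd X x v)"
proof -
  have dX: "X differentiable at x" using assms smooth_on_differentiable by blast
  have df: "f differentiable at x" using assms smooth_on_differentiable by blast
  have 1: "((\<lambda>q. (X q \<bullet> b) *\<^sub>R fd f q b) has_derivative
      (\<lambda>v. (X x \<bullet> b) *\<^sub>R fd (\<lambda>q. fd f q b) x v + (fd X x v \<bullet> b) *\<^sub>R fd f x b)) (at x)" for b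
    using smooth_on_has_derivative[OF assms(3,4)] smooth_on_has_derivative[OF smooth_on_fd[OF assms(2)] assms(4)]
    by (intro has_derivative_scaleR has_derivative_inner_left)
  have 2: "((\<lambda>q. (w \<bullet> b) *\<^sub>R fd f q b) has_derivative
      (\<lambda>v. (w \<bullet> b) *\<^sub>R fd (\<lambda>q. fd f q b) x v)) (at x)" for b w
    using smooth_on_has_derivative[OF smooth_on_fd[OF assms(2)] assms(4)]
    by (intro has_derivative_scaleR_right)
  have "fd (\<lambda>q. fd f q (X q)) x = fd (\<lambda>q. \<Sum>b\<in>Basis. (X q \<bullet> b) *\<^sub>R fd f q b) x"
    by (rule fd_cong_open[OF assms(1,4)]) (rule fd_expand, rule smooth_on_differentiable[OF assms(2)])
  also have "\<dots> = (\<lambda>v. \<Sum>b\<in>Basis. (X x \<bullet> b) *\<^sub>R fd (\<lambda>q. fd f q b) x v + (fd X x v \<bullet> b) *\<^sub>R fd f x b)"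
    by (intro fd_eqI has_derivative_sum 1)
  finally have A: "fd (\<lambda>q. fd f q (X q)) x v =
     (\<Sum>b\<in>Basis. (X x \<bullet> b) *\<^sub>R fd (\<lambda>q. fd f q b) x v) + (\<Sum>b\<in>Basis. (fd X x v \<bullet> b) *\<^sub>R fd f x b)"
    by (simp add: sum.distrib)
  have "fd (\<lambda>q. fd f q (X x)) x = fd (\<lambda>q. \<Sum>b\<in>Basis. (X x \<bullet> b) *\<^sub>R fd f q b) x"
    by (rule fd_cong_open[OF assms(1,4)]) (rule fd_expand, rule smooth_on_differentiable[OF assms(2)])
  also have "\<dots> = (\<lambda>v. \<Sum>b\<in>Basis. (X x \<bullet> b) *\<^sub>R fd (\<lambda>q. fd f q b) x v)"
    by (intro fd_eqI has_derivative_sum 2)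
  finally show ?thesis using A fd_expand[OF df, of "fd X x v"] by simp
qed

section \<open>Symmetry of second derivatives\<close>

text \<open>The mean value theorem is applied in direction \<open>u\<close> to the difference of
  \<open>f\<close> across \<open>h *\<^sub>R v\<close>, then in direction \<open>v\<close> to the
  derivative along \<open>u\<close>. The left-hand side is symmetric in \<open>u\<close> and
  \<open>v\<close>, so both mixed derivatives can be compared with it.\<close>

lemma second_difference_mvt:
  fixes f :: "'a::real_normed_vector \<Rightarrow> real"
  assumes "Ck_on 2 S f" "h > 0" "\<And>s t. 0 \<le> s \<Longrightarrow> s \<le> h \<Longrightarrow> 0 \<le> t \<Longrightarrow> t \<le> h \<Longrightarrow> x + s *\<^sub>R u + t *\<^sub>R v \<in> S"
  shows "\<exists>s t. 0 < s \<and> s < h \<and> 0 < t \<and> t < h \<and>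
    f (x + h *\<^sub>R u + h *\<^sub>R v) - f (x + h *\<^sub>R u) - f (x + h *\<^sub>R v) + f x =
      h * h * fd (\<lambda>q. fd f q u) (x + s *\<^sub>R u + t *\<^sub>R v) v"
proof -
  have df: "f differentiable at y" if "y \<in> S" for y using assms(1) that by (simp add: numeral_2_eq_2)
  have ddf: "(\<lambda>q. fd f q u) differentiable at y" if "y \<in> S" for y
    using assms(1) that by (simp add: numeral_2_eq_2)
  have line: "((\<lambda>s. g (y + s *\<^sub>R w)) has_real_derivative fd g (y + s *\<^sub>R w) w) (at s)"
    if "g differentiable at (y + s *\<^sub>R w)" for g :: "'a \<Rightarrow> real" and y w s
  proof -
    have "((\<lambda>s. y + s *\<^sub>R w) has_derivative (\<lambda>r. r *\<^sub>R w)) (at s)"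
      by (auto intro!: derivative_eq_intros)
    moreover have "(g has_derivative fd g (y + s *\<^sub>R w)) (at (y + s *\<^sub>R w))"
      using that frechet_derivative_works by blast
    ultimately have "((\<lambda>s. g (y + s *\<^sub>R w)) has_derivative (\<lambda>r. fd g (y + s *\<^sub>R w) (r *\<^sub>R w))) (at s)"
      using diff_chain_at[of "\<lambda>s. y + s *\<^sub>R w" "\<lambda>r. r *\<^sub>R w" s g] by (simp add: o_def)
    moreover have "fd g (y + s *\<^sub>R w) (r *\<^sub>R w) = fd g (y + s *\<^sub>R w) w * r" for r
      using linear_fd[OF that] by (simp add: linear_cmul)
    ultimately show ?thesis by (simp add: has_field_derivative_def)
  qed
  define \<phi> where "\<phi> s = f ((x + h *\<^sub>R v) + s *\<^sub>R u) - f (x + s *\<^sub>R u)" for s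
  have "\<exists>s. 0 < s \<and> s < h \<and> \<phi> h - \<phi> 0 = (h - 0) * (fd f ((x + h *\<^sub>R v) + s *\<^sub>R u) u - fd f (x + s *\<^sub>R u) u)"
  proof (intro MVT2 assms(2))
    fix s assume s: "0 \<le> s" "s \<le> h"
    have "x + h *\<^sub>R v + s *\<^sub>R u \<in> S" using assms(3)[of s h] s assms(2) by (simp add: algebra_simps)
    moreover have "x + s *\<^sub>R u \<in> S" using assms(3)[of s 0] s assms(2) by simp
    ultimately show "(\<phi> has_real_derivative fd f (x + h *\<^sub>R v + s *\<^sub>R u) u - fd f (x + s *\<^sub>R u) u) (at s)"
      unfolding \<phi>_def by (intro DERIV_diff line df)
  qed
  then obtain s where s: "0 < s" "s < h"
    and 1: "\<phi> h - \<phi> 0 = h * (fd f ((x + h *\<^sub>R v) + s *\<^sub>R u) u - fd f (x + s *\<^sub>R u) u)" by auto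
  define \<psi> where "\<psi> t = fd f ((x + s *\<^sub>R u) + t *\<^sub>R v) u" for t
  have "\<exists>t. 0 < t \<and> t < h \<and> \<psi> h - \<psi> 0 = (h - 0) * fd (\<lambda>q. fd f q u) ((x + s *\<^sub>R u) + t *\<^sub>R v) v"
  proof (intro MVT2 assms(2))
    fix t assume t: "0 \<le> t" "t \<le> h"
    show "(\<psi> has_real_derivative fd (\<lambda>q. fd f q u) (x + s *\<^sub>R u + t *\<^sub>R v) v) (at t)"
      unfolding \<psi>_def using assms(3)[of s t] s t by (intro line ddf) auto
  qed
  then obtain t where t: "0 < t" "t < h"
    and 2: "\<psi> h - \<psi> 0 = h * fd (\<lambda>q. fd f q u) ((x + s *\<^sub>R u) + t *\<^sub>R v) v" by auto
  have "\<psi> h - \<psi> 0 = fd f ((x + h *\<^sub>R v) + s *\<^sub>R u) u - fd f (x + s *\<^sub>R u) u"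
    unfolding \<psi>_def by (simp add: algebra_simps)
  then have "\<phi> h - \<phi> 0 = h * h * fd (\<lambda>q. fd f q u) ((x + s *\<^sub>R u) + t *\<^sub>R v) v"
    using 1 2 by simp
  moreover have "\<phi> h - \<phi> 0 = f (x + h *\<^sub>R u + h *\<^sub>R v) - f (x + h *\<^sub>R u) - f (x + h *\<^sub>R v) + f x"
    unfolding \<phi>_def by (simp add: algebra_simps)
  ultimately show ?thesis using s t by metis
qed

lemma second_derivative_symmetric_real:
  fixes f :: "'a::real_normed_vector \<Rightarrow> real"
  assumes "open S" "x \<in> S" "Ck_on 2 S f"
  shows "fd (\<lambda>q. fd f q u) x v = fd (\<lambda>q. fd f q v) x u"
proof (rule ccontr)
  define G where "G u v q = fd (\<lambda>q. fd f q u) q v" for u v q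
  assume neq: "fd (\<lambda>q. fd f q u) x v \<noteq> fd (\<lambda>q. fd f q v) x u"
  \<comment> \<open>Half the supposed gap: values within \<open>e\<close> of the two mixed
    derivatives at \<open>x\<close> can never coincide.\<close>
  define e where "e = \<bar>G u v x - G v u x\<bar> / 2"
  have e: "e > 0" using neq by (simp add: e_def G_def)
  have cont: "continuous_on S (G u v)" for u v
    using assms(3) unfolding G_def by (simp add: numeral_2_eq_2)
  have "\<exists>d>0. \<forall>y. dist y x < d \<longrightarrow> y \<in> S \<and> \<bar>G u v y - G u v x\<bar> < e" for u v
  proof -
    have "isCont (G u v) x" using cont assms(1,2) continuous_on_eq_continuous_at by blast
    then obtain d1 where d1: "d1 > 0" "\<And>y. dist y x < d1 \<Longrightarrow> dist (G u v y) (G u v x) < e"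
      unfolding continuous_at_eps_delta using e by (metis dist_commute)
    obtain d2 where "d2 > 0" "\<And>y. dist y x < d2 \<Longrightarrow> y \<in> S"
      using assms(1,2) unfolding open_dist by blast
    then show ?thesis using d1 by (intro exI[of _ "min d1 d2"]) (auto simp: dist_real_def)
  qed
  then obtain d1 d2 where d: "d1 > 0" "d2 > 0"
    "\<And>y. dist y x < d1 \<Longrightarrow> y \<in> S \<and> \<bar>G u v y - G u v x\<bar> < e"
    "\<And>y. dist y x < d2 \<Longrightarrow> y \<in> S \<and> \<bar>G v u y - G v u x\<bar> < e" by metis
  \<comment> \<open>Small enough to keep both parallelograms within both neighbourhoods of
    \<open>x\<close>; the summand 1 keeps the denominator positive when \<open>u\<close> and
    \<open>v\<close> vanish.\<close>
  define h where "h = min d1 d2 / (2 * (1 + norm u + norm v))"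
  have pos: "1 + norm u + norm v > 0" by (simp add: add_pos_nonneg)
  have h: "h > 0" unfolding h_def using d pos by simp
  have near: "dist (x + s *\<^sub>R a + t *\<^sub>R b) x < min d1 d2"
    if "0 \<le> s" "s \<le> h" "0 \<le> t" "t \<le> h" "{a, b} = {u, v}" for s t a b
  proof -
    have "dist (x + s *\<^sub>R a + t *\<^sub>R b) x = norm (s *\<^sub>R a + t *\<^sub>R b)" by (simp add: dist_norm add.assoc)
    also have "\<dots> \<le> s * norm a + t * norm b" using that norm_triangle_ineq[of "s *\<^sub>R a" "t *\<^sub>R b"] by simp
    also have "\<dots> \<le> h * norm a + h * norm b" using that by (intro add_mono mult_right_mono) auto
    also have "\<dots> = h * (norm u + norm v)" using that by (auto simp: doubleton_eq_iff algebra_simps)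
    also have "\<dots> < h * (2 * (1 + norm u + norm v))"
      using h pos by (intro mult_strict_left_mono) simp_all
    also have "\<dots> = min d1 d2" unfolding h_def using pos by simp
    finally show ?thesis .
  qed
  obtain s t where st: "0 < s" "s < h" "0 < t" "t < h"
    "f (x + h *\<^sub>R u + h *\<^sub>R v) - f (x + h *\<^sub>R u) - f (x + h *\<^sub>R v) + f x = h * h * G u v (x + s *\<^sub>R u + t *\<^sub>R v)"
    using second_difference_mvt[OF assms(3) h, of x u v] near[of _ _ u v] d(3) unfolding G_def by auto
  obtain s' t' where st': "0 < s'" "s' < h" "0 < t'" "t' < h"
    "f (x + h *\<^sub>R v + h *\<^sub>R u) - f (x + h *\<^sub>R v) - f (x + h *\<^sub>R u) + f x = h * h * G v u (x + s' *\<^sub>R v + t' *\<^sub>R u)"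
    using second_difference_mvt[OF assms(3) h, of x v u] near[of _ _ v u] d(3) unfolding G_def
    by (auto simp: insert_commute)
  have "h * h * G u v (x + s *\<^sub>R u + t *\<^sub>R v) = h * h * G v u (x + s' *\<^sub>R v + t' *\<^sub>R u)"
    using st(5) st'(5) by (simp add: algebra_simps)
  then have "G u v (x + s *\<^sub>R u + t *\<^sub>R v) = G v u (x + s' *\<^sub>R v + t' *\<^sub>R u)" using h by simp
  moreover have "\<bar>G u v (x + s *\<^sub>R u + t *\<^sub>R v) - G u v x\<bar> < e"
    using d(3) near[of s t u v] st by auto
  moreover have "\<bar>G v u (x + s' *\<^sub>R v + t' *\<^sub>R u) - G v u x\<bar> < e"
    using d(4) near[of s' t' v u] st' by (auto simp: insert_commute)
  ultimately show False unfolding e_def by (auto simp: abs_if split: if_splits)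
qed

lemma second_derivative_symmetric:
  fixes f :: "'a::real_normed_vector \<Rightarrow> 'b::euclidean_space"
  assumes "open S" "x \<in> S" "smooth_on S f"
  shows "fd (\<lambda>q. fd f q u) x v = fd (\<lambda>q. fd f q v) x u"
proof (rule euclidean_eqI)
  fix b :: 'b assume "b \<in> Basis"
  have *: "fd (\<lambda>q. g q \<bullet> b) y w = fd g y w \<bullet> b" if "g differentiable at y" for g :: "'a \<Rightarrow> 'b" and y w
    using that by (simp add: fd_inner)
  have **: "fd (\<lambda>q. fd f q u) x v \<bullet> b = fd (\<lambda>q. fd (\<lambda>q. f q \<bullet> b) q u) x v" for u v
  proof -
    have "fd (\<lambda>q. fd (\<lambda>q. f q \<bullet> b) q u) x = fd (\<lambda>q. fd f q u \<bullet> b) x"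
      using * smooth_on_differentiable[OF assms(3)] by (intro fd_cong_open[OF assms(1,2)]) auto
    then show ?thesis using * smooth_on_differentiable[OF smooth_on_fd[OF assms(3)] assms(2)] by simp
  qed
  have "smooth_on S (\<lambda>q. f q \<bullet> b)"
    by (intro smooth_on_inner assms smooth_on_const)
  then show "fd (\<lambda>q. fd f q u) x v \<bullet> b = fd (\<lambda>q. fd f q v) x u \<bullet> b"
    using second_derivative_symmetric_real[OF assms(1,2)] ** unfolding smooth_on_def by auto
qed

text \<open>The second derivatives of \<open>f\<close> cancel by symmetry. This expresses the
  flatness of the ambient space and serves both the Gauss and the Codazzi argument.\<close>

lemma bracket_commutator:
  fixes X Y :: "'a::euclidean_space \<Rightarrow> 'a" and f :: "'a \<Rightarrow> 'b::euclidean_space"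
  assumes "open S" "x \<in> S" "smooth_on S f" "smooth_on S X" "smooth_on S Y"
  shows "fd (\<lambda>q. fd f q (Y q)) x (X x) - fd (\<lambda>q. fd f q (X q)) x (Y x)
    = fd f x (fd Y x (X x) - fd X x (Y x))"
proof -
  have "linear (fd f x)" using assms by (intro linear_fd smooth_on_differentiable)
  then show ?thesis
    using fd_fd_field[OF assms(1,3,5,2), of "X x"] fd_fd_field[OF assms(1,3,4,2), of "Y x"]
      second_derivative_symmetric[OF assms(1,2,3), of "X x" "Y x"]
    by (simp add: linear_diff)
qed

section \<open>Alternating forms\<close>

text \<open>No degree is fixed, so one notion covers lists of all lengths. Alternation is required
  for adjacent equal entries only, which is easy to check for wedge products; the general case
  follows by moving entries together.\<close>

definition alt_on :: "'a::real_vector set \<Rightarrow> 'a ext_form \<Rightarrow> bool" where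
  "alt_on T \<alpha> \<longleftrightarrow> (\<forall>ps\<in>lists T. \<forall>qs\<in>lists T.
     (\<forall>x\<in>T. \<forall>y\<in>T. \<forall>a b. \<alpha> (ps @ (a *\<^sub>R x + b *\<^sub>R y) # qs) = a * \<alpha> (ps @ x # qs) + b * \<alpha> (ps @ y # qs)) \<and>
     (\<forall>x\<in>T. \<alpha> (ps @ x # x # qs) = 0))"

definition double_alt :: "'a::real_vector set \<Rightarrow> 'a double_form \<Rightarrow> bool" where
  "double_alt T \<omega> \<longleftrightarrow> (\<forall>ys\<in>lists T. alt_on T (\<lambda>xs. \<omega> xs ys)) \<and> (\<forall>xs\<in>lists T. alt_on T (\<omega> xs))"

lemma alt_onI:
  assumes "\<And>ps qs x y a b. ps \<in> lists T \<Longrightarrow> qs \<in> lists T \<Longrightarrow> x \<in> T \<Longrightarrow> y \<in> T \<Longrightarrow>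
      \<alpha> (ps @ (a *\<^sub>R x + b *\<^sub>R y) # qs) = a * \<alpha> (ps @ x # qs) + b * \<alpha> (ps @ y # qs)"
    "\<And>ps qs x. ps \<in> lists T \<Longrightarrow> qs \<in> lists T \<Longrightarrow> x \<in> T \<Longrightarrow> \<alpha> (ps @ x # x # qs) = 0"
  shows "alt_on T \<alpha>"
  using assms unfolding alt_on_def by blast

lemma alt_on_lin:
  assumes "alt_on T \<alpha>" "ps \<in> lists T" "qs \<in> lists T" "x \<in> T" "y \<in> T"
  shows "\<alpha> (ps @ (a *\<^sub>R x + b *\<^sub>R y) # qs) = a * \<alpha> (ps @ x # qs) + b * \<alpha> (ps @ y # qs)"
  using assms unfolding alt_on_def by blast

lemma alt_on_add:
  assumes "alt_on T \<alpha>" "ps \<in> lists T" "qs \<in> lists T" "x \<in> T" "y \<in> T"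
  shows "\<alpha> (ps @ (x + y) # qs) = \<alpha> (ps @ x # qs) + \<alpha> (ps @ y # qs)"
  using alt_on_lin[OF assms, of 1 1] by simp

lemma alt_on_adj:
  assumes "alt_on T \<alpha>" "ps \<in> lists T" "qs \<in> lists T" "x \<in> T"
  shows "\<alpha> (ps @ x # x # qs) = 0"
  using assms unfolding alt_on_def by blast

lemma alt_on_sum:
  assumes "\<And>i. i \<in> I \<Longrightarrow> alt_on T (\<alpha> i)"
  shows "alt_on T (\<lambda>xs. \<Sum>i\<in>I. c i * \<alpha> i xs)"
proof (rule alt_onI)
  fix ps qs x y a b assume *: "ps \<in> lists T" "qs \<in> lists T" "x \<in> T" "y \<in> T"
  have "c i * \<alpha> i (ps @ (a *\<^sub>R x + b *\<^sub>R y) # qs) = a * (c i * \<alpha> i (ps @ x # qs)) + b * (c i * \<alpha> i (ps @ y # qs))"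
    if "i \<in> I" for i
    using alt_on_lin[OF assms[OF that] *] by (simp add: algebra_simps)
  then show "(\<Sum>i\<in>I. c i * \<alpha> i (ps @ (a *\<^sub>R x + b *\<^sub>R y) # qs))
     = a * (\<Sum>i\<in>I. c i * \<alpha> i (ps @ x # qs)) + b * (\<Sum>i\<in>I. c i * \<alpha> i (ps @ y # qs))"
    by (simp add: sum_distrib_left flip: sum.distrib)
next
  fix ps qs x assume *: "ps \<in> lists T" "qs \<in> lists T" "x \<in> T"
  show "(\<Sum>i\<in>I. c i * \<alpha> i (ps @ x # x # qs)) = 0"
    using alt_on_adj[OF assms *] by simp
qed

lemma alt_on_append_right:
  assumes "alt_on T \<alpha>" "zs \<in> lists T"
  shows "alt_on T (\<lambda>xs. \<alpha> (xs @ zs))"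
  using alt_on_lin[OF assms(1), of _ "_ @ zs"] alt_on_adj[OF assms(1), of _ "_ @ zs"] assms(2)
  by (intro alt_onI) auto

lemma alt_on_append_left:
  assumes "alt_on T \<alpha>" "zs \<in> lists T"
  shows "alt_on T (\<lambda>xs. \<alpha> (zs @ xs))"
  using alt_on_lin[OF assms(1), of "zs @ _"] alt_on_adj[OF assms(1), of "zs @ _"] assms(2)
  by (intro alt_onI) auto

lemma alt_on_swap:
  assumes "alt_on T \<alpha>" "subspace T" "ps \<in> lists T" "qs \<in> lists T" "x \<in> T" "y \<in> T"
  shows "\<alpha> (ps @ x # y # qs) = - \<alpha> (ps @ y # x # qs)"
proof -
  have xy: "x + y \<in> T" using assms by (simp add: subspace_add)
  have "0 = \<alpha> (ps @ (x + y) # (x + y) # qs)"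
    using alt_on_adj[OF assms(1,3,4) xy] by simp
  also have "\<dots> = \<alpha> (ps @ x # (x + y) # qs) + \<alpha> (ps @ y # (x + y) # qs)"
    using assms xy by (intro alt_on_add[OF assms(1)]) auto
  also have "\<alpha> (ps @ x # (x + y) # qs) = \<alpha> (ps @ x # x # qs) + \<alpha> (ps @ x # y # qs)"
    using alt_on_add[OF assms(1), of "ps @ [x]" qs x y] assms by simp
  also have "\<alpha> (ps @ y # (x + y) # qs) = \<alpha> (ps @ y # x # qs) + \<alpha> (ps @ y # y # qs)"
    using alt_on_add[OF assms(1), of "ps @ [y]" qs x y] assms by simp
  finally show ?thesis using alt_on_adj[OF assms(1,3,4)] assms by simp
qed

text \<open>Only vanishing is tracked, so the sign produced by the move can be ignored.\<close>

lemma alt_on_move: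
  assumes "alt_on T \<alpha>" "subspace T" "qs \<in> lists T" "ps \<in> lists T" "rs \<in> lists T" "x \<in> T"
  shows "\<alpha> (ps @ x # qs @ rs) = 0 \<longleftrightarrow> \<alpha> (ps @ qs @ x # rs) = 0"
  using assms(3,4)
proof (induction qs arbitrary: ps)
  case (Cons q qs)
  then have "\<alpha> (ps @ x # (q # qs) @ rs) = 0 \<longleftrightarrow> \<alpha> ((ps @ [q]) @ x # qs @ rs) = 0"
    using alt_on_swap[OF assms(1,2), of ps "qs @ rs" x q] assms by simp
  also have "\<dots> \<longleftrightarrow> \<alpha> ((ps @ [q]) @ qs @ x # rs) = 0"
    using Cons by (intro Cons.IH) auto
  finally show ?case by simp
qed simp

lemma alt_on_mset:
  assumes "alt_on T \<alpha>" "subspace T" "mset xs = mset ys" "xs \<in> lists T" "ps \<in> lists T"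
  shows "\<alpha> (ps @ xs) = 0 \<longleftrightarrow> \<alpha> (ps @ ys) = 0"
  using assms(3-5)
proof (induction xs arbitrary: ys ps)
  case (Cons x xs)
  have "x \<in> set ys" using Cons.prems by (metis list.set_intros(1) set_mset_mset)
  then obtain us vs where ys: "ys = us @ x # vs" by (meson split_list)
  have m: "mset xs = mset (us @ vs)" using Cons.prems ys by simp
  have uv: "us \<in> lists T" "vs \<in> lists T"
  proof -
    have "set (us @ vs) = set xs" using m by (metis set_mset_mset)
    then show "us \<in> lists T" "vs \<in> lists T" using Cons.prems by auto
  qed
  have "\<alpha> (ps @ x # xs) = 0 \<longleftrightarrow> \<alpha> ((ps @ [x]) @ us @ vs) = 0"
    using Cons.IH[OF m, of "ps @ [x]"] Cons.prems by simp
  also have "\<dots> \<longleftrightarrow> \<alpha> (ps @ us @ x # vs) = 0"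
    using alt_on_move[OF assms(1,2), of us ps vs x] uv Cons.prems by simp
  finally show ?case using ys by simp
qed simp

lemma alt_on_not_distinct:
  assumes "alt_on T \<alpha>" "subspace T" "xs \<in> lists T" "\<not> distinct xs"
  shows "\<alpha> xs = 0"
proof -
  obtain a b c y where xs: "xs = a @ [y] @ b @ [y] @ c" using not_distinct_decomp[OF assms(4)] by blast
  then have "\<alpha> xs = 0 \<longleftrightarrow> \<alpha> (a @ b @ y # y # c) = 0"
    using alt_on_move[OF assms(1,2), of b a "y # c" y] assms(3) by simp
  then show ?thesis using alt_on_adj[OF assms(1), of "a @ b" c y] assms(3) xs by simp
qed

text \<open>A list of distinct basis vectors is a rearrangement of the increasing list
  \<open>nths e I\<close> of the same vectors; any other list has a repetition.\<close>

lemma alt_on_zero_on_basis: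
  assumes "alt_on T \<alpha>" "subspace T" "distinct e" "set e \<subseteq> T"
    "\<And>I. I \<subseteq> {..<length e} \<Longrightarrow> \<alpha> (nths e I) = 0" "xs \<in> lists (set e)"
  shows "\<alpha> xs = 0"
proof (cases "distinct xs")
  case True
  have xsT: "xs \<in> lists T" using assms(4,6) by auto
  define I where "I = {i. i < length e \<and> e ! i \<in> set xs}"
  have "filter (\<lambda>x. x \<in> set xs) e = nths e I" unfolding I_def by (rule filter_eq_nths)
  then have "set (nths e I) = {x \<in> set e. x \<in> set xs}" by (metis set_filter)
  then have "set (nths e I) = set xs" using assms(6) by auto
  then have "mset xs = mset (nths e I)"
    using True assms(3) set_eq_iff_mset_eq_distinct distinct_nthsI by metis
  then show ?thesis
    using alt_on_mset[OF assms(1,2), of xs "nths e I" "[]"] xsT assms(5)[of I] by (auto simp: I_def)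
next
  case False
  then show ?thesis using alt_on_not_distinct[OF assms(1,2)] assms(4,6) by (auto simp: in_lists_conv_set)
qed

text \<open>The prefix \<open>ps\<close> collects the entries already reduced to basis vectors. The
  next entry is treated by induction over the span, the remaining ones by induction over the
  list.\<close>

lemma alt_on_zero:
  assumes "alt_on T \<alpha>" "T = span (set e)" "distinct e"
    "\<And>I. I \<subseteq> {..<length e} \<Longrightarrow> \<alpha> (nths e I) = 0" "xs \<in> lists T" "ps \<in> lists (set e)"
  shows "\<alpha> (ps @ xs) = 0"
  using assms(5,6)
proof (induction xs arbitrary: ps rule: list.induct)
  case Nil
  then show ?case
    using alt_on_zero_on_basis[OF assms(1) _ assms(3) _ assms(4), of ps] assms(2) by (simp add: span_superset)
next
  case (Cons x xs)
  have sub: "subspace T" using assms(2) by simp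
  have psT: "ps \<in> lists T" using Cons.prems assms(2) by (auto intro: span_base)
  have "x \<in> span (set e)" using Cons.prems assms(2) by auto
  \<comment> \<open>Membership in \<open>T\<close> has to accompany the induction, since
    multilinearity is known on \<open>T\<close> only.\<close>
  then have "x \<in> T \<and> \<alpha> (ps @ x # xs) = 0"
  proof (induction rule: span_induct)
    case base
    have lin: "\<alpha> (ps @ (a *\<^sub>R u + b *\<^sub>R v) # xs) = a * \<alpha> (ps @ u # xs) + b * \<alpha> (ps @ v # xs)"
      if "u \<in> T" "v \<in> T" for a b u v
      using alt_on_lin[OF assms(1) psT _ that] Cons.prems by simp
    have "\<alpha> (ps @ 0 # xs) = 0" using lin[of 0 0 0 0] sub by (simp add: subspace_0)
    moreover have "\<alpha> (ps @ (u + v) # xs) = 0"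
      if "u \<in> T" "v \<in> T" "\<alpha> (ps @ u # xs) = 0" "\<alpha> (ps @ v # xs) = 0" for u v
      using lin[of u v 1 1] that by simp
    moreover have "\<alpha> (ps @ (c *\<^sub>R u) # xs) = 0"
      if "u \<in> T" "\<alpha> (ps @ u # xs) = 0" for u c
      using lin[of u 0 c 0] that sub by (simp add: subspace_0)
    ultimately show ?case
      using sub by (auto intro!: subspaceI simp: subspace_0 subspace_add subspace_mul)
  next
    case (step x)
    then show ?case
      using Cons.IH[of "ps @ [x]"] Cons.prems assms(2) by (auto intro: span_base)
  qed
  then show ?case by simp
qed

lemma alt_on_eqI:
  assumes "alt_on T \<alpha>" "alt_on T \<beta>" "T = span (set e)" "distinct e"
    "\<And>I. I \<subseteq> {..<length e} \<Longrightarrow> \<alpha> (nths e I) = \<beta> (nths e I)" "xs \<in> lists T"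
  shows "\<alpha> xs = \<beta> xs"
proof -
  have "alt_on T (\<lambda>xs. \<Sum>i\<in>{True, False}. (if i then 1 else - 1) * (if i then \<alpha> else \<beta>) xs)"
    using assms(1,2) by (intro alt_on_sum) auto
  then have "alt_on T (\<lambda>xs. \<alpha> xs - \<beta> xs)" by simp
  then show ?thesis using alt_on_zero[of T "\<lambda>xs. \<alpha> xs - \<beta> xs" e xs "[]"] assms by simp
qed

lemma in_lists_nths: "xs \<in> lists T \<Longrightarrow> nths xs I \<in> lists T"
  by (auto dest: in_set_nthsD)

lemma double_alt_eqI:
  assumes "double_alt T \<omega>" "double_alt T \<eta>" "T = span (set e)" "distinct e"
    "\<And>I J. I \<subseteq> {..<length e} \<Longrightarrow> J \<subseteq> {..<length e} \<Longrightarrow> \<omega> (nths e I) (nths e J) = \<eta> (nths e I) (nths e J)"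
    "xs \<in> lists T" "ys \<in> lists T"
  shows "\<omega> xs ys = \<eta> xs ys"
proof -
  have "e \<in> lists T" using assms(3) by (auto intro: span_base)
  then have eT: "nths e I \<in> lists T" for I by (rule in_lists_nths)
  have "\<omega> xs (nths e J) = \<eta> xs (nths e J)" if J: "J \<subseteq> {..<length e}" for J
  proof (rule alt_on_eqI[of T "\<lambda>xs. \<omega> xs (nths e J)" "\<lambda>xs. \<eta> xs (nths e J)", OF _ _ assms(3,4) _ assms(6)])
    show "alt_on T (\<lambda>xs. \<omega> xs (nths e J))" "alt_on T (\<lambda>xs. \<eta> xs (nths e J))"
      using assms(1,2) eT unfolding double_alt_def by blast+
  qed (rule assms(5)[OF _ J])
  moreover have "alt_on T (\<omega> xs)" "alt_on T (\<eta> xs)"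
    using assms(1,2,6) unfolding double_alt_def by blast+
  ultimately show ?thesis
    using alt_on_eqI[of T "\<omega> xs" "\<eta> xs", OF _ _ assms(3,4) _ assms(7)] by blast
qed

section \<open>The volume form and expansion in an orthonormal basis\<close>

lemma nth_middle_eq:
  assumes "i \<noteq> length ps"
  shows "(ps @ x # qs) ! i = (ps @ y # qs) ! i"
  using assms by (auto simp: nth_append nth_Cons split: nat.splits)

lemma alt_on_volume_form: "alt_on T (volume_form e)"
proof (rule alt_onI)
  fix ps qs :: "'a list" and x y :: 'a and a b :: real
  let ?n = "length e" and ?j = "length ps"
  define g where "g z \<pi> = (\<Prod>i<?n. (e ! i) \<bullet> ((ps @ z # qs) ! \<pi> i))" for z \<pi>
  show "volume_form e (ps @ (a *\<^sub>R x + b *\<^sub>R y) # qs) = a * volume_form e (ps @ x # qs) + b * volume_form e (ps @ y # qs)"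
  proof (cases "length ps + Suc (length qs) = ?n")
    case True
    have "g (a *\<^sub>R x + b *\<^sub>R y) \<pi> = a * g x \<pi> + b * g y \<pi>" if p: "\<pi> permutes {..<?n}" for \<pi>
    proof -
      \<comment> \<open>The index of the only factor that sees the varied entry; the other factors
        do not depend on it.\<close>
      define i0 where "i0 = inv \<pi> ?j"
      have i0: "i0 \<in> {..<?n}" "\<pi> i0 = ?j"
        using p True permutes_in_image[OF permutes_inv[OF p]] permutes_inverses[OF p] unfolding i0_def by auto
      have rest: "(\<Prod>i\<in>{..<?n} - {i0}. (e ! i) \<bullet> ((ps @ z # qs) ! \<pi> i))
         = (\<Prod>i\<in>{..<?n} - {i0}. (e ! i) \<bullet> ((ps @ 0 # qs) ! \<pi> i))" for z
      proof (rule prod.cong[OF refl])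
        fix i assume "i \<in> {..<?n} - {i0}"
        then have "\<pi> i \<noteq> ?j" using i0 permutes_inj[OF p] by (metis DiffE injD singletonI)
        then show "(e ! i) \<bullet> ((ps @ z # qs) ! \<pi> i) = (e ! i) \<bullet> ((ps @ 0 # qs) ! \<pi> i)"
          using nth_middle_eq[of "\<pi> i" ps z qs 0] by metis
      qed
      have "g z \<pi> = (e ! i0 \<bullet> z) * (\<Prod>i\<in>{..<?n} - {i0}. (e ! i) \<bullet> ((ps @ 0 # qs) ! \<pi> i))" for z
        unfolding g_def using prod.remove[OF _ i0(1), of "\<lambda>i. (e ! i) \<bullet> ((ps @ z # qs) ! \<pi> i)"] rest i0(2)
        by simp
      then show ?thesis by (simp add: inner_add_right inner_scaleR_right algebra_simps)
    qed
    then have "(\<Sum>\<pi> | \<pi> permutes {..<?n}. of_int (sign \<pi>) * g (a *\<^sub>R x + b *\<^sub>R y) \<pi>)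
       = a * (\<Sum>\<pi> | \<pi> permutes {..<?n}. of_int (sign \<pi>) * g x \<pi>) + b * (\<Sum>\<pi> | \<pi> permutes {..<?n}. of_int (sign \<pi>) * g y \<pi>)"
      by (simp add: sum_distrib_left algebra_simps flip: sum.distrib)
    then show ?thesis using True by (simp add: volume_form_def g_def)
  qed (simp add: volume_form_def)
next
  fix ps qs :: "'a list" and x :: 'a
  let ?n = "length e" and ?j = "length ps"
  let ?xs = "ps @ x # x # qs"
  let ?t = "\<lambda>\<pi>. of_int (sign \<pi>) * (\<Prod>i<?n. (e ! i) \<bullet> (?xs ! \<pi> i)) :: real"
  show "volume_form e ?xs = 0"
  proof (cases "length ?xs = ?n")
    case True
    \<comment> \<open>Composition with this transposition fixes every product, because the two
      entries agree, and reverses every sign. Hence the sum is its own negative.\<close>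
    let ?\<tau> = "Transposition.transpose ?j (Suc ?j)"
    have \<tau>: "?\<tau> permutes {..<?n}" using True by (intro permutes_swap_id) auto
    have nth: "?xs ! ?\<tau> k = ?xs ! k" for k
      by (auto simp: Transposition.transpose_def nth_append)
    have "?t (?\<tau> \<circ> \<pi>) = - ?t \<pi>" if "\<pi> permutes {..<?n}" for \<pi>
    proof -
      have "permutation \<pi>" "permutation ?\<tau>" using that \<tau> permutation_permutes by blast+
      then show ?thesis by (simp add: sign_compose sign_swap_id nth)
    qed
    then have "(\<Sum>\<pi> | \<pi> permutes {..<?n}. ?t \<pi>) = - (\<Sum>\<pi> | \<pi> permutes {..<?n}. ?t \<pi>)"
      by (subst setum_permutations_compose_left[OF \<tau>]) (simp add: sum_negf)
    then show ?thesis using True by (simp add: volume_form_def)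
  qed (simp add: volume_form_def)
qed

text \<open>\<open>volume_form a b\<close> is the determinant of the matrix of inner products, so
  this is invariance under transposition: substitute the inverse permutation.\<close>

lemma volume_form_commute: "volume_form a b = volume_form b a"
proof (cases "length a = length b")
  case True
  let ?n = "length a"
  have "(\<Sum>\<pi> | \<pi> permutes {..<?n}. of_int (sign \<pi>) * (\<Prod>i<?n. (a ! i) \<bullet> (b ! \<pi> i)))
    = (\<Sum>\<pi> | \<pi> permutes {..<?n}. of_int (sign (inv \<pi>)) * (\<Prod>i<?n. (a ! i) \<bullet> (b ! inv \<pi> i)) :: real)"
    by (rule sum_permutations_inverse)
  also have "\<dots> = (\<Sum>\<pi> | \<pi> permutes {..<?n}. of_int (sign \<pi>) * (\<Prod>i<?n. (b ! i) \<bullet> (a ! \<pi> i)))"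
  proof (rule sum.cong[OF refl])
    fix \<pi> assume "\<pi> \<in> {\<pi>. \<pi> permutes {..<?n}}"
    then have p: "\<pi> permutes {..<?n}" by simp
    have "permutation \<pi>" using p permutation_permutes by blast
    have "(\<Prod>i<?n. (a ! i) \<bullet> (b ! inv \<pi> i)) = (\<Prod>i<?n. (a ! \<pi> i) \<bullet> (b ! inv \<pi> (\<pi> i)))"
      using prod.permute[OF p, of "\<lambda>i. (a ! i) \<bullet> (b ! inv \<pi> i)"] by (simp add: o_def)
    also have "\<dots> = (\<Prod>i<?n. (b ! i) \<bullet> (a ! \<pi> i))"
      using permutes_inverses[OF p] by (simp add: inner_commute)
    finally show "of_int (sign (inv \<pi>)) * (\<Prod>i<?n. (a ! i) \<bullet> (b ! inv \<pi> i)) =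
       of_int (sign \<pi>) * (\<Prod>i<?n. (b ! i) \<bullet> (a ! \<pi> i))"
      using sign_inverse[OF \<open>permutation \<pi>\<close>] by simp
  qed
  finally show ?thesis using True by (simp add: volume_form_def)
qed (auto simp: volume_form_def)

definition orthonormal_list :: "'a::euclidean_space list \<Rightarrow> bool" where
  "orthonormal_list e \<longleftrightarrow> distinct e \<and> (\<forall>x\<in>set e. \<forall>y\<in>set e. x \<bullet> y = (if x = y then 1 else 0))"

lemma orthonormal_list_iff: "orthonormal_list e \<longleftrightarrow> distinct e \<and> pairwise orthogonal (set e) \<and> (\<forall>x\<in>set e. norm x = 1)"
  by (auto simp: orthonormal_list_def pairwise_def orthogonal_def norm_eq_1)

lemma orthonormal_basis_iff: "orthonormal_basis T e \<longleftrightarrow> orthonormal_list e \<and> span (set e) = T"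
  by (auto simp: orthonormal_basis_def orthonormal_list_iff)

lemma orthonormal_list_nths:
  assumes "orthonormal_list e"
  shows "orthonormal_list (nths e I)"
proof -
  have "set (nths e I) \<subseteq> set e" by (auto dest: in_set_nthsD)
  then show ?thesis using assms unfolding orthonormal_list_def by (metis distinct_nthsI subsetD)
qed

lemma in_set_nthsE:
  assumes "y \<in> set (nths e J)"
  obtains j where "j < length e" "j \<in> J" "y = e ! j"
  using assms by (simp add: set_nths) blast

lemma orthonormal_list_nth: "orthonormal_list e \<Longrightarrow> i < length e \<Longrightarrow> j < length e \<Longrightarrow> e ! i \<bullet> e ! j = (if i = j then 1 else 0)"
  unfolding orthonormal_list_def by (simp add: nth_eq_iff_index_eq)

lemma volume_form_self:
  assumes "orthonormal_list e"
  shows "volume_form e e = 1"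
proof -
  let ?n = "length e"
  have "(\<Sum>\<pi> | \<pi> permutes {..<?n}. of_int (sign \<pi>) * (\<Prod>i<?n. (e ! i) \<bullet> (e ! \<pi> i)) :: real)
     = (\<Sum>\<pi> | \<pi> permutes {..<?n}. if \<pi> = id then 1 else 0)"
  proof (rule sum.cong[OF refl])
    fix \<pi> assume "\<pi> \<in> {\<pi>. \<pi> permutes {..<?n}}"
    then have p: "\<pi> permutes {..<?n}" by simp
    show "of_int (sign \<pi>) * (\<Prod>i<?n. (e ! i) \<bullet> (e ! \<pi> i)) = (if \<pi> = id then 1 else 0 :: real)"
    proof (cases "\<pi> = id")
      case True
      then show ?thesis using orthonormal_list_nth[OF assms] by simp
    next
      case False
      then obtain i where "\<pi> i \<noteq> i" by (metis eq_id_iff)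
      then have i: "i < ?n" using p permutes_not_in by fastforce
      moreover have "\<pi> i < ?n" using permutes_in_image[OF p] i by auto
      ultimately have "(e ! i) \<bullet> (e ! \<pi> i) = 0" using orthonormal_list_nth[OF assms] \<open>\<pi> i \<noteq> i\<close> by simp
      then have "(\<Prod>i<?n. (e ! i) \<bullet> (e ! \<pi> i)) = 0" using i by (intro prod_zero) auto
      then show ?thesis using False by simp
    qed
  qed
  also have "\<dots> = 1" by (subst sum.delta) (auto simp: finite_permutations permutes_id)
  finally show ?thesis by (simp add: volume_form_def)
qed

lemma length_nths_subset: "I \<subseteq> {..<length e} \<Longrightarrow> length (nths e I) = card I"
  unfolding length_nths by (rule arg_cong[of _ _ card]) auto

text \<open>If two index sets of equal size differ, some \<open>e ! i\<close> with
  \<open>i \<in> I\<close> is orthogonal to all vectors of the other list and produces a zero row.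
  Thus the forms \<open>volume_form (nths e I)\<close> are dual to the lists
  \<open>nths e I\<close>.\<close>

lemma volume_form_nths:
  assumes "orthonormal_list e" "I \<subseteq> {..<length e}" "J \<subseteq> {..<length e}"
  shows "volume_form (nths e I) (nths e J) = (if I = J then 1 else 0)"
proof -
  have zero: "volume_form (nths e I) (nths e J) = 0" if "I \<noteq> J"
  proof (cases "card I = card J")
    case True
    have "finite I" "finite J" using assms(2,3) finite_subset by blast+
    then have "\<not> I \<subseteq> J" using True that by (metis card_subset_eq)
    then obtain i where i: "i \<in> I" "i \<notin> J" by blast
    let ?a = "nths e I" and ?b = "nths e J"
    have "e ! i \<in> set ?a" using i assms(2) by (auto simp: set_nths)
    then obtain k where k: "k < length ?a" "?a ! k = e ! i" by (metis in_set_conv_nth)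
    have orth: "e ! i \<bullet> y = 0" if y: "y \<in> set ?b" for y
    proof -
      obtain j where "j < length e" "j \<in> J" "y = e ! j" using y by (rule in_set_nthsE)
      then show ?thesis using orthonormal_list_nth[OF assms(1), of i j] i assms(2) by auto
    qed
    have len: "length ?a = length ?b" using True assms by (simp add: length_nths_subset)
    have "(\<Prod>i<length ?a. (?a ! i) \<bullet> (?b ! \<pi> i)) = 0" if p: "\<pi> permutes {..<length ?a}" for \<pi>
    proof (rule prod_zero)
      have "\<pi> k < length ?b" using permutes_in_image[OF p] k len by auto
      then show "\<exists>i\<in>{..<length ?a}. ?a ! i \<bullet> ?b ! \<pi> i = 0"
        using orth[of "?b ! \<pi> k"] k by (intro bexI[of _ k]) auto
    qed simp
    then show ?thesis unfolding volume_form_def by (auto intro!: sum.neutral simp del: prod_zero_iff)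
  next
    case False
    then show ?thesis using assms by (simp add: volume_form_def length_nths_subset)
  qed
  then show ?thesis using volume_form_self[OF orthonormal_list_nths[OF assms(1)]] by auto
qed

lemma alt_on_expansion:
  assumes "alt_on T \<alpha>" "orthonormal_basis T e" "xs \<in> lists T"
  shows "\<alpha> xs = (\<Sum>I\<in>Pow {..<length e}. \<alpha> (nths e I) * volume_form (nths e I) xs)"
proof (rule alt_on_eqI[OF assms(1) _ _ _ _ assms(3), of _ e])
  have e: "orthonormal_list e" "span (set e) = T" using assms(2) by (auto simp: orthonormal_basis_iff)
  show "alt_on T (\<lambda>xs. \<Sum>I\<in>Pow {..<length e}. \<alpha> (nths e I) * volume_form (nths e I) xs)"
    by (intro alt_on_sum alt_on_volume_form)
  show "T = span (set e)" "distinct e" using e by (auto simp: orthonormal_list_def)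
  fix I assume I: "I \<subseteq> {..<length e}"
  have "(\<Sum>J\<in>Pow {..<length e}. \<alpha> (nths e J) * volume_form (nths e J) (nths e I))
    = (\<Sum>J\<in>Pow {..<length e}. if J = I then \<alpha> (nths e J) else 0)"
    by (rule sum.cong) (auto simp: volume_form_nths[OF e(1) _ I])
  also have "\<dots> = \<alpha> (nths e I)" using I by (subst sum.delta) auto
  finally show "\<alpha> (nths e I) = (\<Sum>J\<in>Pow {..<length e}. \<alpha> (nths e J) * volume_form (nths e J) (nths e I))"
    by simp
qed

lemma length_orthonormal_basis: "orthonormal_basis T e \<Longrightarrow> length e = dim T"
proof -
  assume e: "orthonormal_basis T e"
  then have "pairwise orthogonal (set e)" "\<forall>x\<in>set e. norm x = 1"
    unfolding orthonormal_basis_def by simp_all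
  moreover from this have "0 \<notin> set e" by (metis norm_zero zero_neq_one)
  ultimately have "independent (set e)" using pairwise_orthogonal_independent by blast
  then show ?thesis
    using e dim_span_eq_card_independent[of "set e"] distinct_card[of e] by (auto simp: orthonormal_basis_def)
qed

text \<open>An orthogonal change of basis has determinant 1 or -1. Expanding
  \<open>volume_form e\<close> in the basis \<open>b\<close> and evaluating at \<open>e\<close>
  leaves only the full index set, by a count of vectors.\<close>

lemma volume_form_square:
  assumes "orthonormal_basis T e" "orthonormal_basis T b"
  shows "volume_form e b * volume_form e b = 1"
proof -
  have orthonormal_list: "orthonormal_list e" "orthonormal_list b" and span: "span (set e) = T" using assms by (auto simp: orthonormal_basis_iff)
  have len: "length b = length e" using assms by (simp add: length_orthonormal_basis)
  have "e \<in> lists T" using span span_superset[of "set e"] by auto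
  then have "1 = (\<Sum>I\<in>Pow {..<length b}. volume_form e (nths b I) * volume_form (nths b I) e)"
    using alt_on_expansion[OF alt_on_volume_form[of T e] assms(2), of e] volume_form_self[OF orthonormal_list(1)] by simp
  also have "\<dots> = (\<Sum>I\<in>Pow {..<length b}. if I = {..<length b} then volume_form e b * volume_form b e else 0)"
  proof (rule sum.cong[OF refl])
    fix I assume I: "I \<in> Pow {..<length b}"
    have "I = {..<length b}" if "card I = length e"
      using card_subset_eq[of "{..<length b}" I] I that len by simp
    then have "volume_form e (nths b I) = 0" if "I \<noteq> {..<length b}"
      using that I by (auto simp: volume_form_def length_nths_subset)
    then show "volume_form e (nths b I) * volume_form (nths b I) e =
        (if I = {..<length b} then volume_form e b * volume_form b e else 0)"
      by (simp add: nths_all)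
  qed
  also have "\<dots> = volume_form e b * volume_form b e" by (subst sum.delta) auto
  finally show ?thesis using volume_form_commute[of e b] by simp
qed

section \<open>Double forms and the Hodge star\<close>

text \<open>The function \<open>c\<close> on index sets carries all information: products will act
  on it by convolution and the double star by complementation, without any signs.\<close>

definition diag_form :: "'a list \<Rightarrow> 'a double_form \<Rightarrow> (nat set \<Rightarrow> real) \<Rightarrow> bool" where
  "diag_form f \<omega> c \<longleftrightarrow> (\<forall>I J. I \<subseteq> {..<length f} \<longrightarrow> J \<subseteq> {..<length f} \<longrightarrow>
     \<omega> (nths f I) (nths f J) = (if I = J then c I else 0))"

lemma diag_formD: "diag_form f \<omega> c \<Longrightarrow> I \<subseteq> {..<length f} \<Longrightarrow> J \<subseteq> {..<length f} \<Longrightarrow>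
     \<omega> (nths f I) (nths f J) = (if I = J then c I else 0)"
  by (simp add: diag_form_def)

lemma double_alt_sum_prod:
  assumes "\<And>i. i \<in> S \<Longrightarrow> alt_on T (\<alpha> i)" "\<And>i. i \<in> S \<Longrightarrow> alt_on T (\<beta> i)"
  shows "double_alt T (\<lambda>xs ys. \<Sum>i\<in>S. c i * (\<alpha> i xs * \<beta> i ys))"
  unfolding double_alt_def
proof (intro conjI ballI)
  fix ys
  have "alt_on T (\<lambda>xs. \<Sum>i\<in>S. (c i * \<beta> i ys) * \<alpha> i xs)" using assms(1) by (rule alt_on_sum)
  then show "alt_on T (\<lambda>xs. \<Sum>i\<in>S. c i * (\<alpha> i xs * \<beta> i ys))" by (simp add: mult_ac)
next
  fix xs
  have "alt_on T (\<lambda>ys. \<Sum>i\<in>S. (c i * \<alpha> i xs) * \<beta> i ys)" using assms(2) by (rule alt_on_sum)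
  then show "alt_on T (\<lambda>ys. \<Sum>i\<in>S. c i * (\<alpha> i xs * \<beta> i ys))" by (simp add: mult_ac)
qed

lemma diag_form_expansion:
  assumes "orthonormal_basis T f" "double_alt T \<omega>" "diag_form f \<omega> c" "xs \<in> lists T" "ys \<in> lists T"
  shows "\<omega> xs ys = (\<Sum>K\<in>Pow {..<length f}. c K * (volume_form (nths f K) xs * volume_form (nths f K) ys))"
proof (rule double_alt_eqI[OF assms(2) _ _ _ _ assms(4,5), of _ f])
  have f: "orthonormal_list f" "span (set f) = T" using assms(1) by (auto simp: orthonormal_basis_iff)
  show "double_alt T (\<lambda>xs ys. \<Sum>K\<in>Pow {..<length f}. c K * (volume_form (nths f K) xs * volume_form (nths f K) ys))"
    by (intro double_alt_sum_prod alt_on_volume_form)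
  show "T = span (set f)" "distinct f" using f by (simp_all add: orthonormal_list_def)
  fix I J assume IJ: "I \<subseteq> {..<length f}" "J \<subseteq> {..<length f}"
  have "(\<Sum>K\<in>Pow {..<length f}. c K * (volume_form (nths f K) (nths f I) * volume_form (nths f K) (nths f J)))
    = (\<Sum>K\<in>Pow {..<length f}. if K = I then (if I = J then c I else 0) else 0)"
    by (rule sum.cong[OF refl]) (simp add: volume_form_nths[OF f(1) _ IJ(1)] volume_form_nths[OF f(1) _ IJ(2)])
  also have "\<dots> = (if I = J then c I else 0)" using IJ by (subst sum.delta) auto
  finally show "\<omega> (nths f I) (nths f J) =
      (\<Sum>K\<in>Pow {..<length f}. c K * (volume_form (nths f K) (nths f I) * volume_form (nths f K) (nths f J)))"
    using diag_formD[OF assms(3) IJ] by simp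
qed

text \<open>The star is written in the basis \<open>e\<close>, whereas \<open>fK\<close> will come
  from another basis. Summing over \<open>e\<close> is the expansion of the alternating map
  \<open>\<lambda>zs. volume_form e (zs @ xs)\<close>, evaluated at \<open>fK\<close>.\<close>

lemma hodge_volume_form:
  assumes "orthonormal_basis T e" "fK \<in> lists T" "xs \<in> lists T"
  shows "hodge e (volume_form fK) xs = volume_form e (fK @ xs)"
proof -
  have "alt_on T (\<lambda>zs. volume_form e (zs @ xs))"
    by (intro alt_on_append_right alt_on_volume_form assms)
  from alt_on_expansion[OF this assms(1,2)] show ?thesis
    by (simp add: hodge_def volume_form_commute[of fK] mult.commute)
qed

lemma hodge_cong: "(\<And>I. \<alpha> (nths e I) = \<beta> (nths e I)) \<Longrightarrow> hodge e \<alpha> xs = hodge e \<beta> xs"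
  by (simp add: hodge_def)

lemma hodge_sum: "hodge e (\<lambda>zs. \<Sum>i\<in>S. c i * \<alpha> i zs) xs = (\<Sum>i\<in>S. c i * hodge e (\<alpha> i) xs)"
  unfolding hodge_def sum_distrib_left sum_distrib_right
  by (subst sum.swap) (simp add: mult_ac)

text \<open>The basis \<open>e\<close> chosen inside \<open>double_hodge\<close> is unknown and
  unrelated to \<open>f\<close>. It survives only in the two orientation factors of each term, which
  become a square on the diagonal.\<close>

lemma double_hodge_diag:
  assumes "orthonormal_basis T f" "double_alt T \<omega>" "diag_form f \<omega> c"
  defines "e \<equiv> SOME e. orthonormal_basis T e"
  shows "orthonormal_basis T e"
    and "xs \<in> lists T \<Longrightarrow> ys \<in> lists T \<Longrightarrow> double_hodge T \<omega> xs ys =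
      (\<Sum>K\<in>Pow {..<length f}. c K * (volume_form e (nths f K @ xs) * volume_form e (nths f K @ ys)))"
proof -
  show e: "orthonormal_basis T e" unfolding e_def using assms(1) by (rule someI)
  assume xs: "xs \<in> lists T" and ys: "ys \<in> lists T"
  have fT: "f \<in> lists T" using assms(1) by (auto simp: orthonormal_basis_def intro: span_base)
  have eT: "e \<in> lists T" using e by (auto simp: orthonormal_basis_def intro: span_base)
  let ?v = "\<lambda>K. volume_form (nths f K)" and ?w = "\<lambda>K xs. volume_form e (nths f K @ xs)"
  have 1: "hodge e (\<lambda>bs. \<omega> (nths e I) bs) ys = (\<Sum>K\<in>Pow {..<length f}. (c K * ?w K ys) * ?v K (nths e I))" for I
  proof -
    have "hodge e (\<lambda>bs. \<omega> (nths e I) bs) ys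
        = hodge e (\<lambda>bs. \<Sum>K\<in>Pow {..<length f}. (c K * ?v K (nths e I)) * ?v K bs) ys"
    proof (rule hodge_cong)
      fix J
      show "\<omega> (nths e I) (nths e J) = (\<Sum>K\<in>Pow {..<length f}. (c K * ?v K (nths e I)) * ?v K (nths e J))"
        using diag_form_expansion[OF assms(1-3) in_lists_nths[OF eT] in_lists_nths[OF eT], of I J]
        by (simp add: mult.assoc)
    qed
    also have "\<dots> = (\<Sum>K\<in>Pow {..<length f}. (c K * ?v K (nths e I)) * ?w K ys)"
      by (simp add: hodge_sum hodge_volume_form[OF e in_lists_nths[OF fT] ys])
    finally show ?thesis by (simp add: mult_ac)
  qed
  have "double_hodge T \<omega> xs ys = hodge e (\<lambda>as. hodge e (\<lambda>bs. \<omega> as bs) ys) xs"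
    by (simp add: double_hodge_def e_def Let_def)
  also have "\<dots> = hodge e (\<lambda>as. \<Sum>K\<in>Pow {..<length f}. (c K * ?w K ys) * ?v K as) xs"
    by (rule hodge_cong) (rule 1)
  also have "\<dots> = (\<Sum>K\<in>Pow {..<length f}. (c K * ?w K ys) * ?w K xs)"
    by (simp add: hodge_sum hodge_volume_form[OF e in_lists_nths[OF fT] xs])
  finally show "double_hodge T \<omega> xs ys = (\<Sum>K\<in>Pow {..<length f}. c K * (?w K xs * ?w K ys))"
    by (simp add: mult_ac)
qed

lemma double_hodge_nths:
  assumes "orthonormal_basis T f" "double_alt T \<omega>" "diag_form f \<omega> c"
    "A \<subseteq> {..<length f}" "B \<subseteq> {..<length f}"
  shows "double_hodge T \<omega> (nths f A) (nths f B) = (if A = B then c ({..<length f} - A) else 0)"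
proof -
  define e where "e = (SOME e. orthonormal_basis T e)"
  note e = double_hodge_diag(1)[OF assms(1-3), folded e_def]
  have f: "orthonormal_list f" "span (set f) = T" using assms(1) by (auto simp: orthonormal_basis_iff)
  have fT: "f \<in> lists T" using assms(1) by (auto simp: orthonormal_basis_def intro: span_base)
  have len: "length e = length f" using e assms(1) by (simp add: length_orthonormal_basis)
  let ?n = "length f" and ?w = "\<lambda>K A. volume_form e (nths f K @ nths f A)"
  \<comment> \<open>Either the number of vectors is wrong or one of them is repeated: only the
    complement of \<open>C\<close> completes \<open>nths f C\<close> to a basis.\<close>
  have zero: "?w K C = 0" if "K \<subseteq> {..<?n}" "C \<subseteq> {..<?n}" "K \<noteq> {..<?n} - C" for K C
  proof (cases "K \<inter> C = {}")
    case True
    have fin: "finite K" "finite C" using that finite_subset by blast+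
    have "K \<union> C \<noteq> {..<?n}" using True that by blast
    then have "card (K \<union> C) \<noteq> ?n" using that card_subset_eq[of "{..<?n}" "K \<union> C"] by auto
    then have "length (nths f K @ nths f C) \<noteq> length e"
      using that len card_Un_disjoint[OF fin True] by (simp add: length_nths_subset)
    then show ?thesis by (simp add: volume_form_def)
  next
    case False
    then obtain i where "i \<in> K" "i \<in> C" by blast
    then have "f ! i \<in> set (nths f K)" "f ! i \<in> set (nths f C)" using that by (auto simp: set_nths)
    then have "\<not> distinct (nths f K @ nths f C)" by auto
    then show ?thesis
      using alt_on_not_distinct[OF alt_on_volume_form, of T "nths f K @ nths f C" e] f(2) in_lists_nths[OF fT]
      by auto
  qed
  \<comment> \<open>The orientation of this reordered basis relative to \<open>e\<close> is not
    determined, but it enters squared.\<close>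
  have one: "?w ({..<?n} - C) C * ?w ({..<?n} - C) C = 1" if C: "C \<subseteq> {..<?n}" for C
  proof (rule volume_form_square[OF e])
    let ?b = "nths f ({..<?n} - C) @ nths f C"
    have im: "set (nths f A) = (!) f ` A" if "A \<subseteq> {..<?n}" for A
      using that by (auto simp: set_nths)
    have "set ?b = (!) f ` (({..<?n} - C) \<union> C)" using im[of "{..<?n} - C"] im[OF C]
      by (simp only: set_append image_Un Diff_subset)
    also have "({..<?n} - C) \<union> C = {..<?n}" using C by blast
    also have "(!) f ` {..<?n} = set f" by (auto simp: set_conv_nth)
    finally have set: "set ?b = set f" .
    have "set (nths f ({..<?n} - C)) \<inter> set (nths f C) = {}"
      using f(1) by (auto simp: set_nths orthonormal_list_def nth_eq_iff_index_eq)
    then have "distinct ?b" using f(1) by (simp add: orthonormal_list_def)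
    then show "orthonormal_basis T ?b" using f set unfolding orthonormal_basis_iff orthonormal_list_def by simp
  qed
  have "double_hodge T \<omega> (nths f A) (nths f B) = (\<Sum>K\<in>Pow {..<?n}. c K * (?w K A * ?w K B))"
    using double_hodge_diag(2)[OF assms(1-3), folded e_def] in_lists_nths[OF fT] by blast
  also have "\<dots> = (\<Sum>K\<in>Pow {..<?n}. if K = {..<?n} - A then (if A = B then c ({..<?n} - A) else 0) else 0)"
  proof (rule sum.cong[OF refl])
    fix K assume "K \<in> Pow {..<?n}"
    then have K: "K \<subseteq> {..<?n}" by simp
    show "c K * (?w K A * ?w K B) = (if K = {..<?n} - A then (if A = B then c ({..<?n} - A) else 0) else 0)"
    proof (cases "K = {..<?n} - A")
      case True
      show ?thesis
      proof (cases "A = B")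
        case True
        then show ?thesis using one[OF assms(5)] \<open>K = _\<close> by simp
      next
        case False
        then have "K \<noteq> {..<?n} - B" using True assms(4,5) by blast
        then show ?thesis using zero[OF K assms(5)] False True by simp
      qed
    next
      case False
      then show ?thesis using zero[OF K assms(4)] by simp
    qed
  qed
  also have "\<dots> = (if A = B then c ({..<?n} - A) else 0)" by (subst sum.delta) auto
  finally show ?thesis .
qed

text \<open>The Thorpe equation is demanded for all lists of tangent vectors. Both sides being
  alternating, complement-invariant diagonal entries are enough.\<close>

lemma double_alt_double_hodge_diag:
  assumes "orthonormal_basis T f" "double_alt T \<omega>" "diag_form f \<omega> c"
    "\<And>A. A \<subseteq> {..<length f} \<Longrightarrow> c ({..<length f} - A) = c A" "xs \<in> lists T" "ys \<in> lists T"
  shows "double_hodge T \<omega> xs ys = \<omega> xs ys"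
proof -
  define e where "e = (SOME e. orthonormal_basis T e)"
  have f: "orthonormal_list f" "span (set f) = T" using assms(1) by (auto simp: orthonormal_basis_iff)
  have fT: "f \<in> lists T" using assms(1) by (auto simp: orthonormal_basis_def intro: span_base)
  define \<eta> where "\<eta> xs ys = (\<Sum>K\<in>Pow {..<length f}. c K * (volume_form e (nths f K @ xs) * volume_form e (nths f K @ ys)))"
    for xs ys
  have eq: "double_hodge T \<omega> xs ys = \<eta> xs ys" if "xs \<in> lists T" "ys \<in> lists T" for xs ys
    unfolding \<eta>_def using double_hodge_diag(2)[OF assms(1-3) that, folded e_def] .
  have "double_alt T \<eta>" unfolding \<eta>_def
    by (intro double_alt_sum_prod alt_on_append_left alt_on_volume_form in_lists_nths fT)
  then have "\<eta> xs ys = \<omega> xs ys"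
  proof (rule double_alt_eqI[OF _ assms(2) _ _ _ assms(5,6), of _ f])
    show "T = span (set f)" "distinct f" using f by (simp_all add: orthonormal_list_def)
    fix I J assume IJ: "I \<subseteq> {..<length f}" "J \<subseteq> {..<length f}"
    have "\<eta> (nths f I) (nths f J) = double_hodge T \<omega> (nths f I) (nths f J)"
      using eq[OF in_lists_nths[OF fT] in_lists_nths[OF fT]] by simp
    then show "\<eta> (nths f I) (nths f J) = \<omega> (nths f I) (nths f J)"
      using double_hodge_nths[OF assms(1-3) IJ] diag_formD[OF assms(3) IJ] assms(4)[OF IJ(1)]
      by (cases "I = J") simp_all
  qed
  then show ?thesis using eq[OF assms(5,6)] by simp
qed

section \<open>Alternation of exterior products\<close>

lemma nths_two:
  "nths (ps @ x # y # qs) I = nths ps I @ (if length ps \<in> I then [x] else []) @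
     (if Suc (length ps) \<in> I then [y] else []) @ nths qs {i. Suc (Suc (i + length ps)) \<in> I}"
  by (simp add: nths_append nths_Cons)

lemma nths_one:
  "nths (ps @ x # qs) I = nths ps I @ (if length ps \<in> I then [x] else []) @ nths qs {i. Suc (i + length ps) \<in> I}"
  by (simp add: nths_append nths_Cons)

text \<open>Exactly one inversion, the pair \<open>(Suc j, j)\<close>, disappears when the two
  positions are exchanged; the transposition carries the remaining inversions to those of the image
  bijectively.\<close>

lemma shuffle_sign_transpose_aux:
  assumes I: "I \<subseteq> {..<m}" and j: "Suc j < m" "j \<notin> I" "Suc j \<in> I"
  shows "shuffle_sign m (Transposition.transpose j (Suc j) ` I) = - shuffle_sign m I"
proof -
  let ?\<tau> = "Transposition.transpose j (Suc j)"
  define Inv where "Inv I = {(i, k). i \<in> I \<and> k \<in> {..<m} - I \<and> k < i}" for I :: "nat set"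
  have mem: "i \<in> ?\<tau> ` I \<longleftrightarrow> ?\<tau> i \<in> I" for i
    by (metis (no_types, opaque_lifting) image_iff transpose_involutory)
  have lt: "?\<tau> i < m \<longleftrightarrow> i < m" for i using j by (auto simp: Transposition.transpose_def)
  have ord: "?\<tau> k < ?\<tau> i \<longleftrightarrow> k < i" if "i \<noteq> k" "{i, k} \<noteq> {j, Suc j}" for i k
    using that by (auto simp: Transposition.transpose_def doubleton_eq_iff split: if_splits)
  have "(i, k) \<in> Inv (?\<tau> ` I) \<longleftrightarrow> (?\<tau> i, ?\<tau> k) \<in> Inv I - {(Suc j, j)}" for i k
  proof (cases "{i, k} = {j, Suc j}")
    case True
    then show ?thesis using j unfolding Inv_def
      by (auto simp: mem doubleton_eq_iff)
  next
    case False
    have "(?\<tau> i, ?\<tau> k) \<noteq> (Suc j, j)" using False by (auto simp: Transposition.transpose_def split: if_splits)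
    then show ?thesis unfolding Inv_def
      using ord[OF _ False] lt[of k] by (cases "i = k") (auto simp: mem)
  qed
  then have "Inv (?\<tau> ` I) = map_prod ?\<tau> ?\<tau> -` (Inv I - {(Suc j, j)})" by auto
  also have "card \<dots> = card (Inv I - {(Suc j, j)})"
  proof (rule card_vimage_inj)
    show "inj (map_prod ?\<tau> ?\<tau>)" by (intro prod.inj_map inj_transpose)
    show "Inv I - {(Suc j, j)} \<subseteq> range (map_prod ?\<tau> ?\<tau>)"
      by (metis map_prod_surj subset_UNIV surj_transpose)
  qed
  finally have c: "card (Inv (?\<tau> ` I)) = card (Inv I - {(Suc j, j)})" .
  have "finite (Inv I)"
    by (rule finite_subset[of _ "{..<m} \<times> {..<m}"]) (use I in \<open>auto simp: Inv_def\<close>)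
  moreover have "(Suc j, j) \<in> Inv I" using j by (auto simp: Inv_def)
  ultimately have "card (Inv I) = Suc (card (Inv (?\<tau> ` I)))"
    unfolding c by (metis card.remove)
  then show ?thesis by (simp add: shuffle_sign_def Inv_def)
qed

lemma shuffle_sign_transpose:
  assumes I: "I \<subseteq> {..<m}" and j: "Suc j < m" "(j \<in> I) \<noteq> (Suc j \<in> I)"
  shows "shuffle_sign m (Transposition.transpose j (Suc j) ` I) = - shuffle_sign m I"
proof (cases "Suc j \<in> I")
  case True
  then show ?thesis using shuffle_sign_transpose_aux[OF I j(1)] j by blast
next
  case False
  let ?\<tau> = "Transposition.transpose j (Suc j)"
  have mem: "i \<in> ?\<tau> ` I \<longleftrightarrow> ?\<tau> i \<in> I" for i
    by (metis (no_types, opaque_lifting) image_iff transpose_involutory)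
  have "?\<tau> ` I \<subseteq> {..<m}" using I j(1) by (auto simp: Transposition.transpose_def)
  moreover have "j \<notin> ?\<tau> ` I" "Suc j \<in> ?\<tau> ` I" using False j by (auto simp: mem)
  ultimately have "shuffle_sign m (?\<tau> ` ?\<tau> ` I) = - shuffle_sign m (?\<tau> ` I)"
    using shuffle_sign_transpose_aux j(1) by blast
  moreover have "?\<tau> ` ?\<tau> ` I = I" by (simp add: image_image)
  ultimately show ?thesis by simp
qed

text \<open>Handles one argument of \<open>dmult\<close> at a time: with the other list fixed,
  \<open>dmult\<close> is a linear combination of wedge products.\<close>

definition wedge :: "'a ext_form \<Rightarrow> 'a ext_form \<Rightarrow> 'a ext_form" where
  "wedge \<alpha> \<beta> xs = (\<Sum>I\<in>Pow {..<length xs}. shuffle_sign (length xs) I * (\<alpha> (nths xs I) * \<beta> (nths xs (- I))))"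

text \<open>Suppose two neighbouring entries are equal. If \<open>I\<close> contains both positions
  or neither, one of the factors vanishes. Otherwise exchanging the two positions in
  \<open>I\<close> gives a term with the same factors and the opposite shuffle sign.\<close>

lemma alt_on_wedge:
  assumes "alt_on T \<alpha>" "alt_on T \<beta>"
  shows "alt_on T (wedge \<alpha> \<beta>)"
proof (rule alt_onI)
  fix ps qs x y and a b :: real
  assume ps: "ps \<in> lists T" and qs: "qs \<in> lists T" and x: "x \<in> T" and y: "y \<in> T"
  let ?m = "Suc (length ps + length qs)" and ?z = "a *\<^sub>R x + b *\<^sub>R y"
  have *: "\<alpha> (nths (ps @ ?z # qs) I) * \<beta> (nths (ps @ ?z # qs) (- I)) =
    a * (\<alpha> (nths (ps @ x # qs) I) * \<beta> (nths (ps @ x # qs) (- I))) +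
    b * (\<alpha> (nths (ps @ y # qs) I) * \<beta> (nths (ps @ y # qs) (- I)))" for I
    using alt_on_lin[OF assms(1) in_lists_nths[OF ps] in_lists_nths[OF qs] x y]
      alt_on_lin[OF assms(2) in_lists_nths[OF ps] in_lists_nths[OF qs] x y]
    unfolding nths_one by (simp add: algebra_simps)
  show "wedge \<alpha> \<beta> (ps @ ?z # qs) = a * wedge \<alpha> \<beta> (ps @ x # qs) + b * wedge \<alpha> \<beta> (ps @ y # qs)"
    unfolding wedge_def * by (simp add: sum_distrib_left algebra_simps flip: sum.distrib)
next
  fix ps qs x assume ps: "ps \<in> lists T" and qs: "qs \<in> lists T" and x: "x \<in> T"
  let ?xs = "ps @ x # x # qs" and ?j = "length ps"
  let ?m = "length ?xs"
  let ?\<tau> = "Transposition.transpose ?j (Suc ?j)"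
  define t where "t I = shuffle_sign ?m I * (\<alpha> (nths ?xs I) * \<beta> (nths ?xs (- I)))" for I
  have mem: "i \<in> ?\<tau> ` I \<longleftrightarrow> ?\<tau> i \<in> I" for i I
    by (metis (no_types, opaque_lifting) image_iff transpose_involutory)
  have bij: "bij_betw ((`) ?\<tau>) (Pow {..<?m}) (Pow {..<?m})"
  proof (rule bij_betw_Pow)
    have "?\<tau> permutes {..<?m}" by (intro permutes_swap_id) auto
    then show "bij_betw ?\<tau> {..<?m} {..<?m}" by (rule permutes_imp_bij)
  qed
  have "t (?\<tau> ` I) = - t I" if I: "I \<in> Pow {..<?m}" for I
  proof (cases "(?j \<in> I) = (Suc ?j \<in> I)")
    case True
    then have "?\<tau> ` I = I" by (auto simp: mem set_eq_iff Transposition.transpose_def)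
    moreover have "t I = 0"
    proof (cases "?j \<in> I")
      case True
      then have "\<alpha> (nths ?xs I) = 0"
        using alt_on_adj[OF assms(1) in_lists_nths[OF ps] in_lists_nths[OF qs] x] \<open>(?j \<in> I) = _\<close>
        by (simp add: nths_two)
      then show ?thesis by (simp add: t_def)
    next
      case False
      then have "\<beta> (nths ?xs (- I)) = 0"
        using alt_on_adj[OF assms(2) in_lists_nths[OF ps] in_lists_nths[OF qs] x] \<open>(?j \<in> I) = _\<close>
        by (simp add: nths_two)
      then show ?thesis by (simp add: t_def)
    qed
    ultimately show ?thesis by simp
  next
    case False
    have mem': "?j \<in> ?\<tau> ` I \<longleftrightarrow> Suc ?j \<in> I" "Suc ?j \<in> ?\<tau> ` I \<longleftrightarrow> ?j \<in> I"
      unfolding mem by simp_all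
    have other: "i \<in> ?\<tau> ` I \<longleftrightarrow> i \<in> I" if "i \<noteq> ?j" "i \<noteq> Suc ?j" for i
      unfolding mem using that by (simp add: Transposition.transpose_def)
    have ne: "{i. Suc (Suc (i + ?j)) \<in> ?\<tau> ` I} = {i. Suc (Suc (i + ?j)) \<in> I}"
      "{i. Suc (Suc (i + ?j)) \<in> - (?\<tau> ` I)} = {i. Suc (Suc (i + ?j)) \<in> - I}"
      by (simp_all add: other)
    have cong: "nths ps A = nths ps B" if "\<And>i. i < ?j \<Longrightarrow> i \<in> A \<longleftrightarrow> i \<in> B" for A B
      unfolding nths_def by (intro arg_cong[of _ _ "map fst"] filter_cong) (auto simp: in_set_zip that)
    have psn: "nths ps (?\<tau> ` I) = nths ps I" "nths ps (- (?\<tau> ` I)) = nths ps (- I)"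
      by (rule cong; simp add: other)+
    have sw: "(if Suc ?j \<in> I then [x] else []) @ (if ?j \<in> I then [x] else []) @ r =
        (if ?j \<in> I then [x] else []) @ (if Suc ?j \<in> I then [x] else []) @ r" for r
      using False by (cases "?j \<in> I") simp_all
    have sw': "(if Suc ?j \<in> - I then [x] else []) @ (if ?j \<in> - I then [x] else []) @ r =
        (if ?j \<in> - I then [x] else []) @ (if Suc ?j \<in> - I then [x] else []) @ r" for r
      using False by (cases "?j \<in> I") simp_all
    have memc: "?j \<in> - (?\<tau> ` I) \<longleftrightarrow> Suc ?j \<in> - I" "Suc ?j \<in> - (?\<tau> ` I) \<longleftrightarrow> ?j \<in> - I"
      unfolding Compl_iff mem' by (rule refl)+
    have nn: "nths ?xs (?\<tau> ` I) = nths ?xs I" "nths ?xs (- (?\<tau> ` I)) = nths ?xs (- I)"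
      unfolding nths_two ne psn mem' memc by (simp_all only: sw sw')
    have sg: "shuffle_sign ?m (?\<tau> ` I) = - shuffle_sign ?m I"
      by (rule shuffle_sign_transpose) (use I False in simp_all)
    show ?thesis unfolding t_def nn sg by simp
  qed
  then have "(\<Sum>I\<in>Pow {..<?m}. t (?\<tau> ` I)) = - (\<Sum>I\<in>Pow {..<?m}. t I)"
    by (simp add: sum_negf)
  then have "(\<Sum>I\<in>Pow {..<?m}. t I) = 0"
    using sum.reindex_bij_betw[OF bij, of t] by simp
  then show "wedge \<alpha> \<beta> ?xs = 0" by (simp add: wedge_def t_def)
qed

lemma double_alt_dmult:
  assumes "double_alt T \<omega>" "double_alt T \<eta>"
  shows "double_alt T (dmult \<omega> \<eta>)"
proof -
  have 1: "dmult \<omega> \<eta> xs ys = (\<Sum>J\<in>Pow {..<length ys}. shuffle_sign (length ys) J *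
      wedge (\<lambda>as. \<omega> as (nths ys J)) (\<lambda>as. \<eta> as (nths ys (- J))) xs)" for xs ys
    unfolding dmult_def wedge_def sum_distrib_left by (subst sum.swap) (simp add: mult_ac)
  have 2: "dmult \<omega> \<eta> xs ys = (\<Sum>I\<in>Pow {..<length xs}. shuffle_sign (length xs) I *
      wedge (\<omega> (nths xs I)) (\<eta> (nths xs (- I))) ys)" for xs ys
    unfolding dmult_def wedge_def sum_distrib_left by (simp add: mult_ac)
  have "alt_on T (\<lambda>xs. dmult \<omega> \<eta> xs ys)" if "ys \<in> lists T" for ys
    unfolding 1 using assms in_lists_nths[OF that]
    by (intro alt_on_sum alt_on_wedge) (simp_all add: double_alt_def)
  moreover have "alt_on T (dmult \<omega> \<eta> xs)" if "xs \<in> lists T" for xs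
    unfolding 2[abs_def] using assms in_lists_nths[OF that]
    by (intro alt_on_sum alt_on_wedge) (simp_all add: double_alt_def)
  ultimately show ?thesis by (simp add: double_alt_def)
qed

lemma double_alt_dunit: "double_alt T dunit"
  unfolding double_alt_def dunit_def by (auto intro!: alt_onI)

lemma double_alt_dpower: "double_alt T \<omega> \<Longrightarrow> double_alt T (dpower \<omega> k)"
  by (induction k) (simp_all add: double_alt_dunit double_alt_dmult)

lemma metric_form_simps: "metric_form xs ys = (if length xs = 1 \<and> length ys = 1 then hd xs \<bullet> hd ys else 0)"
  by (auto simp: metric_form_def split: list.splits)

lemma double_alt_metric: "double_alt T metric_form"
  unfolding double_alt_def metric_form_simps
  by (auto intro!: alt_onI simp: inner_add_left inner_add_right)

section \<open>Diagonal double forms\<close>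

text \<open>\<open>dmult\<close> sums over sets of positions in the list \<open>nths f I\<close>,
  while coefficients are indexed by subsets of \<open>I\<close>. The rank of an element within
  \<open>I\<close> is its position in that list.\<close>

lemma rank_bij:
  fixes I :: "nat set"
  assumes "finite I"
  shows "bij_betw (\<lambda>i. card {j \<in> I. j < i}) I {..<card I}"
proof -
  have mono: "card {j \<in> I. j < i} < card {j \<in> I. j < k}" if "i \<in> I" "i < k" for i k
    using assms that by (intro psubset_card_mono) auto
  have inj: "inj_on (\<lambda>i. card {j \<in> I. j < i}) I"
    by (rule linorder_inj_onI) (use mono in fastforce)+
  have "card {j \<in> I. j < i} < card I" if "i \<in> I" for i
    using assms that by (intro psubset_card_mono) auto
  then have "(\<lambda>i. card {j \<in> I. j < i}) ` I \<subseteq> {..<card I}" by auto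
  then have "(\<lambda>i. card {j \<in> I. j < i}) ` I = {..<card I}"
    using card_image[OF inj] by (intro card_subset_eq) auto
  then show ?thesis using inj by (simp add: bij_betw_def)
qed

lemma shuffle_sign_square: "shuffle_sign m I * shuffle_sign m I = 1"
  by (simp add: shuffle_sign_def flip: power_add)

text \<open>A nonzero term needs the same subset \<open>A\<close> in both arguments and equal
  complements, which forces \<open>I = J\<close>. The two shuffle signs then coincide and multiply
  to 1.\<close>

lemma diag_form_dmult:
  assumes "diag_form f \<omega> c" "diag_form f \<eta> d"
  shows "diag_form f (dmult \<omega> \<eta>) (\<lambda>I. \<Sum>A\<in>Pow I. c A * d (I - A))"
  unfolding diag_form_def
proof (intro allI impI)
  fix I J assume I: "I \<subseteq> {..<length f}" and J: "J \<subseteq> {..<length f}"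
  define rk where "rk I i = card {j \<in> I. j < i}" for I :: "nat set" and i
  define s where "s I A = shuffle_sign (card I) (rk I ` A)" for I A
  have fin: "finite X" if "X \<subseteq> {..<length f}" for X using that finite_subset by blast
  have bij: "bij_betw ((`) (rk X)) (Pow X) (Pow {..<card X})" if "X \<subseteq> {..<length f}" for X
    unfolding rk_def by (intro bij_betw_Pow rank_bij fin that)
  have sub: "nths (nths f X) (rk X ` A) = nths f A" "nths (nths f X) (- rk X ` A) = nths f (X - A)"
    if X: "X \<subseteq> {..<length f}" and A: "A \<subseteq> X" for X A
  proof -
    have inj: "inj_on (rk X) X" using rank_bij[OF fin[OF X]] unfolding rk_def bij_betw_def by blast
    have mem: "rk X i \<in> rk X ` A \<longleftrightarrow> i \<in> A" if "i \<in> X" for i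
      using inj_on_image_mem_iff[OF inj that A] .
    have "{i \<in> X. \<exists>j\<in>rk X ` A. card {i' \<in> X. i' < i} = j} = A"
      "{i \<in> X. \<exists>j\<in>- rk X ` A. card {i' \<in> X. i' < i} = j} = X - A"
      using mem A unfolding rk_def[symmetric] by auto
    then show "nths (nths f X) (rk X ` A) = nths f A" "nths (nths f X) (- rk X ` A) = nths f (X - A)"
      unfolding nths_nths by simp_all
  qed
  have "dmult \<omega> \<eta> (nths f I) (nths f J) = (\<Sum>A\<in>Pow I. \<Sum>B\<in>Pow J. s I A * s J B *
     \<omega> (nths f A) (nths f B) * \<eta> (nths f (I - A)) (nths f (J - B)))"
    unfolding dmult_def length_nths_subset[OF I] length_nths_subset[OF J]
      sum.reindex_bij_betw[OF bij[OF I], symmetric] sum.reindex_bij_betw[OF bij[OF J], symmetric]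
    by (intro sum.cong refl) (simp add: sub[OF I] sub[OF J] s_def)
  also have "\<dots> = (\<Sum>A\<in>Pow I. \<Sum>B\<in>Pow J. if B = A then (if I = J then c A * d (I - A) else 0) else 0)"
  proof (intro sum.cong refl)
    fix A B assume A: "A \<in> Pow I" and B: "B \<in> Pow J"
    have AB: "A \<subseteq> {..<length f}" "B \<subseteq> {..<length f}" "I - A \<subseteq> {..<length f}" "J - B \<subseteq> {..<length f}"
      using A B I J by auto
    have "I - A \<noteq> J - B" if "A = B" "I \<noteq> J" using that A B by auto
    moreover have "s I A * s I A = 1" by (simp add: s_def shuffle_sign_square)
    ultimately show "s I A * s J B * \<omega> (nths f A) (nths f B) * \<eta> (nths f (I - A)) (nths f (J - B)) =
       (if B = A then (if I = J then c A * d (I - A) else 0) else 0)"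
      using diag_formD[OF assms(1) AB(1,2)] diag_formD[OF assms(2) AB(3,4)] by auto
  qed
  also have "\<dots> = (if I = J then \<Sum>A\<in>Pow I. c A * d (I - A) else 0)"
  proof (cases "I = J")
    case True
    then show ?thesis using fin[OF J] by (simp add: sum.delta)
  next
    case False
    have "(\<Sum>B\<in>Pow J. if B = A then (if I = J then c A * d (I - A) else 0) else 0) = 0" for A
      using False by (intro sum.neutral) simp
    then show ?thesis using False by simp
  qed
  finally show "dmult \<omega> \<eta> (nths f I) (nths f J) = (if I = J then \<Sum>A\<in>Pow I. c A * d (I - A) else 0)" .
qed

lemma diag_form_cong:
  "diag_form f \<omega> c \<Longrightarrow> (\<And>I. I \<subseteq> {..<length f} \<Longrightarrow> c I = d I) \<Longrightarrow> diag_form f \<omega> d"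
  unfolding diag_form_def by auto

lemma convolution_card:
  fixes c d :: "nat set \<Rightarrow> real"
  assumes "finite I"
  shows "(\<Sum>A\<in>Pow I. (if card A = p then c A else 0) * (if card (I - A) = q then d (I - A) else 0)) =
    (if card I = p + q then \<Sum>A | A \<subseteq> I \<and> card A = p. c A * d (I - A) else 0)"
proof -
  have "(\<Sum>A\<in>Pow I. (if card A = p then c A else 0) * (if card (I - A) = q then d (I - A) else 0)) =
    (\<Sum>A\<in>Pow I. if card A = p then (if card I = p + q then c A * d (I - A) else 0) else 0)"
  proof (intro sum.cong refl)
    fix A assume "A \<in> Pow I"
    then have "card (I - A) = card I - card A" "card A \<le> card I"
      using assms by (auto simp: card_Diff_subset finite_subset card_mono)
    then show "(if card A = p then c A else 0) * (if card (I - A) = q then d (I - A) else 0) =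
      (if card A = p then (if card I = p + q then c A * d (I - A) else 0) else 0)" by auto
  qed
  also have "\<dots> = (\<Sum>A\<in>{A \<in> Pow I. card A = p}. if card I = p + q then c A * d (I - A) else 0)"
    using assms by (intro sum.inter_filter[symmetric]) simp
  also have "{A \<in> Pow I. card A = p} = {A. A \<subseteq> I \<and> card A = p}" by auto
  finally show ?thesis by simp
qed

lemma diag_form_dmult_graded:
  assumes "diag_form f \<omega> (\<lambda>I. if card I = p then c I else 0)" "diag_form f \<eta> (\<lambda>I. if card I = q then d I else 0)"
  shows "diag_form f (dmult \<omega> \<eta>) (\<lambda>I. if card I = p + q then \<Sum>A | A \<subseteq> I \<and> card A = p. c A * d (I - A) else 0)"
  using diag_form_dmult[OF assms]
  by (rule diag_form_cong) (rule convolution_card, rule finite_subset, auto)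

lemma diag_form_dunit: "diag_form f dunit (\<lambda>I. if card I = 0 then 1 else 0)"
  unfolding diag_form_def
proof (intro allI impI)
  fix I J assume IJ: "I \<subseteq> {..<length f}" "J \<subseteq> {..<length f}"
  then have "finite I" "finite J" using finite_subset by blast+
  moreover have "nths f I = [] \<longleftrightarrow> card I = 0" "nths f J = [] \<longleftrightarrow> card J = 0"
    using IJ length_nths_subset[of I f] length_nths_subset[of J f] by (metis length_0_conv)+
  ultimately show "dunit (nths f I) (nths f J) = (if I = J then if card I = 0 then 1 else 0 else 0)"
    by (auto simp: dunit_def)
qed

lemma nths_insert_less:
  "i < length f \<Longrightarrow> nths f {i} = [f ! i]"
  "i < j \<Longrightarrow> j < length f \<Longrightarrow> nths f {i, j} = [f ! i, f ! j]"
proof -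
  have single: "nths f {i} = [f ! i]" if "i < length f" for f :: "'a list" and i
    using that
  proof (induction f arbitrary: i)
    case (Cons x f)
    have "{j. Suc j \<in> {i}} = (case i of 0 \<Rightarrow> {} | Suc k \<Rightarrow> {k})" by (auto split: nat.splits)
    then show ?case using Cons by (cases i) (auto simp: nths_Cons)
  qed simp
  show "i < length f \<Longrightarrow> nths f {i} = [f ! i]" by (rule single)
  show "i < j \<Longrightarrow> j < length f \<Longrightarrow> nths f {i, j} = [f ! i, f ! j]"
  proof (induction f arbitrary: i j)
    case (Cons x f)
    obtain j' where j: "j = Suc j'" using Cons.prems by (cases j) auto
    show ?case
    proof (cases i)
      case 0
      then have "{k. Suc k \<in> {i, j}} = {j'}" using j by auto
      then show ?thesis using 0 j Cons.prems single[of j' f] by (simp add: nths_Cons)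
    next
      case (Suc i')
      then have "{k. Suc k \<in> {i, j}} = {i', j'}" using j by auto
      then show ?thesis using Suc j Cons by (simp add: nths_Cons)
    qed
  qed simp
qed

lemma diag_form_metric:
  assumes "orthonormal_list f"
  shows "diag_form f metric_form (\<lambda>I. if card I = 1 then 1 else 0)"
  unfolding diag_form_def
proof (intro allI impI)
  fix I J assume IJ: "I \<subseteq> {..<length f}" "J \<subseteq> {..<length f}"
  show "metric_form (nths f I) (nths f J) = (if I = J then if card I = 1 then 1 else 0 else 0)"
  proof (cases "card I = 1 \<and> card J = 1")
    case True
    then obtain i j where "I = {i}" "J = {j}" by (metis card_1_singletonE)
    then show ?thesis using IJ orthonormal_list_nth[OF assms, of i j] by (simp add: nths_insert_less metric_form_def)
  next
    case False
    then show ?thesis using IJ by (auto simp: metric_form_simps length_nths_subset)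
  qed
qed

text \<open>One more factor splits a single element off a set of \<open>Suc m\<close> elements,
  which can be done in \<open>Suc m\<close> ways; hence the factorial.\<close>

lemma diag_form_dpower_metric:
  assumes "orthonormal_list f"
  shows "diag_form f (dpower metric_form m) (\<lambda>I. if card I = m then fact m else 0)"
proof (induction m)
  case 0
  show ?case unfolding dpower.simps by (rule diag_form_cong[OF diag_form_dunit]) simp
next
  case (Suc m)
  have "diag_form f (dpower metric_form (Suc m))
      (\<lambda>I. if card I = 1 + m then \<Sum>A | A \<subseteq> I \<and> card A = 1. 1 * fact m else 0)"
    using diag_form_dmult_graded[OF diag_form_metric[OF assms] Suc] by simp
  then show ?case
  proof (rule diag_form_cong)
    fix I assume "I \<subseteq> {..<length f}"
    then have "finite I" using finite_subset by blast
    then show "(if card I = 1 + m then \<Sum>A | A \<subseteq> I \<and> card A = 1. 1 * fact m else 0) =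
       (if card I = Suc m then fact (Suc m) else 0 :: real)"
      using n_subsets[of I 1] by simp
  qed
qed

text \<open>Every splitting of \<open>I\<close> contributes the same full product, so one more
  factor multiplies the constant by a number of two-element subsets. Only the positivity of the
  constant will matter.\<close>

lemma diag_form_dpower_prod:
  fixes \<mu> :: "nat \<Rightarrow> real"
  assumes "diag_form f \<rho> (\<lambda>I. if card I = 2 then \<Prod>i\<in>I. \<mu> i else 0)"
  shows "\<exists>a>0. diag_form f (dpower \<rho> k) (\<lambda>I. if card I = 2 * k then a * (\<Prod>i\<in>I. \<mu> i) else 0)"
proof (induction k)
  case 0
  have "diag_form f (dpower \<rho> 0) (\<lambda>I. if card I = 2 * 0 then 1 * (\<Prod>i\<in>I. \<mu> i) else 0)"
    unfolding dpower.simps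
    by (rule diag_form_cong[OF diag_form_dunit]) (auto dest: finite_subset)
  then show ?case by (intro exI[of _ 1] conjI) simp_all
next
  case (Suc k)
  then obtain a where a: "a > 0"
    "diag_form f (dpower \<rho> k) (\<lambda>I. if card I = 2 * k then a * (\<Prod>i\<in>I. \<mu> i) else 0)" by blast
  define b where "b = real ((2 + 2 * k) choose 2) * a"
  have "diag_form f (dpower \<rho> (Suc k))
      (\<lambda>I. if card I = 2 + 2 * k then \<Sum>A | A \<subseteq> I \<and> card A = 2. (\<Prod>i\<in>A. \<mu> i) * (a * (\<Prod>i\<in>I - A. \<mu> i)) else 0)"
    using diag_form_dmult_graded[OF assms a(2)] by simp
  then have "diag_form f (dpower \<rho> (Suc k)) (\<lambda>I. if card I = 2 * Suc k then b * (\<Prod>i\<in>I. \<mu> i) else 0)"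
  proof (rule diag_form_cong)
    fix I assume "I \<subseteq> {..<length f}"
    then have fin: "finite I" using finite_subset by blast
    have "(\<Sum>A | A \<subseteq> I \<and> card A = 2. (\<Prod>i\<in>A. \<mu> i) * (a * (\<Prod>i\<in>I - A. \<mu> i))) =
       (\<Sum>A | A \<subseteq> I \<and> card A = 2. a * (\<Prod>i\<in>I. \<mu> i))"
    proof (rule sum.cong[OF refl])
      fix A assume "A \<in> {A. A \<subseteq> I \<and> card A = 2}"
      then have "(\<Prod>i\<in>I. \<mu> i) = (\<Prod>i\<in>I - A. \<mu> i) * (\<Prod>i\<in>A. \<mu> i)"
        using prod.subset_diff[of A I \<mu>] fin by simp
      then show "(\<Prod>i\<in>A. \<mu> i) * (a * (\<Prod>i\<in>I - A. \<mu> i)) = a * (\<Prod>i\<in>I. \<mu> i)" by simp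
    qed
    also have "\<dots> = real (card I choose 2) * (a * (\<Prod>i\<in>I. \<mu> i))"
      using n_subsets[OF fin, of 2] by simp
    finally show "(if card I = 2 + 2 * k then \<Sum>A | A \<subseteq> I \<and> card A = 2. (\<Prod>i\<in>A. \<mu> i) * (a * (\<Prod>i\<in>I - A. \<mu> i)) else 0) =
       (if card I = 2 * Suc k then b * (\<Prod>i\<in>I. \<mu> i) else 0)" by (simp add: b_def)
  qed
  moreover have "b > 0" using a(1) by (simp add: b_def zero_less_binomial)
  ultimately show ?case by blast
qed

section \<open>Elementary symmetric polynomials\<close>

definition esym :: "nat \<Rightarrow> ('i \<Rightarrow> real) \<Rightarrow> 'i set \<Rightarrow> real" where
  "esym j \<mu> I = (\<Sum>B | B \<subseteq> I \<and> card B = j. \<Prod>i\<in>B. \<mu> i)"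

lemma diag_form_thorpe:
  fixes \<mu> :: "nat \<Rightarrow> real"
  assumes "orthonormal_list f" "diag_form f \<rho> (\<lambda>I. if card I = 2 then \<Prod>i\<in>I. \<mu> i else 0)"
  shows "\<exists>a>0. diag_form f (dmult (dpower metric_form m) (dpower \<rho> k))
    (\<lambda>I. if card I = m + 2 * k then a * esym (2 * k) \<mu> I else 0)"
proof -
  obtain a where a: "a > 0"
    "diag_form f (dpower \<rho> k) (\<lambda>I. if card I = 2 * k then a * (\<Prod>i\<in>I. \<mu> i) else 0)"
    using diag_form_dpower_prod[OF assms(2)] by blast
  have "diag_form f (dmult (dpower metric_form m) (dpower \<rho> k))
      (\<lambda>I. if card I = m + 2 * k then \<Sum>A | A \<subseteq> I \<and> card A = m. fact m * (a * (\<Prod>i\<in>I - A. \<mu> i)) else 0)"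
    by (rule diag_form_dmult_graded[OF diag_form_dpower_metric[OF assms(1)] a(2)])
  then have "diag_form f (dmult (dpower metric_form m) (dpower \<rho> k))
      (\<lambda>I. if card I = m + 2 * k then fact m * a * esym (2 * k) \<mu> I else 0)"
  proof (rule diag_form_cong)
    fix I assume "I \<subseteq> {..<length f}"
    then have fin: "finite I" using finite_subset by blast
    have "(\<Sum>A | A \<subseteq> I \<and> card A = m. fact m * (a * (\<Prod>i\<in>I - A. \<mu> i))) = fact m * a * esym (2 * k) \<mu> I"
      if c: "card I = m + 2 * k"
    proof -
      \<comment> \<open>The convolution is indexed by the part of \<open>I\<close> taken by the
        metric; passing to its complement gives the subsets of size \<open>2 * k\<close> in
        \<open>esym\<close>.\<close>
      have "bij_betw (\<lambda>A. I - A) {A. A \<subseteq> I \<and> card A = m} {B. B \<subseteq> I \<and> card B = 2 * k}"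
      proof (rule bij_betw_byWitness[where f' = "\<lambda>A. I - A"])
        show "(\<lambda>A. I - A) ` {A. A \<subseteq> I \<and> card A = m} \<subseteq> {B. B \<subseteq> I \<and> card B = 2 * k}"
          using c fin by (auto simp: card_Diff_subset finite_subset)
        show "(\<lambda>A. I - A) ` {B. B \<subseteq> I \<and> card B = 2 * k} \<subseteq> {A. A \<subseteq> I \<and> card A = m}"
          using c fin by (auto simp: card_Diff_subset finite_subset)
      qed auto
      then have "(\<Sum>A | A \<subseteq> I \<and> card A = m. fact m * (a * (\<Prod>i\<in>I - A. \<mu> i)))
         = (\<Sum>B | B \<subseteq> I \<and> card B = 2 * k. fact m * (a * (\<Prod>i\<in>B. \<mu> i)))"
        using sum.reindex_bij_betw[of "\<lambda>A. I - A" _ _ "\<lambda>B. fact m * (a * (\<Prod>i\<in>B. \<mu> i))"] by simp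
      then show ?thesis by (simp add: esym_def sum_distrib_left mult.assoc)
    qed
    then show "(if card I = m + 2 * k then \<Sum>A | A \<subseteq> I \<and> card A = m. fact m * (a * (\<Prod>i\<in>I - A. \<mu> i)) else 0) =
       (if card I = m + 2 * k then fact m * a * esym (2 * k) \<mu> I else 0)" by simp
  qed
  then show ?thesis using a(1) by (intro exI[of _ "fact m * a"]) simp
qed

lemma esym_insert:
  assumes "finite A" "i \<notin> A"
  shows "esym (Suc j) \<mu> (insert i A) = esym (Suc j) \<mu> A + \<mu> i * esym j \<mu> A"
proof -
  let ?P = "{B. B \<subseteq> A \<and> card B = Suc j}" and ?Q = "{B. B \<subseteq> A \<and> card B = j}"
  have fin: "finite ?P" "finite ?Q" using assms(1) by auto
  have finB: "finite B" if "B \<subseteq> A" for B using that assms(1) finite_subset by blast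
  have "{B. B \<subseteq> insert i A \<and> card B = Suc j} = ?P \<union> insert i ` ?Q"
  proof (intro equalityI subsetI)
    fix B assume B: "B \<in> {B. B \<subseteq> insert i A \<and> card B = Suc j}"
    show "B \<in> ?P \<union> insert i ` ?Q"
    proof (cases "i \<in> B")
      case True
      then have "B = insert i (B - {i})" "B - {i} \<subseteq> A" "card (B - {i}) = j" using B by auto
      then show ?thesis by blast
    qed (use B in auto)
  next
    fix B assume "B \<in> ?P \<union> insert i ` ?Q"
    moreover have "card (insert i C) = Suc (card C)" if "C \<subseteq> A" for C
      using that assms finB by (intro card_insert_disjoint) auto
    ultimately show "B \<in> {B. B \<subseteq> insert i A \<and> card B = Suc j}" by auto
  qed
  moreover have "?P \<inter> insert i ` ?Q = {}" using assms(2) by auto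
  ultimately have "esym (Suc j) \<mu> (insert i A) = (\<Sum>B\<in>?P. \<Prod>i\<in>B. \<mu> i) + (\<Sum>B\<in>insert i ` ?Q. \<Prod>i\<in>B. \<mu> i)"
    unfolding esym_def using fin by (simp add: sum.union_disjoint)
  also have "(\<Sum>B\<in>insert i ` ?Q. \<Prod>i\<in>B. \<mu> i) = (\<Sum>B\<in>?Q. \<Prod>i\<in>insert i B. \<mu> i)"
    using assms(2) by (subst sum.reindex) (auto simp: inj_on_def)
  also have "\<dots> = (\<Sum>B\<in>?Q. \<mu> i * (\<Prod>i\<in>B. \<mu> i))"
    using assms(2) finB by (intro sum.cong refl prod.insert) auto
  finally show ?thesis by (simp add: esym_def sum_distrib_left)
qed

lemma esym_pos:
  assumes "finite A" "j \<le> card A" "\<And>i. i \<in> A \<Longrightarrow> \<mu> i > 0"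
  shows "esym j \<mu> A > 0"
  unfolding esym_def
proof (rule sum_pos)
  show "finite {B. B \<subseteq> A \<and> card B = j}" using assms(1) by simp
  show "{B. B \<subseteq> A \<and> card B = j} \<noteq> {}" using obtain_subset_with_card_n[OF assms(2)] by blast
  show "(\<Prod>i\<in>B. \<mu> i) > 0" if "B \<in> {B. B \<subseteq> A \<and> card B = j}" for B
    using that assms(3) by (intro prod_pos) auto
qed

lemma esym_scale: "esym j (\<lambda>i. s * \<mu> i) A = s ^ j * esym j \<mu> A"
  unfolding esym_def sum_distrib_left by (intro sum.cong) (auto simp: prod.distrib)

lemma esym_const: "finite A \<Longrightarrow> esym j (\<lambda>i. s) A = real (card A choose j) * s ^ j"
  using n_subsets[of A j] by (simp add: esym_def)

lemma complementary_esym_imp_equal_pos: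
  assumes pos: "\<And>i. i < 2 * r \<Longrightarrow> \<mu> i > 0" and j: "0 < j" "j \<le> r"
    and eq: "\<And>I. I \<subseteq> {..<2 * r} \<Longrightarrow> card I = r \<Longrightarrow> esym j \<mu> ({..<2 * r} - I) = esym j \<mu> I"
    and il: "i < 2 * r" "l < 2 * r"
  shows "\<mu> i = \<mu> l"
proof (cases "i = l")
  case False
  obtain j' where j': "j = Suc j'" using j by (cases j) auto
  let ?X = "{..<2 * r} - {i, l}"
  have cX: "card ?X = 2 * r - 2" using False il by (subst card_Diff_subset) auto
  then have "r - 1 \<le> card ?X" by simp
  then obtain A where A: "A \<subseteq> ?X" "card A = r - 1" "finite A" by (rule obtain_subset_with_card_n)
  define C where "C = ?X - A"
  have C: "C \<subseteq> ?X" "card C = r - 1" "finite C"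
    using cX A by (auto simp: C_def card_Diff_subset)
  have e1: "{..<2 * r} - insert i A = insert l C" and e2: "{..<2 * r} - insert l A = insert i C"
    using False il A(1) unfolding C_def by auto
  have nin: "i \<notin> A" "l \<notin> A" "i \<notin> C" "l \<notin> C" using A(1) C(1) by auto
  have sub: "insert i A \<subseteq> {..<2 * r}" "insert l A \<subseteq> {..<2 * r}" using A(1) il by auto
  have crd: "card (insert i A) = r" "card (insert l A) = r" using A nin j by auto
  have "esym j \<mu> (insert l C) = esym j \<mu> (insert i A)" using eq[OF sub(1) crd(1)] e1 by simp
  moreover have "esym j \<mu> (insert i C) = esym j \<mu> (insert l A)" using eq[OF sub(2) crd(2)] e2 by simp
  ultimately have "(\<mu> i - \<mu> l) * (esym j' \<mu> A + esym j' \<mu> C) = 0"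
    unfolding j' esym_insert[OF A(3) nin(1)] esym_insert[OF A(3) nin(2)]
      esym_insert[OF C(3) nin(3)] esym_insert[OF C(3) nin(4)]
    by (simp add: algebra_simps)
  \<comment> \<open>\<open>A\<close> and \<open>C\<close> have \<open>r - 1\<close> elements and
    \<open>j'\<close> is \<open>j - 1\<close>, so \<open>j \<le> r\<close> guarantees that neither
    sum is empty.\<close>
  moreover have "esym j' \<mu> A > 0" "esym j' \<mu> C > 0"
    using A C j j' pos by (auto intro!: esym_pos)
  ultimately show ?thesis by simp
qed simp

text \<open>The normal may point either way, so the curvatures may all be negative. By homogeneity,
  scaling with \<open>s\<close> multiplies both sides of the hypothesis by
  \<open>s ^ j\<close>.\<close>

lemma complementary_esym_imp_equal:
  assumes pos: "\<And>i. i < 2 * r \<Longrightarrow> s * \<mu> i > 0" and j: "0 < j" "j \<le> r"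
    and eq: "\<And>I. I \<subseteq> {..<2 * r} \<Longrightarrow> card I = r \<Longrightarrow> esym j \<mu> ({..<2 * r} - I) = esym j \<mu> I"
    and il: "i < 2 * r" "l < 2 * r"
  shows "\<mu> i = \<mu> l"
proof -
  have "s * \<mu> i = s * \<mu> l"
    using complementary_esym_imp_equal_pos[of r "\<lambda>i. s * \<mu> i" j i l] assms by (simp add: esym_scale)
  moreover have "s \<noteq> 0" using pos[OF il(1)] by auto
  ultimately show ?thesis by simp
qed

section \<open>Diagonalisation of symmetric bilinear forms\<close>

lemma quadratic_bound_zero:
  fixes a b :: real
  assumes "\<And>t. 2 * t * a \<le> t\<^sup>2 * b"
  shows "a = 0"
proof (rule ccontr)
  assume a: "a \<noteq> 0"
  \<comment> \<open>Chosen so that the quadratic side is at most \<open>t * a\<close>, half of the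
    linear side, although \<open>t * a > 0\<close>.\<close>
  define t where "t = a / (\<bar>b\<bar> + 1)"
  have b: "\<bar>b\<bar> + 1 > 0" by simp
  have "t\<^sup>2 * b \<le> t\<^sup>2 * (\<bar>b\<bar> + 1)" by (intro mult_left_mono) auto
  also have "\<dots> = t * a" using b by (simp add: t_def power2_eq_square)
  finally have "2 * t * a \<le> t * a" using assms[of t] by linarith
  moreover have "t * a > 0" using a b by (simp add: t_def divide_pos_pos zero_less_mult_iff flip: power2_eq_square)
  ultimately show False by linarith
qed

text \<open>A maximiser \<open>e\<close> of the quadratic form on the unit sphere of
  \<open>T\<close> is \<open>h\<close>-orthogonal to its orthogonal complement: otherwise moving
  from \<open>e\<close> towards \<open>y\<close> would increase the form to first order. Induction
  on the dimension then treats the complement.\<close>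

lemma spectral_bilinear:
  fixes h :: "'a::euclidean_space \<Rightarrow> 'a \<Rightarrow> real"
  assumes h: "bilinear h" and sym: "\<And>x y. h x y = h y x" and "subspace T"
  shows "\<exists>f. orthonormal_basis T f \<and> (\<forall>x\<in>set f. \<forall>y\<in>set f. x \<noteq> y \<longrightarrow> h x y = 0)"
  using assms(3)
proof (induction "dim T" arbitrary: T rule: less_induct)
  case less
  show ?case
  proof (cases "T = {0}")
    case True
    then show ?thesis by (intro exI[of _ "[]"]) (simp add: orthonormal_basis_def)
  next
    case False
    let ?S = "T \<inter> sphere 0 1"
    obtain z where "z \<in> T" "z \<noteq> 0" using False less.prems subspace_0 by blast
    then have "z /\<^sub>R norm z \<in> ?S" using less.prems by (simp add: subspace_mul)
    then have ne: "?S \<noteq> {}" by blast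
    have cpt: "compact ?S" using closed_subspace[OF less.prems] by (simp add: closed_Int_compact)
    have "bounded_bilinear h" using h by (simp add: bilinear_conv_bounded_bilinear)
    then have "continuous_on ?S (\<lambda>x. h x x)"
      by (rule bounded_bilinear.continuous_on[OF _ continuous_on_id continuous_on_id])
    from continuous_attains_sup[OF cpt ne this]
    obtain e where e: "e \<in> ?S" "\<And>x. x \<in> ?S \<Longrightarrow> h x x \<le> h e e" by blast
    have eT: "e \<in> T" and ee: "e \<bullet> e = 1" using e(1) by (auto simp: norm_eq_1)
    note bil = bilinear_ladd[OF h] bilinear_radd[OF h] bilinear_lmul[OF h] bilinear_rmul[OF h]
    have max: "h x x \<le> h e e * (x \<bullet> x)" if "x \<in> T" for x
    proof (cases "x = 0")
      case True
      then show ?thesis using bilinear_lzero[OF h] by simp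
    next
      case False
      then have "x /\<^sub>R norm x \<in> ?S" using that less.prems by (simp add: subspace_mul)
      from e(2)[OF this] have "h x x / (norm x)\<^sup>2 \<le> h e e"
        by (simp add: bil power2_eq_square divide_inverse mult_ac)
      then show ?thesis using False by (simp add: divide_le_eq power2_norm_eq_inner)
    qed
    have orth: "h e y = 0" if y: "y \<in> T" "e \<bullet> y = 0" for y
    proof (rule quadratic_bound_zero)
      fix t :: real
      have "e + t *\<^sub>R y \<in> T" using y eT less.prems by (simp add: subspace_add subspace_mul)
      from max[OF this] show "2 * t * h e y \<le> t\<^sup>2 * (h e e * (y \<bullet> y) - h y y)"
        using y(2) ee by (simp add: bil inner_add_left inner_add_right inner_commute[of y e] sym[of y e]
            power2_eq_square algebra_simps)
    qed
    define T' where "T' = {y \<in> T. e \<bullet> y = 0}"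
    have T': "subspace T'" using less.prems
      by (auto simp: T'_def subspace_def inner_add_right)
    have "e \<notin> T'" using ee by (simp add: T'_def)
    moreover have "T' \<subseteq> T" by (auto simp: T'_def)
    ultimately have "T' \<subset> T" using eT by blast
    then have "dim T' < dim T"
      using T' less.prems by (intro dim_psubset) (simp add: span_eq_iff[THEN iffD2])
    from less.hyps[OF this T'] obtain f where f: "orthonormal_basis T' f"
      "\<And>x y. x \<in> set f \<Longrightarrow> y \<in> set f \<Longrightarrow> x \<noteq> y \<Longrightarrow> h x y = 0" by blast
    have onf: "orthonormal_list f" and spf: "span (set f) = T'" using f(1) by (auto simp: orthonormal_basis_iff)
    have fT': "x \<in> T'" if "x \<in> set f" for x using that spf span_base by blast
    have fe: "e \<bullet> x = 0" "x \<bullet> e = 0" "h e x = 0" "h x e = 0" if "x \<in> set f" for x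
      using fT'[OF that] orth[of x] sym[of x e] by (auto simp: T'_def inner_commute)
    have "e \<notin> set f" using fT' \<open>e \<notin> T'\<close> by blast
    then have "orthonormal_list (e # f)" using onf ee fe unfolding orthonormal_list_def by auto
    moreover have "span (set (e # f)) = T"
    proof (rule span_subspace[OF _ _ less.prems])
      show "set (e # f) \<subseteq> T" using eT fT' by (auto simp: T'_def)
      show "T \<subseteq> span (set (e # f))"
      proof
        fix x assume "x \<in> T"
        then have "x - (e \<bullet> x) *\<^sub>R e \<in> T'"
          using eT ee less.prems by (simp add: T'_def subspace_diff subspace_mul inner_diff_right)
        then have "x - (e \<bullet> x) *\<^sub>R e \<in> span (set (e # f))"
          using spf span_mono[of "set f" "set (e # f)"] by auto
        moreover have "(e \<bullet> x) *\<^sub>R e \<in> span (set (e # f))" by (intro span_mul span_base) simp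
        ultimately show "x \<in> span (set (e # f))" using span_add by fastforce
      qed
    qed
    ultimately have "orthonormal_basis T (e # f)" by (simp add: orthonormal_basis_iff)
    moreover have "h x y = 0" if "x \<in> set (e # f)" "y \<in> set (e # f)" "x \<noteq> y" for x y
      using that f(2) fe by auto
    ultimately show ?thesis by blast
  qed
qed

section \<open>The Gauss equation\<close>

text \<open>Composed with a curve of velocity \<open>v\<close>, both candidates give the derivative
  at 0 of one function of a real variable, and that is unique.\<close>

lemma tangent_deriv_unique:
  assumes "v \<in> tangent_space M p" "(f has_derivative f') (at p within M)" "(f has_derivative f'') (at p within M)"
  shows "f' v = f'' v"
proof -
  from assms(1) obtain \<epsilon> and \<gamma> :: "real \<Rightarrow> 'a" where \<epsilon>: "\<epsilon> > 0" "\<gamma> ` {-\<epsilon><..<\<epsilon>} \<subseteq> M" "\<gamma> 0 = p"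
    and \<gamma>: "(\<gamma> has_vector_derivative v) (at 0)"
    unfolding tangent_space_def mem_Collect_eq by (elim exE conjE) (rule that; assumption)
  have *: "((g \<circ> \<gamma>) has_derivative (g' \<circ> (\<lambda>t. t *\<^sub>R v))) (at 0)" if "(g has_derivative g') (at p within M)" for g g'
  proof -
    have "(g has_derivative g') (at (\<gamma> 0) within \<gamma> ` {-\<epsilon><..<\<epsilon>})"
      using has_derivative_subset[OF that \<epsilon>(2)] \<epsilon>(3) by simp
    moreover have "(\<gamma> has_derivative (\<lambda>t. t *\<^sub>R v)) (at 0 within {-\<epsilon><..<\<epsilon>})"
      using \<gamma> has_derivative_at_withinI unfolding has_vector_derivative_def by blast
    ultimately have "((g \<circ> \<gamma>) has_derivative (g' \<circ> (\<lambda>t. t *\<^sub>R v))) (at 0 within {-\<epsilon><..<\<epsilon>})"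
      by (rule diff_chain_within[rotated])
    then show ?thesis using \<epsilon>(1) at_within_open[of 0 "{-\<epsilon><..<\<epsilon>}"] by simp
  qed
  have "f' \<circ> (\<lambda>t. t *\<^sub>R v) = f'' \<circ> (\<lambda>t. t *\<^sub>R v)"
    using has_derivative_unique[OF *[OF assms(2)] *[OF assms(3)]] .
  from fun_cong[OF this, of 1] show ?thesis by simp
qed

lemma has_derivative_within_transform:
  assumes "(F has_derivative F') (at p)" "p \<in> M" "open U" "p \<in> U" "\<And>q. q \<in> M \<inter> U \<Longrightarrow> F q = f q"
  shows "(f has_derivative F') (at p within M)"
proof -
  obtain d where d: "d > 0" "\<And>q. dist q p < d \<Longrightarrow> q \<in> U" using assms(3,4) unfolding open_dist by blast
  show ?thesis
    by (rule has_derivative_transform_within[OF has_derivative_at_withinI[OF assms(1)] d(1) assms(2)])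
      (use assms(5) d(2) in blast)
qed

lemma tangent_deriv_eq:
  assumes "v \<in> tangent_space M p" "F differentiable at p" "G differentiable at p"
    "p \<in> M" "open U" "p \<in> U" "\<And>q. q \<in> M \<inter> U \<Longrightarrow> F q = G q"
  shows "fd F p v = fd G p v"
proof -
  have F: "(F has_derivative fd F p) (at p)" and G: "(G has_derivative fd G p) (at p)"
    using assms(2,3) unfolding frechet_derivative_works by simp_all
  show ?thesis
    by (rule tangent_deriv_unique[OF assms(1) has_derivative_within_transform[OF F assms(4-7)] has_derivative_at_withinI[OF G]])
qed

text \<open>Replaces the derivative within \<open>M\<close> by the ordinary derivative of any local
  extension, so that later computations can take place in open sets of the ambient space.\<close>

lemma deriv_along_eq:
  assumes "F differentiable at p" "p \<in> M" "open U" "p \<in> U" "\<And>q. q \<in> M \<inter> U \<Longrightarrow> F q = f q"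
    "X p \<in> tangent_space M p"
  shows "deriv_along M X f p = fd F p (X p)"
proof -
  have "(F has_derivative fd F p) (at p)" using assms(1) frechet_derivative_works by blast
  then have 1: "(f has_derivative fd F p) (at p within M)"
    by (rule has_derivative_within_transform[OF _ assms(2-4)]) (rule assms(5))
  then have "(f has_derivative frechet_derivative f (at p within M)) (at p within M)"
    unfolding frechet_derivative_works[symmetric] by (rule differentiableI)
  then show ?thesis unfolding deriv_along_def by (rule tangent_deriv_unique[OF assms(6) _ 1])
qed

section \<open>Slice charts and local normal fields\<close>

definition slice_chart :: "'a::euclidean_space set \<Rightarrow> 'a set \<Rightarrow> 'a set \<Rightarrow> 'a set \<Rightarrow> ('a \<Rightarrow> 'a) \<Rightarrow> ('a \<Rightarrow> 'a) \<Rightarrow> bool" where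
  "slice_chart M U V H \<phi> \<psi> \<longleftrightarrow> open U \<and> open V \<and> homeomorphism U V \<phi> \<psi> \<and> smooth_on U \<phi> \<and> smooth_on V \<psi> \<and>
     subspace H \<and> Suc (dim H) = DIM('a) \<and> \<phi> ` (M \<inter> U) = V \<inter> H"

lemma embedded_hypersurface_iff:
  fixes M :: "'a::euclidean_space set"
  shows "embedded_hypersurface M \<longleftrightarrow> (\<forall>p\<in>M. \<exists>U V H \<phi> \<psi>. slice_chart M U V H \<phi> \<psi> \<and> p \<in> U)"
  unfolding embedded_hypersurface_def slice_chart_def by (simp only: conj_ac)

lemma embedded_hypersurface_chart:
  assumes "embedded_hypersurface M" "p \<in> M"
  obtains U V H \<phi> \<psi> where "slice_chart M U V H \<phi> \<psi>" "p \<in> U"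
  using assms unfolding embedded_hypersurface_iff by blast

lemma slice_chart_inv:
  assumes "slice_chart M U V H \<phi> \<psi>"
  shows "q \<in> U \<Longrightarrow> \<psi> (\<phi> q) = q" "q \<in> U \<Longrightarrow> \<phi> q \<in> V" "y \<in> V \<Longrightarrow> \<phi> (\<psi> y) = y" "y \<in> V \<Longrightarrow> \<psi> y \<in> U"
    "y \<in> V \<Longrightarrow> y \<in> H \<longleftrightarrow> \<psi> y \<in> M"
proof -
  have h: "homeomorphism U V \<phi> \<psi>" and im: "\<phi> ` (M \<inter> U) = V \<inter> H" using assms by (auto simp: slice_chart_def)
  show a: "\<psi> (\<phi> q) = q" if "q \<in> U" for q using h that by (simp add: homeomorphism_def)
  show "\<phi> q \<in> V" if "q \<in> U" using h that by (auto simp: homeomorphism_def)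
  show b: "\<phi> (\<psi> y) = y" if "y \<in> V" for y using h that by (simp add: homeomorphism_def)
  show c: "\<psi> y \<in> U" if "y \<in> V" for y using h that by (auto simp: homeomorphism_def)
  show "y \<in> H \<longleftrightarrow> \<psi> y \<in> M" if y: "y \<in> V"
  proof
    assume "y \<in> H"
    then have "y \<in> \<phi> ` (M \<inter> U)" using im y by blast
    then obtain m where "m \<in> M" "m \<in> U" "y = \<phi> m" by blast
    then show "\<psi> y \<in> M" using a by simp
  next
    assume "\<psi> y \<in> M"
    then have "\<phi> (\<psi> y) \<in> \<phi> ` (M \<inter> U)" using c[OF y] by blast
    then show "y \<in> H" using im b[OF y] by auto
  qed
qed

lemma slice_chart_fd:
  assumes "slice_chart M U V H \<phi> \<psi>" 
  shows "q \<in> U \<Longrightarrow> fd \<psi> (\<phi> q) (fd \<phi> q v) = v" "y \<in> V \<Longrightarrow> fd \<phi> (\<psi> y) (fd \<psi> y v) = v"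
proof -
  note [simp] = slice_chart_inv[OF assms]
  have s: "open U" "open V" "smooth_on U \<phi>" "smooth_on V \<psi>" using assms by (auto simp: slice_chart_def)
  have *: "fd g (f x) (fd f x v) = v"
    if "open S" "x \<in> S" "smooth_on S f" "smooth_on S' g" "f x \<in> S'" "\<And>z. z \<in> S \<Longrightarrow> g (f z) = z"
    for f g :: "'a \<Rightarrow> 'a" and S S' x v
  proof -
    have "((g \<circ> f) has_derivative (fd g (f x) \<circ> fd f x)) (at x)"
      using that by (intro diff_chain_at smooth_on_has_derivative)
    moreover have "((g \<circ> f) has_derivative (\<lambda>v. v)) (at x)"
      by (rule has_derivative_transform_within_open[OF has_derivative_ident that(1,2)]) (simp add: that(6))
    ultimately have "fd g (f x) \<circ> fd f x = (\<lambda>v. v)" by (rule has_derivative_unique)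
    from fun_cong[OF this, of v] show ?thesis by simp
  qed
  show "q \<in> U \<Longrightarrow> fd \<psi> (\<phi> q) (fd \<phi> q v) = v" using *[of U q \<phi> V \<psi>] s by simp
  show "y \<in> V \<Longrightarrow> fd \<phi> (\<psi> y) (fd \<psi> y v) = v" using *[of V y \<psi> U \<phi>] s by simp
qed

lemma affine_line_smooth: "smooth_on S (\<lambda>t::real. y + t *\<^sub>R w)" if "open S"
  by (intro smooth_on_add smooth_on_scaleR smooth_on_const smooth_on_ident that)

lemma slice_chart_line:
  assumes c: "slice_chart M U V H \<phi> \<psi>" and "y + t *\<^sub>R w \<in> V" 
  shows "((\<lambda>t. \<psi> (y + t *\<^sub>R w)) has_vector_derivative fd \<psi> (y + t *\<^sub>R w) w) (at t)"
proof -
  have s: "smooth_on V \<psi>" using c by (auto simp: slice_chart_def)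
  have d: "(\<psi> has_derivative fd \<psi> (y + t *\<^sub>R w)) (at (y + t *\<^sub>R w))"
    using smooth_on_has_derivative[OF s assms(2)] .
  have "((\<lambda>t. y + t *\<^sub>R w) has_derivative (\<lambda>r. r *\<^sub>R w)) (at t)" by (auto intro!: derivative_eq_intros)
  from diff_chain_at[OF this d] have "((\<lambda>t. \<psi> (y + t *\<^sub>R w)) has_derivative (\<lambda>r. fd \<psi> (y + t *\<^sub>R w) (r *\<^sub>R w))) (at t)"
    by (simp add: o_def)
  moreover have "fd \<psi> (y + t *\<^sub>R w) (r *\<^sub>R w) = r *\<^sub>R fd \<psi> (y + t *\<^sub>R w) w" for r
    using has_derivative_linear[OF d] by (simp add: linear_cmul)
  ultimately show ?thesis by (simp add: has_vector_derivative_def)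
qed

text \<open>\<open>\<psi>\<close> carries a straight segment in \<open>H\<close> to a smooth curve
  in \<open>M\<close>.\<close>

lemma slice_chart_tangent:
  assumes c: "slice_chart M U V H \<phi> \<psi>" and y: "y \<in> V" "y \<in> H" and w: "w \<in> H"
  shows "fd \<psi> y w \<in> tangent_space M (\<psi> y)"
proof -
  have s: "open V" "smooth_on V \<psi>" "subspace H" using c by (auto simp: slice_chart_def)
  let ?l = "\<lambda>t::real. y + t *\<^sub>R w"
  have "open (?l -` V)"
    by (rule continuous_open_vimage[OF s(1)]) (auto intro!: continuous_intros)
  moreover have "0 \<in> ?l -` V" using y by simp
  ultimately obtain \<epsilon> where \<epsilon>: "\<epsilon> > 0" "\<And>t. dist t 0 < \<epsilon> \<Longrightarrow> t \<in> ?l -` V"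
    unfolding open_dist by blast
  have inV: "?l t \<in> V" if "t \<in> {-\<epsilon><..<\<epsilon>}" for t using \<epsilon>(2)[of t] that by (auto simp: dist_real_def)
  have inH: "?l t \<in> H" for t using y w s(3) by (simp add: subspace_add subspace_mul)
  have "smooth_on {-\<epsilon><..<\<epsilon>} (\<lambda>t. \<psi> (?l t))"
    by (rule smooth_on_compose[OF _ _ affine_line_smooth s(2)]) (use inV in auto)
  moreover have "(\<lambda>t. \<psi> (?l t)) ` {-\<epsilon><..<\<epsilon>} \<subseteq> M"
    using inV inH slice_chart_inv(5)[OF c] by blast
  moreover have "((\<lambda>t. \<psi> (?l t)) has_vector_derivative fd \<psi> y w) (at 0)"
    using slice_chart_line[OF c, of y 0 w] y by simp
  ultimately show ?thesis unfolding tangent_space_def mem_Collect_eq using \<epsilon>(1)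
    by (intro exI[of _ \<epsilon>] exI[of _ "\<lambda>t. \<psi> (?l t)"] conjI) simp_all
qed

text \<open>\<open>N\<close> is not normalised; its derivative is symmetric because \<open>N\<close> will be the gradient of a
  local defining function.\<close>

definition local_normal :: "'a::euclidean_space set \<Rightarrow> 'a set \<Rightarrow> ('a \<Rightarrow> 'a) \<Rightarrow> bool" where
  "local_normal M U N \<longleftrightarrow> open U \<and> smooth_on U N \<and>
     (\<forall>q\<in>U. N q \<noteq> 0 \<and> (\<forall>x y. fd N q x \<bullet> y = fd N q y \<bullet> x)) \<and>
     (\<forall>q\<in>M \<inter> U. tangent_space M q = {v. N q \<bullet> v = 0})"

lemma local_normalD:
  assumes "local_normal M U N"
  shows "open U" "smooth_on U N" "q \<in> U \<Longrightarrow> N q \<noteq> 0" "q \<in> U \<Longrightarrow> fd N q x \<bullet> y = fd N q y \<bullet> x"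
    "q \<in> M \<Longrightarrow> q \<in> U \<Longrightarrow> tangent_space M q = {v. N q \<bullet> v = 0}"
  using assms unfolding local_normal_def by blast+

lemma local_normal_subset: "local_normal M U N \<Longrightarrow> open V \<Longrightarrow> V \<subseteq> U \<Longrightarrow> local_normal M V N"
  unfolding local_normal_def using smooth_on_subset by blast

text \<open>If \<open>H\<close> is the kernel of \<open>a\<close>, then
  \<open>F q = a \<bullet> \<phi> q\<close> is a defining function of \<open>M\<close> near
  \<open>p\<close>, and \<open>N\<close> is its gradient. It does not vanish, as the direction
  \<open>fd \<psi> (\<phi> q) a\<close> has derivative \<open>a \<bullet> a\<close>; the derivative
  of \<open>N\<close> is the Hessian of \<open>F\<close>, hence symmetric.\<close>

lemma local_normal_exists:
  assumes "embedded_hypersurface M" "p \<in> M"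
  obtains U N where "p \<in> U" "local_normal M U N"
proof -
  obtain U V H \<phi> \<psi> where c: "slice_chart M U V H \<phi> \<psi>" and p: "p \<in> U"
    using embedded_hypersurface_chart[OF assms] by blast
  have s: "open U" "open V" "smooth_on U \<phi>" "smooth_on V \<psi>" "subspace H" "Suc (dim H) = DIM('a)"
    using c by (auto simp: slice_chart_def)
  obtain a where a: "a \<noteq> 0" "span H = {x. a \<bullet> x = 0}"
    using dim_eq_hyperplane[of H] s(6) by force
  have H: "H = {x. a \<bullet> x = 0}" using a s(5) by (simp add: span_eq_iff[THEN iffD2])
  define F where "F q = a \<bullet> \<phi> q" for q
  have sF: "smooth_on U F" unfolding F_def by (intro smooth_on_inner smooth_on_const s)
  have fdF: "fd F q v = a \<bullet> fd \<phi> q v" if "q \<in> U" for q v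
    unfolding F_def using smooth_on_differentiable[OF s(3) that] by (simp add: fd_inner)
  define N where "N q = (\<Sum>b\<in>Basis. fd F q b *\<^sub>R b)" for q
  have sN: "smooth_on U N" unfolding N_def
    by (intro smooth_on_sum smooth_on_scaleR smooth_on_const smooth_on_fd sF s)
  have NF: "N q \<bullet> v = fd F q v" if "q \<in> U" for q v
    using fd_expand[OF smooth_on_differentiable[OF sF that], of v]
    by (simp add: N_def inner_sum_left inner_sum_right inner_commute mult.commute)
  have "N q \<noteq> 0" if "q \<in> U" for q
  proof -
    have "N q \<bullet> fd \<psi> (\<phi> q) a = a \<bullet> fd \<phi> (\<psi> (\<phi> q)) (fd \<psi> (\<phi> q) a)"
      using NF[OF that] fdF[OF that] slice_chart_inv(1)[OF c that] by simp
    also have "\<dots> = a \<bullet> a" using slice_chart_fd(2)[OF c] slice_chart_inv(2)[OF c that] by simp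
    finally show ?thesis using a(1) by auto
  qed
  moreover have "fd N q x \<bullet> y = fd N q y \<bullet> x" if q: "q \<in> U" for q x y
  proof -
    have "fd N q x \<bullet> y = fd (\<lambda>q. fd F q y) q x" for x y
    proof -
      have "fd (\<lambda>q. fd F q y) q x = fd (\<lambda>q. N q \<bullet> y) q x"
        using fd_cong_open[OF s(1) q, of "\<lambda>q. fd F q y" "\<lambda>q. N q \<bullet> y"] NF by simp
      then show ?thesis using smooth_on_differentiable[OF sN q] by (simp add: fd_inner)
    qed
    then show ?thesis using second_derivative_symmetric[OF s(1) q sF] by simp
  qed
  moreover have "tangent_space M q = {v. N q \<bullet> v = 0}" if q: "q \<in> M \<inter> U" for q
  proof (intro equalityI subsetI)
    fix v assume v: "v \<in> tangent_space M q"
    have "F m = 0" if "m \<in> M \<inter> U" for m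
    proof -
      have "\<phi> m \<in> V" "\<psi> (\<phi> m) = m" using slice_chart_inv[OF c] that by auto
      then have "\<phi> m \<in> H" using slice_chart_inv(5)[OF c, of "\<phi> m"] that by simp
      then show ?thesis by (simp add: F_def H)
    qed
    then have "fd F q v = fd (\<lambda>_. 0) q v"
      using q by (intro tangent_deriv_eq[OF v _ _ _ s(1)] smooth_on_differentiable[OF sF]) auto
    then show "v \<in> {v. N q \<bullet> v = 0}" using NF q by simp
  next
    fix v assume "v \<in> {v. N q \<bullet> v = 0}"
    then have "fd \<phi> q v \<in> H" using NF[of q v] fdF[of q v] q by (simp add: H)
    moreover have "\<phi> q \<in> V" "\<phi> q \<in> H"
      using q slice_chart_inv[OF c, of q] slice_chart_inv(5)[OF c, of "\<phi> q"] by auto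
    ultimately show "v \<in> tangent_space M q"
      using slice_chart_tangent[OF c, of "\<phi> q" "fd \<phi> q v"] slice_chart_fd(1)[OF c, of q v]
        slice_chart_inv(1)[OF c, of q] q by simp
  qed
  ultimately have "local_normal M U N" unfolding local_normal_def using s(1) sN by blast
  then show ?thesis using that p by blast
qed

lemma subspace_tangent_space:
  assumes "embedded_hypersurface M" "p \<in> M"
  shows "subspace (tangent_space M p)"
proof -
  obtain U N where "p \<in> U" "local_normal M U N" using local_normal_exists[OF assms] by blast
  then show ?thesis using local_normalD(5)[of M U N p] assms(2) subspace_hyperplane[of "N p"] by simp
qed

section \<open>Tangential projection and local extensions\<close>

definition nproj :: "'a::euclidean_space \<Rightarrow> 'a \<Rightarrow> 'a" where
  "nproj n v = v - ((v \<bullet> n) / (n \<bullet> n)) *\<^sub>R n"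

text \<open>Characterised without a normal field, so that it is defined on all of \<open>M\<close>;
  on the domain of a local normal it is \<open>nproj\<close>, from which smoothness is read
  off.\<close>

definition tproj :: "'a::euclidean_space set \<Rightarrow> 'a \<Rightarrow> 'a \<Rightarrow> 'a" where
  "tproj M p v = (THE w. w \<in> tangent_space M p \<and> (\<forall>z\<in>tangent_space M p. (v - w) \<bullet> z = 0))"

lemma nproj_orthogonal: "n \<noteq> 0 \<Longrightarrow> n \<bullet> nproj n v = 0"
  by (simp add: nproj_def inner_diff_right inner_commute)

lemma nproj_inner: "n \<bullet> z = 0 \<Longrightarrow> nproj n v \<bullet> z = v \<bullet> z"
  by (simp add: nproj_def inner_diff_left)

lemma nproj_id: "n \<bullet> v = 0 \<Longrightarrow> nproj n v = v"
  by (simp add: nproj_def inner_commute)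

lemma nproj_add: "nproj n (v + w) = nproj n v + nproj n w"
  by (simp add: nproj_def inner_add_left add_divide_distrib algebra_simps)

lemma nproj_diff: "nproj n (v - w) = nproj n v - nproj n w"
  by (simp add: nproj_def inner_diff_left diff_divide_distrib algebra_simps)

lemma nproj_scaleR: "nproj n (c *\<^sub>R v) = c *\<^sub>R nproj n v"
  by (simp add: nproj_def algebra_simps)

lemma tproj_eq_nproj:
  assumes "local_normal M U N" "q \<in> M" "q \<in> U"
  shows "tproj M q v = nproj (N q) v"
proof -
  have T: "tangent_space M q = {v. N q \<bullet> v = 0}" and N: "N q \<noteq> 0" using local_normalD[OF assms(1)] assms by blast+
  show ?thesis unfolding tproj_def T
  proof (rule the_equality)
    show "nproj (N q) v \<in> {v. N q \<bullet> v = 0} \<and> (\<forall>z\<in>{v. N q \<bullet> v = 0}. (v - nproj (N q) v) \<bullet> z = 0)"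
      using nproj_orthogonal[OF N] nproj_inner[of "N q" _ v] by (simp add: inner_diff_left)
  next
    fix w assume w: "w \<in> {v. N q \<bullet> v = 0} \<and> (\<forall>z\<in>{v. N q \<bullet> v = 0}. (v - w) \<bullet> z = 0)"
    let ?d = "nproj (N q) v - w"
    have d: "N q \<bullet> ?d = 0" using w nproj_orthogonal[OF N, of v] by (simp add: inner_diff_right)
    then have "(v - w) \<bullet> ?d = 0" using w by blast
    then have "?d \<bullet> ?d = 0" using nproj_inner[OF d, of v] by (simp add: inner_diff_left)
    then show "w = nproj (N q) v" by simp
  qed
qed

lemma smooth_on_nproj:
  assumes "open U" "smooth_on U N" "\<And>q. q \<in> U \<Longrightarrow> N q \<noteq> 0" "smooth_on U Y"
  shows "smooth_on U (\<lambda>q. nproj (N q) (Y q))"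
  unfolding nproj_def
  by (intro smooth_on_diff smooth_on_scaleR smooth_on_divide smooth_on_inner assms) (use assms(3) in simp)

text \<open>Names the neighbourhood of a local extension, so that several extensions can be
  restricted to a common one.\<close>

definition ext_on :: "'a::euclidean_space set \<Rightarrow> 'a set \<Rightarrow> ('a \<Rightarrow> 'b::real_normed_vector) \<Rightarrow> ('a \<Rightarrow> 'b) \<Rightarrow> bool" where
  "ext_on M U f F \<longleftrightarrow> open U \<and> smooth_on U F \<and> (\<forall>q\<in>M \<inter> U. F q = f q)"

lemma ext_onD: "ext_on M U f F \<Longrightarrow> open U" "ext_on M U f F \<Longrightarrow> smooth_on U F"
  "ext_on M U f F \<Longrightarrow> q \<in> M \<Longrightarrow> q \<in> U \<Longrightarrow> F q = f q"
  by (auto simp: ext_on_def)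

lemma ext_on_subset: "ext_on M U f F \<Longrightarrow> open V \<Longrightarrow> V \<subseteq> U \<Longrightarrow> ext_on M V f F"
  unfolding ext_on_def using smooth_on_subset by blast

lemma smooth_map_ext: "smooth_map M f \<longleftrightarrow> (\<forall>p\<in>M. \<exists>U F. p \<in> U \<and> ext_on M U f F)"
  unfolding smooth_map_def ext_on_def by blast

lemma deriv_along_ext:
  assumes "ext_on M U f F" "q \<in> M" "q \<in> U" "X q \<in> tangent_space M q"
  shows "deriv_along M X f q = fd F q (X q)"
proof (rule deriv_along_eq[OF _ assms(2) _ assms(3)])
  show "F differentiable at q" using smooth_on_differentiable ext_onD(2)[OF assms(1)] assms(3) by blast
  show "open U" using ext_onD(1)[OF assms(1)] .
  show "F m = f m" if "m \<in> M \<inter> U" for m using ext_onD(3)[OF assms(1)] that by blast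
qed (rule assms(4))

lemma deriv_along_field:
  assumes "ext_on M U f F" "q \<in> M" "q \<in> U" "tangent_field M X"
  shows "deriv_along M X f q = fd F q (X q)"
  by (rule deriv_along_ext[OF assms(1-3)]) (use assms(2,4) in \<open>simp add: tangent_field_def\<close>)

lemma ext_on_deriv_along:
  assumes "ext_on M U Y Y'" "ext_on M U X X'" "\<And>q. q \<in> M \<Longrightarrow> X q \<in> tangent_space M q"
  shows "ext_on M U (deriv_along M X Y) (\<lambda>q. fd Y' q (X' q))"
  unfolding ext_on_def
proof (intro conjI ballI)
  show "open U" using ext_onD(1)[OF assms(1)] .
  then show "smooth_on U (\<lambda>q. fd Y' q (X' q))"
    using ext_onD(2)[OF assms(1)] ext_onD(2)[OF assms(2)] by (rule smooth_on_fd_field)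
  show "fd Y' q (X' q) = deriv_along M X Y q" if "q \<in> M \<inter> U" for q
    using deriv_along_ext[OF assms(1), of q X] ext_onD(3)[OF assms(2), of q] assms(3)[of q] that by simp
qed

lemma ext_on_tproj:
  assumes "local_normal M U N" "ext_on M U Y Y'"
  shows "ext_on M U (\<lambda>q. tproj M q (Y q)) (\<lambda>q. nproj (N q) (Y' q))"
  unfolding ext_on_def
proof (intro conjI ballI)
  show "open U" using ext_onD(1)[OF assms(2)] .
  then show "smooth_on U (\<lambda>q. nproj (N q) (Y' q))"
    using local_normalD(2,3)[OF assms(1)] ext_onD(2)[OF assms(2)] by (intro smooth_on_nproj)
  show "nproj (N q) (Y' q) = tproj M q (Y q)" if "q \<in> M \<inter> U" for q
    using tproj_eq_nproj[OF assms(1), of q] ext_onD(3)[OF assms(2), of q] that by simp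
qed

lemma common_nbhd:
  assumes "embedded_hypersurface M" "p \<in> M" "smooth_map M X" "smooth_map M Y" "smooth_map M Z" "smooth_map M f"
  obtains U N X' Y' Z' f' where "p \<in> U" "local_normal M U N" "ext_on M U X X'" "ext_on M U Y Y'"
    "ext_on M U Z Z'" "ext_on M U f f'"
proof -
  obtain U0 N where 0: "p \<in> U0" "local_normal M U0 N" using local_normal_exists[OF assms(1,2)] by blast
  obtain U1 X' where 1: "p \<in> U1" "ext_on M U1 X X'" using assms(2,3) unfolding smooth_map_ext by blast
  obtain U2 Y' where 2: "p \<in> U2" "ext_on M U2 Y Y'" using assms(2,4) unfolding smooth_map_ext by blast
  obtain U3 Z' where 3: "p \<in> U3" "ext_on M U3 Z Z'" using assms(2,5) unfolding smooth_map_ext by blast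
  obtain U4 f' where 4: "p \<in> U4" "ext_on M U4 f f'" using assms(2,6) unfolding smooth_map_ext by blast
  define U where "U = U0 \<inter> U1 \<inter> U2 \<inter> U3 \<inter> U4"
  have op: "open U" unfolding U_def
    using local_normalD(1)[OF 0(2)] ext_onD(1)[OF 1(2)] ext_onD(1)[OF 2(2)] ext_onD(1)[OF 3(2)] ext_onD(1)[OF 4(2)]
    by (intro open_Int)
  have sub: "U \<subseteq> U0" "U \<subseteq> U1" "U \<subseteq> U2" "U \<subseteq> U3" "U \<subseteq> U4" by (auto simp: U_def)
  have "p \<in> U" using 0 1 2 3 4 by (simp add: U_def)
  then show ?thesis
    by (rule that[OF _ local_normal_subset[OF 0(2) op sub(1)] ext_on_subset[OF 1(2) op sub(2)]
      ext_on_subset[OF 2(2) op sub(3)] ext_on_subset[OF 3(2) op sub(4)] ext_on_subset[OF 4(2) op sub(5)]])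
qed

lemma common_nbhd2:
  assumes "embedded_hypersurface M" "p \<in> M" "smooth_map M X" "smooth_map M f"
  obtains U N X' f' where "p \<in> U" "local_normal M U N" "ext_on M U X X'" "ext_on M U f f'"
  by (rule common_nbhd[OF assms(1-3,3,3,4)]) (rule that)

lemma smooth_map_const: "smooth_map M (\<lambda>_. c)"
  unfolding smooth_map_def by (intro ballI exI[of _ UNIV] exI[of _ "\<lambda>_. c"]) (simp add: smooth_on_const)

lemma tangent_field_tproj:
  assumes "embedded_hypersurface M" "smooth_map M Y"
  shows "tangent_field M (\<lambda>q. tproj M q (Y q))"
  unfolding tangent_field_def smooth_map_ext
proof (intro conjI ballI)
  fix p assume p: "p \<in> M"
  obtain U N Y' Y2 where U: "p \<in> U" "local_normal M U N" "ext_on M U Y Y'" "ext_on M U Y Y2"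
    by (rule common_nbhd2[OF assms(1) p assms(2) assms(2)])
  then show "\<exists>U F. p \<in> U \<and> ext_on M U (\<lambda>q. tproj M q (Y q)) F" using ext_on_tproj by blast
  show "tproj M p (Y p) \<in> tangent_space M p"
    using tproj_eq_nproj[OF U(2) p U(1)] local_normalD(5)[OF U(2) p U(1)] nproj_orthogonal
      local_normalD(3)[OF U(2,1)] by simp
qed

lemma tproj_tangent:
  assumes "embedded_hypersurface M" "p \<in> M" "v \<in> tangent_space M p"
  shows "tproj M p v = v"
proof -
  obtain U N where U: "p \<in> U" "local_normal M U N" using local_normal_exists[OF assms(1,2)] by blast
  then show ?thesis
    using tproj_eq_nproj[OF U(2) assms(2) U(1)] local_normalD(5)[OF U(2) assms(2) U(1)] nproj_id assms(3) by simp
qed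

lemma tproj_inner:
  assumes "embedded_hypersurface M" "p \<in> M" "z \<in> tangent_space M p"
  shows "tproj M p v \<bullet> z = v \<bullet> z"
proof -
  obtain U N where U: "p \<in> U" "local_normal M U N" using local_normal_exists[OF assms(1,2)] by blast
  then show ?thesis
    using tproj_eq_nproj[OF U(2) assms(2) U(1)] local_normalD(5)[OF U(2) assms(2) U(1)] nproj_inner assms(3) by simp
qed

lemma tproj_linear:
  assumes "embedded_hypersurface M" "p \<in> M"
  shows "tproj M p (v + w) = tproj M p v + tproj M p w" "tproj M p (v - w) = tproj M p v - tproj M p w"
    "tproj M p (c *\<^sub>R v) = c *\<^sub>R tproj M p v"
proof -
  obtain U N where U: "p \<in> U" "local_normal M U N" using local_normal_exists[OF assms] by blast
  show "tproj M p (v + w) = tproj M p v + tproj M p w" "tproj M p (v - w) = tproj M p v - tproj M p w"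
    "tproj M p (c *\<^sub>R v) = c *\<^sub>R tproj M p v"
    unfolding tproj_eq_nproj[OF U(2) assms(2) U(1)] by (simp_all add: nproj_add nproj_diff nproj_scaleR)
qed

section \<open>The Levi-Civita connection as projected ambient derivative\<close>

definition proj_conn :: "'a::euclidean_space set \<Rightarrow> ('a \<Rightarrow> 'a) \<Rightarrow> ('a \<Rightarrow> 'a) \<Rightarrow> 'a \<Rightarrow> 'a" where
  "proj_conn M X Y = (\<lambda>p. tproj M p (deriv_along M X Y p))"

lemma tangent_fieldD: "tangent_field M X \<Longrightarrow> smooth_map M X" "tangent_field M X \<Longrightarrow> p \<in> M \<Longrightarrow> X p \<in> tangent_space M p"
  by (auto simp: tangent_field_def)

lemma smooth_map_deriv_along:
  assumes "tangent_field M X" "smooth_map M Y" "embedded_hypersurface M"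
  shows "smooth_map M (deriv_along M X Y)"
  unfolding smooth_map_ext
proof
  fix p assume p: "p \<in> M"
  obtain U N X' Y' where U: "p \<in> U" "local_normal M U N" "ext_on M U X X'" "ext_on M U Y Y'"
    by (rule common_nbhd2[OF assms(3) p tangent_fieldD(1)[OF assms(1)] assms(2)])
  show "\<exists>U F. p \<in> U \<and> ext_on M U (deriv_along M X Y) F"
    using ext_on_deriv_along[OF U(4,3) tangent_fieldD(2)[OF assms(1)]] U(1) by blast
qed

text \<open>Differentiate \<open>Y \<bullet> N = 0\<close> along \<open>M\<close>. This expresses
  the normal part of the ambient derivative of a tangent field through the derivative of
  \<open>N\<close>.\<close>

lemma differentiable_normal_inner_zero:
  assumes "local_normal M U N" "ext_on M U Y Y'" "tangent_field M Y" "p \<in> M" "p \<in> U" "v \<in> tangent_space M p"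
  shows "fd Y' p v \<bullet> N p = - (Y p \<bullet> fd N p v)"
proof -
  have d: "Y' differentiable at p" "N differentiable at p"
    using assms smooth_on_differentiable ext_onD(2) local_normalD(2) by blast+
  have "fd (\<lambda>q. Y' q \<bullet> N q) p v = fd (\<lambda>q. 0) p v"
  proof (rule tangent_deriv_eq[OF assms(6) _ _ assms(4) ext_onD(1)[OF assms(2)] assms(5)])
    show "(\<lambda>q. Y' q \<bullet> N q) differentiable at p" using d by (rule differentiable_inner)
    show "Y' q \<bullet> N q = 0" if "q \<in> M \<inter> U" for q
    proof -
      have q: "q \<in> M" "q \<in> U" using that by auto
      have "N q \<bullet> Y q = 0" using tangent_fieldD(2)[OF assms(3) q(1)] local_normalD(5)[OF assms(1) q] by simp
      then show ?thesis using ext_onD(3)[OF assms(2) q] by (simp add: inner_commute)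
    qed
  qed simp
  then show ?thesis
    using fd_inner[OF d, of v] ext_onD(3)[OF assms(2,4,5)] by (simp add: inner_commute)
qed

text \<open>The symmetry of \<open>fd N p\<close> makes the normal parts of the two ambient
  derivatives equal. Hence the bracket is tangent and the projection leaves it unchanged.\<close>

lemma conn_torsion_free:
  assumes "embedded_hypersurface M" "tangent_field M X" "tangent_field M Y" "p \<in> M"
  shows "proj_conn M X Y p - proj_conn M Y X p = lie_bracket M X Y p"
proof -
  obtain U N X' Y' where U: "p \<in> U" "local_normal M U N" "ext_on M U X X'" "ext_on M U Y Y'"
    by (rule common_nbhd2[OF assms(1,4) tangent_fieldD(1)[OF assms(2)] tangent_fieldD(1)[OF assms(3)]])
  note t = tangent_fieldD(2)[OF assms(2,4)] tangent_fieldD(2)[OF assms(3,4)]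
  have "lie_bracket M X Y p = fd Y' p (X p) - fd X' p (Y p)"
    unfolding lie_bracket_def using deriv_along_field[OF U(4) assms(4) U(1) assms(2)]
      deriv_along_field[OF U(3) assms(4) U(1) assms(3)] by simp
  moreover have "N p \<bullet> (fd Y' p (X p) - fd X' p (Y p)) = 0"
    using differentiable_normal_inner_zero[OF U(2,4) assms(3,4) U(1) t(1)]
      differentiable_normal_inner_zero[OF U(2,3) assms(2,4) U(1) t(2)] local_normalD(4)[OF U(2,1), of "X p" "Y p"]
    by (simp add: inner_diff_right inner_commute)
  ultimately have "lie_bracket M X Y p \<in> tangent_space M p" using local_normalD(5)[OF U(2) assms(4) U(1)] by simp
  then show ?thesis
    using tproj_tangent[OF assms(1,4), of "lie_bracket M X Y p"]
      tproj_linear(2)[OF assms(1,4), of "deriv_along M X Y p" "deriv_along M Y X p"]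
    by (simp add: proj_conn_def lie_bracket_def)
qed

lemma tangent_field_conn:
  assumes "embedded_hypersurface M" "tangent_field M X" "tangent_field M Y"
  shows "tangent_field M (proj_conn M X Y)"
  unfolding proj_conn_def
  by (intro tangent_field_tproj smooth_map_deriv_along assms tangent_fieldD(1)[OF assms(3)])

text \<open>Supplies the existence without which the choice in \<open>levi_civita\<close> would say
  nothing. Each axiom is the corresponding rule for the ambient derivative, followed by the
  linearity or self-adjointness of the projection.\<close>

lemma is_levi_civita_conn:
  assumes M: "embedded_hypersurface M"
  shows "is_levi_civita M (proj_conn M)"
  unfolding is_levi_civita_def
proof (intro conjI allI impI ballI)
  fix X Y assume "tangent_field M X" "tangent_field M Y"
  then show "tangent_field M (proj_conn M X Y)" by (rule tangent_field_conn[OF M])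
next
  fix X X' Y p assume f: "tangent_field M X" "tangent_field M X'" "tangent_field M Y" and p: "p \<in> M"
  obtain U Y' where U: "p \<in> U" "ext_on M U Y Y'"
    using tangent_fieldD(1)[OF f(3)] p unfolding smooth_map_ext by blast
  note t = tangent_fieldD(2)[OF f(1) p] tangent_fieldD(2)[OF f(2) p]
  have l: "linear (fd Y' p)" using ext_onD(2)[OF U(2)] U(1) smooth_on_differentiable linear_fd by blast
  have "X p + X' p \<in> tangent_space M p" using t subspace_tangent_space[OF M p] subspace_add by blast
  then have "deriv_along M (\<lambda>q. X q + X' q) Y p = deriv_along M X Y p + deriv_along M X' Y p"
    using deriv_along_field[OF U(2) p U(1) f(1)] deriv_along_field[OF U(2) p U(1) f(2)]
      deriv_along_ext[OF U(2) p U(1), of "\<lambda>q. X q + X' q"] l by (simp add: linear_add)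
  then show "proj_conn M (\<lambda>q. X q + X' q) Y p = proj_conn M X Y p + proj_conn M X' Y p"
    by (simp add: proj_conn_def tproj_linear[OF M p])
next
  fix f :: "'a \<Rightarrow> real" and X Y p
  assume f: "smooth_map M f" "tangent_field M X" "tangent_field M Y" and p: "p \<in> M"
  obtain U Y' where U: "p \<in> U" "ext_on M U Y Y'"
    using tangent_fieldD(1)[OF f(3)] p unfolding smooth_map_ext by blast
  note t = tangent_fieldD(2)[OF f(2) p]
  have l: "linear (fd Y' p)" using ext_onD(2)[OF U(2)] U(1) smooth_on_differentiable linear_fd by blast
  have "f p *\<^sub>R X p \<in> tangent_space M p" using t subspace_tangent_space[OF M p] subspace_mul by blast
  then have "deriv_along M (\<lambda>q. f q *\<^sub>R X q) Y p = f p *\<^sub>R deriv_along M X Y p"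
    using deriv_along_field[OF U(2) p U(1) f(2)]
      deriv_along_ext[OF U(2) p U(1), of "\<lambda>q. f q *\<^sub>R X q"] l by (simp add: linear_cmul)
  then show "proj_conn M (\<lambda>q. f q *\<^sub>R X q) Y p = f p *\<^sub>R proj_conn M X Y p"
    by (simp add: proj_conn_def tproj_linear[OF M p])
next
  fix X Y Y2 p assume f: "tangent_field M X" "tangent_field M Y" "tangent_field M Y2" and p: "p \<in> M"
  obtain U N Y' Y2' where U: "p \<in> U" "local_normal M U N" "ext_on M U Y Y'" "ext_on M U Y2 Y2'"
    by (rule common_nbhd2[OF M p tangent_fieldD(1)[OF f(2)] tangent_fieldD(1)[OF f(3)]])
  note U = U(1,3,4)
  note t = tangent_fieldD(2)[OF f(1) p]
  have d: "Y' differentiable at p" "Y2' differentiable at p"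
    using U ext_onD(2) smooth_on_differentiable by blast+
  have "ext_on M U (\<lambda>q. Y q + Y2 q) (\<lambda>q. Y' q + Y2' q)"
    using U(2,3) unfolding ext_on_def by (simp add: smooth_on_add)
  from deriv_along_field[OF this p U(1) f(1)]
  have "deriv_along M X (\<lambda>q. Y q + Y2 q) p = deriv_along M X Y p + deriv_along M X Y2 p"
    using deriv_along_field[OF U(2) p U(1) f(1)] deriv_along_field[OF U(3) p U(1) f(1)] fd_add[OF d] by simp
  then show "proj_conn M X (\<lambda>q. Y q + Y2 q) p = proj_conn M X Y p + proj_conn M X Y2 p"
    by (simp add: proj_conn_def tproj_linear[OF M p])
next
  fix f :: "'a \<Rightarrow> real" and X Y p
  assume f: "smooth_map M f" "tangent_field M X" "tangent_field M Y" and p: "p \<in> M"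
  obtain U N Y' f' where U: "p \<in> U" "local_normal M U N" "ext_on M U Y Y'" "ext_on M U f f'"
    by (rule common_nbhd2[OF M p tangent_fieldD(1)[OF f(3)] f(1)])
  note t = tangent_fieldD(2)[OF f(2) p]
  have d: "f' differentiable at p" "Y' differentiable at p"
    using U ext_onD(2) smooth_on_differentiable by blast+
  have "ext_on M U (\<lambda>q. f q *\<^sub>R Y q) (\<lambda>q. f' q *\<^sub>R Y' q)"
    using U(3,4) unfolding ext_on_def by (simp add: smooth_on_scaleR)
  from deriv_along_field[OF this p U(1) f(2)]
  have "deriv_along M X (\<lambda>q. f q *\<^sub>R Y q) p = f p *\<^sub>R deriv_along M X Y p + deriv_along M X f p *\<^sub>R Y p"
    using deriv_along_field[OF U(3) p U(1) f(2)] deriv_along_field[OF U(4) p U(1) f(2)] fd_scaleR[OF d]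
      ext_onD(3)[OF U(3) p U(1)] ext_onD(3)[OF U(4) p U(1)] by simp
  then show "proj_conn M X (\<lambda>q. f q *\<^sub>R Y q) p = deriv_along M X f p *\<^sub>R Y p + f p *\<^sub>R proj_conn M X Y p"
    by (simp add: proj_conn_def tproj_linear[OF M p] tproj_tangent[OF M p tangent_fieldD(2)[OF f(3) p]])
next
  fix X Y p assume "tangent_field M X" "tangent_field M Y" "p \<in> M"
  then show "proj_conn M X Y p - proj_conn M Y X p = lie_bracket M X Y p" by (rule conn_torsion_free[OF M])
next
  fix X Y Z p assume f: "tangent_field M X" "tangent_field M Y" "tangent_field M Z" and p: "p \<in> M"
  obtain U N Y' Z' where U: "p \<in> U" "local_normal M U N" "ext_on M U Y Y'" "ext_on M U Z Z'"
    by (rule common_nbhd2[OF M p tangent_fieldD(1)[OF f(2)] tangent_fieldD(1)[OF f(3)]])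
  note U = U(1,3,4)
  note t = tangent_fieldD(2)[OF f(1) p] tangent_fieldD(2)[OF f(2) p] tangent_fieldD(2)[OF f(3) p]
  have d: "Y' differentiable at p" "Z' differentiable at p"
    using U ext_onD(2) smooth_on_differentiable by blast+
  have "ext_on M U (\<lambda>q. Y q \<bullet> Z q) (\<lambda>q. Y' q \<bullet> Z' q)"
    using U(2,3) unfolding ext_on_def by (simp add: smooth_on_inner)
  from deriv_along_field[OF this p U(1) f(1)]
  have "deriv_along M X (\<lambda>q. Y q \<bullet> Z q) p = deriv_along M X Y p \<bullet> Z p + Y p \<bullet> deriv_along M X Z p"
    using deriv_along_field[OF U(2) p U(1) f(1)] deriv_along_field[OF U(3) p U(1) f(1)] fd_inner[OF d]
      ext_onD(3)[OF U(2) p U(1)] ext_onD(3)[OF U(3) p U(1)] by simp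
  then show "deriv_along M X (\<lambda>q. Y q \<bullet> Z q) p = proj_conn M X Y p \<bullet> Z p + Y p \<bullet> proj_conn M X Z p"
    using tproj_inner[OF M p t(3), of "deriv_along M X Y p"] tproj_inner[OF M p t(2), of "deriv_along M X Z p"]
    by (simp add: proj_conn_def inner_commute)
qed

lemma tangent_field_extension:
  assumes "embedded_hypersurface M" "p \<in> M" "v \<in> tangent_space M p"
  shows "\<exists>X. tangent_field M X \<and> X p = v"
  using tangent_field_tproj[OF assms(1) smooth_map_const, of v] tproj_tangent[OF assms]
  by (intro exI[of _ "\<lambda>q. tproj M q v"]) simp

lemma is_levi_civitaD:
  assumes "is_levi_civita M D" "tangent_field M X" "tangent_field M Y"
  shows "tangent_field M (D X Y)"
    "p \<in> M \<Longrightarrow> D X Y p - D Y X p = lie_bracket M X Y p"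
    "tangent_field M Z \<Longrightarrow> p \<in> M \<Longrightarrow> deriv_along M X (\<lambda>q. Y q \<bullet> Z q) p = D X Y p \<bullet> Z p + Y p \<bullet> D X Z p"
proof -
  note * = assms(1)[unfolded is_levi_civita_def]
  show "tangent_field M (D X Y)" using conjunct1[OF *] assms(2,3) by simp
  note ** = *[THEN conjunct2, THEN conjunct2, THEN conjunct2, THEN conjunct2, THEN conjunct2]
  show "p \<in> M \<Longrightarrow> D X Y p - D Y X p = lie_bracket M X Y p"
    using conjunct1[OF **] assms(2,3) by simp
  show "tangent_field M Z \<Longrightarrow> p \<in> M \<Longrightarrow> deriv_along M X (\<lambda>q. Y q \<bullet> Z q) p = D X Y p \<bullet> Z p + Y p \<bullet> D X Z p"
    using conjunct2[OF **] assms(2,3) by simp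
qed

text \<open>The difference \<open>S\<close> of two such connections is symmetric in its two fields,
  as both are torsion-free, and skew in the last two slots of \<open>S X Y \<bullet> Z p\<close>, as
  both are metric. An expression with both symmetries vanishes.\<close>

lemma levi_civita_unique:
  assumes M: "embedded_hypersurface M" and D: "is_levi_civita M D"
    and X: "tangent_field M X" and Y: "tangent_field M Y" and p: "p \<in> M"
  shows "D X Y p = proj_conn M X Y p"
proof -
  note C = is_levi_civita_conn[OF M]
  define S where "S X Y = D X Y p - proj_conn M X Y p" for X Y
  have sym: "S X Y = S Y X" if "tangent_field M X" "tangent_field M Y" for X Y
    using is_levi_civitaD(2)[OF D that p] is_levi_civitaD(2)[OF C that p]
    by (simp add: S_def algebra_simps)
  have skew: "S X Y \<bullet> Z p = - (S X Z \<bullet> Y p)"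
    if "tangent_field M X" "tangent_field M Y" "tangent_field M Z" for X Y Z
    using is_levi_civitaD(3)[OF D that(1,2,3) p] is_levi_civitaD(3)[OF C that(1,2,3) p]
    by (simp add: S_def inner_diff_left inner_diff_right inner_commute)
  have zero: "S X Y \<bullet> Z p = 0" if Z: "tangent_field M Z" for Z
    using skew[OF Y X Z] skew[OF Z X Y] skew[OF X Y Z]
    unfolding sym[OF Y X] sym[OF Z X] sym[OF Z Y] by linarith
  have "S X Y \<in> tangent_space M p"
    unfolding S_def
    by (rule subspace_diff[OF subspace_tangent_space[OF M p] tangent_fieldD(2)[OF is_levi_civitaD(1)[OF D X Y] p]
        tangent_fieldD(2)[OF is_levi_civitaD(1)[OF C X Y] p]])
  \<comment> \<open>\<open>zero\<close> tests against fields only, so the tangent vector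
    \<open>S X Y\<close> is extended to one and tested against itself.\<close>
  then obtain Z where "tangent_field M Z" "Z p = S X Y" using tangent_field_extension[OF M p] by blast
  then have "S X Y \<bullet> S X Y = 0" using zero[of Z] by simp
  then show ?thesis by (simp add: S_def)
qed

lemma levi_civita: "embedded_hypersurface M \<Longrightarrow> is_levi_civita M (levi_civita M)"
  unfolding levi_civita_def by (rule someI[where P = "is_levi_civita M", OF is_levi_civita_conn])

lemma tangent_field_cong:
  assumes "tangent_field M X" "\<And>q. q \<in> M \<Longrightarrow> X q = Y q"
  shows "tangent_field M Y"
proof -
  have "ext_on M U X F \<longleftrightarrow> ext_on M U Y F" for U F unfolding ext_on_def using assms(2) by auto
  then show ?thesis using assms unfolding tangent_field_def smooth_map_ext by simp
qed

lemma tangent_field_diff: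
  assumes "embedded_hypersurface M" "tangent_field M X" "tangent_field M Y"
  shows "tangent_field M (\<lambda>q. X q - Y q)"
  unfolding tangent_field_def smooth_map_ext
proof (intro conjI ballI)
  fix p assume p: "p \<in> M"
  obtain U N X' Y' where U: "p \<in> U" "local_normal M U N" "ext_on M U X X'" "ext_on M U Y Y'"
    by (rule common_nbhd2[OF assms(1) p tangent_fieldD(1)[OF assms(2)] tangent_fieldD(1)[OF assms(3)]])
  note U = U(1,3,4)
  have "ext_on M U (\<lambda>q. X q - Y q) (\<lambda>q. X' q - Y' q)"
    using U(2,3) unfolding ext_on_def by (simp add: smooth_on_diff)
  then show "\<exists>U F. p \<in> U \<and> ext_on M U (\<lambda>q. X q - Y q) F" using U(1) by blast
  show "X p - Y p \<in> tangent_space M p"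
    by (rule subspace_diff[OF subspace_tangent_space[OF assms(1) p] tangent_fieldD(2)[OF assms(2) p]
        tangent_fieldD(2)[OF assms(3) p]])
qed

lemma tangent_field_lie_bracket:
  assumes "embedded_hypersurface M" "tangent_field M X" "tangent_field M Y"
  shows "tangent_field M (lie_bracket M X Y)"
proof (rule tangent_field_cong)
  show "tangent_field M (\<lambda>q. proj_conn M X Y q - proj_conn M Y X q)"
    by (intro tangent_field_diff tangent_field_conn assms)
qed (rule conn_torsion_free[OF assms])

section \<open>Curvature in terms of the normal field\<close>

text \<open>The first covariant derivative extends to \<open>A - B N\<close>, with \<open>B\<close>
  the normal coefficient of the ambient derivative \<open>A\<close>. In the next derivative, paired
  with a tangent \<open>W\<close>, the term containing the derivative of \<open>B\<close> disappears
  and \<open>B\<close> itself is given by the derivative of \<open>N\<close>.\<close>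

lemma second_covariant_derivative:
  assumes M: "embedded_hypersurface M" and n: "local_normal M U N" and p: "p \<in> M" "p \<in> U"
    and X: "tangent_field M X" and Y: "tangent_field M Y" "ext_on M U Y Y'" and Z: "tangent_field M Z" "ext_on M U Z Z'"
    and W: "W \<in> tangent_space M p"
  shows "levi_civita M X (levi_civita M Y Z) p \<bullet> W = fd (\<lambda>q. fd Z' q (Y' q)) p (X p) \<bullet> W
    + (fd N p (Y p) \<bullet> Z p) * (fd N p (X p) \<bullet> W) / (N p \<bullet> N p)"
proof -
  let ?D = "levi_civita M"
  note LC = levi_civita[OF M]
  define A where "A q = fd Z' q (Y' q)" for q
  define B where "B q = (A q \<bullet> N q) / (N q \<bullet> N q)" for q
  have xA: "ext_on M U (deriv_along M Y Z) A"
    unfolding A_def[abs_def] by (rule ext_on_deriv_along[OF Z(2) Y(2) tangent_fieldD(2)[OF Y(1)]])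
  have "ext_on M U (\<lambda>q. tproj M q (deriv_along M Y Z q)) (\<lambda>q. nproj (N q) (A q))"
    by (rule ext_on_tproj[OF n xA])
  then have x: "ext_on M U (?D Y Z) (\<lambda>q. A q - B q *\<^sub>R N q)"
    using levi_civita_unique[OF M LC Y(1) Z(1)] unfolding ext_on_def nproj_def B_def proj_conn_def by auto
  have op: "open U" and sN: "smooth_on U N" using local_normalD[OF n] by blast+
  have sA: "smooth_on U A" using ext_onD(2)[OF xA] .
  have "smooth_on U B" unfolding B_def
    by (intro smooth_on_divide smooth_on_inner op sA sN) (use local_normalD(3)[OF n] in simp)
  then have d: "A differentiable at p" "B differentiable at p" "N differentiable at p"
    using sA sN p(2) smooth_on_differentiable by blast+
  have dBN: "(\<lambda>q. B q *\<^sub>R N q) differentiable at p" using d(2,3) by (rule differentiable_scaleR)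
  have NW: "N p \<bullet> W = 0" using local_normalD(5)[OF n p] W by simp
  have "?D X (?D Y Z) p \<bullet> W = deriv_along M X (?D Y Z) p \<bullet> W"
    using levi_civita_unique[OF M LC X is_levi_civitaD(1)[OF LC Y(1) Z(1)] p(1)] tproj_inner[OF M p(1) W]
    by (simp add: proj_conn_def)
  also have "\<dots> = (fd A p (X p) - (B p *\<^sub>R fd N p (X p) + fd B p (X p) *\<^sub>R N p)) \<bullet> W"
    using deriv_along_field[OF x p X] fd_diff[OF d(1) dBN] fd_scaleR[OF d(2,3)] by simp
  also have "\<dots> = fd A p (X p) \<bullet> W - B p * (fd N p (X p) \<bullet> W)"
    using NW by (simp add: inner_diff_left inner_add_left)
  also have "A p \<bullet> N p = - (fd N p (Y p) \<bullet> Z p)"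
    using differentiable_normal_inner_zero[OF n Z(2,1) p tangent_fieldD(2)[OF Y(1) p(1)]] ext_onD(3)[OF Y(2) p]
    by (simp add: A_def inner_commute)
  then have "B p = - (fd N p (Y p) \<bullet> Z p) / (N p \<bullet> N p)" by (simp add: B_def)
  finally show ?thesis by (simp add: A_def[abs_def])
qed

text \<open>The ambient second derivatives cancel against the bracket term by
  \<open>bracket_commutator\<close>. Only the two corrections from the normal parts remain.\<close>

lemma gauss_fields:
  assumes M: "embedded_hypersurface M" and n: "local_normal M U N" and p: "p \<in> M" "p \<in> U"
    and X: "tangent_field M X" and Y: "tangent_field M Y" and Z: "tangent_field M Z" and W: "W \<in> tangent_space M p"
  shows "curvature_field M X Y Z p \<bullet> W =
    ((fd N p (Y p) \<bullet> Z p) * (fd N p (X p) \<bullet> W) - (fd N p (X p) \<bullet> Z p) * (fd N p (Y p) \<bullet> W)) / (N p \<bullet> N p)"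
proof -
  obtain U' N' X' Y' Z' Z2 where U': "p \<in> U'" "local_normal M U' N'" "ext_on M U' X X'" "ext_on M U' Y Y'"
    "ext_on M U' Z Z'" "ext_on M U' Z Z2"
    by (rule common_nbhd[OF M p(1) tangent_fieldD(1)[OF X] tangent_fieldD(1)[OF Y] tangent_fieldD(1)[OF Z]
        tangent_fieldD(1)[OF Z]])
  note U' = U'(1,3,4,5)
  define V where "V = U \<inter> U'"
  have V: "open V" "V \<subseteq> U" "V \<subseteq> U'" "p \<in> V"
    using local_normalD(1)[OF n] ext_onD(1)[OF U'(2)] p U'(1) by (auto simp: V_def)
  note n' = local_normal_subset[OF n V(1,2)]
  note e = ext_on_subset[OF U'(2) V(1,3)] ext_on_subset[OF U'(3) V(1,3)] ext_on_subset[OF U'(4) V(1,3)]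
  note LC = levi_civita[OF M]
  note t = tangent_fieldD(2)[OF X p(1)] tangent_fieldD(2)[OF Y p(1)]
  have br: "lie_bracket M X Y p = fd Y' p (X p) - fd X' p (Y p)"
    unfolding lie_bracket_def using deriv_along_field[OF e(2) p(1) V(4) X]
      deriv_along_field[OF e(1) p(1) V(4) Y] by simp
  note bf = tangent_field_lie_bracket[OF M X Y]
  have "levi_civita M (lie_bracket M X Y) Z p \<bullet> W = deriv_along M (lie_bracket M X Y) Z p \<bullet> W"
    using levi_civita_unique[OF M LC bf Z p(1)] tproj_inner[OF M p(1) W] by (simp add: proj_conn_def)
  also have "\<dots> = fd Z' p (fd Y' p (X p) - fd X' p (Y p)) \<bullet> W"
    using deriv_along_field[OF e(3) p(1) V(4) bf] br by simp
  also have "\<dots> = (fd (\<lambda>q. fd Z' q (Y' q)) p (X p) - fd (\<lambda>q. fd Z' q (X' q)) p (Y p)) \<bullet> W"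
    using bracket_commutator[OF V(1,4) ext_onD(2)[OF e(3)] ext_onD(2)[OF e(1)] ext_onD(2)[OF e(2)]]
      ext_onD(3)[OF e(1) p(1) V(4)] ext_onD(3)[OF e(2) p(1) V(4)] by simp
  finally have 3: "levi_civita M (lie_bracket M X Y) Z p \<bullet> W =
     fd (\<lambda>q. fd Z' q (Y' q)) p (X p) \<bullet> W - fd (\<lambda>q. fd Z' q (X' q)) p (Y p) \<bullet> W"
    by (simp add: inner_diff_left)
  show ?thesis
    unfolding curvature_field_def Let_def
    using second_covariant_derivative[OF M n' p(1) V(4) X Y e(2) Z e(3) W]
      second_covariant_derivative[OF M n' p(1) V(4) Y X e(1) Z e(3) W] 3
    by (simp add: inner_diff_left diff_divide_distrib)
qed

text \<open>The right-hand side of \<open>gauss_fields\<close> depends on the fields only through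
  their values at \<open>p\<close>, so the choice made by \<open>field_ext\<close> is
  harmless.\<close>

lemma gauss_equation:
  assumes M: "embedded_hypersurface M" and n: "local_normal M U N" and p: "p \<in> M" "p \<in> U"
    and "x \<in> tangent_space M p" "y \<in> tangent_space M p" "z \<in> tangent_space M p" "w \<in> tangent_space M p"
  shows "curvature M p x y z \<bullet> w =
    ((fd N p y \<bullet> z) * (fd N p x \<bullet> w) - (fd N p x \<bullet> z) * (fd N p y \<bullet> w)) / (N p \<bullet> N p)"
proof -
  have f: "tangent_field M (field_ext M p v)" "field_ext M p v p = v" if "v \<in> tangent_space M p" for v
    using someI_ex[OF tangent_field_extension[OF M p(1) that]] by (simp_all add: field_ext_def)
  show ?thesis unfolding curvature_def
    using gauss_fields[OF M n p f(1) f(1) f(1) assms(8), OF assms(5-7)] f(2)[OF assms(5)] f(2)[OF assms(6)] f(2)[OF assms(7)]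
    by simp
qed

section \<open>The Thorpe condition in a principal basis\<close>

text \<open>The Gauss equation speaks of tangent vectors only, so alternation has to be transferred
  along an equality on \<open>lists T\<close>.\<close>

lemma alt_on_cong:
  assumes "subspace T" "\<And>xs. xs \<in> lists T \<Longrightarrow> \<alpha> xs = \<beta> xs" "alt_on T \<beta>"
  shows "alt_on T \<alpha>"
proof (rule alt_onI)
  fix ps qs x y and a b :: real
  assume *: "ps \<in> lists T" "qs \<in> lists T" "x \<in> T" "y \<in> T"
  have "a *\<^sub>R x + b *\<^sub>R y \<in> T" using * assms(1) by (simp add: subspace_add subspace_mul)
  then have "ps @ (a *\<^sub>R x + b *\<^sub>R y) # qs \<in> lists T" "ps @ x # qs \<in> lists T" "ps @ y # qs \<in> lists T"
    using * by simp_all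
  then show "\<alpha> (ps @ (a *\<^sub>R x + b *\<^sub>R y) # qs) = a * \<alpha> (ps @ x # qs) + b * \<alpha> (ps @ y # qs)"
    using alt_on_lin[OF assms(3) *, of a b] assms(2) by simp
next
  fix ps qs x assume *: "ps \<in> lists T" "qs \<in> lists T" "x \<in> T"
  then have "ps @ x # x # qs \<in> lists T" by simp
  then show "\<alpha> (ps @ x # x # qs) = 0" using alt_on_adj[OF assms(3) *] assms(2) by simp
qed

lemma double_alt_cong:
  assumes "subspace T" "\<And>xs ys. xs \<in> lists T \<Longrightarrow> ys \<in> lists T \<Longrightarrow> \<omega> xs ys = \<eta> xs ys" "double_alt T \<eta>"
  shows "double_alt T \<omega>"
  unfolding double_alt_def
proof (intro conjI ballI)
  fix zs assume zs: "zs \<in> lists T"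
  show "alt_on T (\<lambda>xs. \<omega> xs zs)"
    by (rule alt_on_cong[OF assms(1), of _ "\<lambda>xs. \<eta> xs zs"]) (use assms(2,3) zs in \<open>simp_all add: double_alt_def\<close>)
  show "alt_on T (\<omega> zs)"
    by (rule alt_on_cong[OF assms(1), of _ "\<eta> zs"]) (use assms(2,3) zs in \<open>simp_all add: double_alt_def\<close>)
qed

text \<open>Half of the square of the \<open>(1,1)\<close> form \<open>h\<close> in the algebra of
  double forms.\<close>

definition half_square :: "('a \<Rightarrow> 'a \<Rightarrow> real) \<Rightarrow> 'a double_form" where
  "half_square h xs ys = (case (xs, ys) of ([x, y], [z, w]) \<Rightarrow> h x z * h y w - h x w * h y z | _ \<Rightarrow> 0)"

lemma half_square_zero: "length xs \<noteq> 2 \<or> length ys \<noteq> 2 \<Longrightarrow> half_square h xs ys = 0"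
  by (auto simp: half_square_def split: list.splits)

lemma length_2_middle: "length (ps @ z # qs) = 2 \<Longrightarrow> (\<exists>y. ps = [] \<and> qs = [y]) \<or> (\<exists>x. ps = [x] \<and> qs = [])"
  by (cases ps; cases qs) (auto simp: length_Suc_conv)

lemma alt_on_half_square:
  fixes h :: "'a::real_vector \<Rightarrow> 'a \<Rightarrow> real"
  assumes h: "bilinear h"
  shows "alt_on T (\<lambda>xs. half_square h xs ys)"
proof (cases "length ys = 2")
  case True
  then obtain z w where ys: "ys = [z, w]" by (auto simp: numeral_2_eq_2 length_Suc_conv)
  note bil = bilinear_ladd[OF h] bilinear_lmul[OF h]
  show ?thesis
  proof (rule alt_onI)
    fix ps qs :: "'a list" and x y :: 'a and a b :: real
    consider y' where "ps = []" "qs = [y']" | x' where "ps = [x']" "qs = []" | "length (ps @ x # qs) \<noteq> 2"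
      using length_2_middle[of ps x qs] by blast
    then show "half_square h (ps @ (a *\<^sub>R x + b *\<^sub>R y) # qs) ys =
      a * half_square h (ps @ x # qs) ys + b * half_square h (ps @ y # qs) ys"
    proof cases
      case 3
      then show ?thesis by (simp add: half_square_zero)
    qed (simp_all add: ys half_square_def bil algebra_simps)
  next
    fix ps qs :: "'a list" and x :: 'a
    show "half_square h (ps @ x # x # qs) ys = 0"
    proof (cases "ps = [] \<and> qs = []")
      case True
      then show ?thesis by (simp add: ys half_square_def)
    next
      case False
      then have "length (ps @ x # x # qs) \<noteq> 2" by simp
      then show ?thesis by (intro half_square_zero) simp
    qed
  qed
next
  case False
  then show ?thesis by (intro alt_onI) (simp_all add: half_square_zero)
qed

lemma double_alt_half_square:
  fixes h :: "'a::real_vector \<Rightarrow> 'a \<Rightarrow> real"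
  assumes "bilinear h" "\<And>x y. h x y = h y x"
  shows "double_alt T (half_square h)"
proof -
  have sym: "half_square h xs ys = half_square h ys xs" for xs ys
  proof (cases "length xs = 2 \<and> length ys = 2")
    case True
    then obtain x y z w where "xs = [x, y]" "ys = [z, w]" by (auto simp: numeral_2_eq_2 length_Suc_conv)
    then show ?thesis using assms(2)[of x z] assms(2)[of x w] assms(2)[of y z] assms(2)[of y w]
      by (simp add: half_square_def)
  next
    case False
    then show ?thesis using half_square_zero[of xs ys h] half_square_zero[of ys xs h] by auto
  qed
  have "alt_on T (half_square h xs)" for xs
  proof -
    have "(\<lambda>ys. half_square h ys xs) = half_square h xs" by (rule ext) (rule sym)
    then show ?thesis using alt_on_half_square[OF assms(1), of T xs] by metis
  qed
  then show ?thesis using alt_on_half_square[OF assms(1)] by (simp add: double_alt_def)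
qed

lemma card_2_ordered:
  fixes I :: "nat set"
  assumes "card I = 2"
  obtains a b where "I = {a, b}" "a < b"
proof -
  obtain a b where "I = {a, b}" "a \<noteq> b" using assms by (auto simp: card_2_iff)
  then show ?thesis using that[of a b] that[of b a] by (cases "a < b") auto
qed

lemma diag_form_half_square:
  assumes "\<And>i j. i < length f \<Longrightarrow> j < length f \<Longrightarrow> i \<noteq> j \<Longrightarrow> h (f ! i) (f ! j) = 0"
  shows "diag_form f (half_square h) (\<lambda>I. if card I = 2 then \<Prod>i\<in>I. h (f ! i) (f ! i) else 0)"
  unfolding diag_form_def
proof (intro allI impI)
  fix I J assume IJ: "I \<subseteq> {..<length f}" "J \<subseteq> {..<length f}"
  show "half_square h (nths f I) (nths f J) = (if I = J then if card I = 2 then \<Prod>i\<in>I. h (f ! i) (f ! i) else 0 else 0)"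
  proof (cases "card I = 2 \<and> card J = 2")
    case True
    obtain a b where ab: "I = {a, b}" "a < b" using True card_2_ordered by blast
    obtain c d where cd: "J = {c, d}" "c < d" using True card_2_ordered by blast
    have l: "a < length f" "b < length f" "c < length f" "d < length f" using IJ ab cd by auto
    have "half_square h (nths f I) (nths f J) = h (f!a) (f!c) * h (f!b) (f!d) - h (f!a) (f!d) * h (f!b) (f!c)"
      using l ab cd by (simp add: nths_insert_less half_square_def)
    \<comment> \<open>A nonzero product would require \<open>a = d\<close> and \<open>b = c\<close>,
      contrary to \<open>a < b\<close> and \<open>c < d\<close>.\<close>
    also have "h (f!a) (f!d) * h (f!b) (f!c) = 0"
      using assms l ab(2) cd(2) by (cases "a = d"; cases "b = c") auto
    also have "h (f!a) (f!c) * h (f!b) (f!d) = (if a = c \<and> b = d then h (f!a) (f!a) * h (f!b) (f!b) else 0)"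
      using assms l by auto
    also have "a = c \<and> b = d \<longleftrightarrow> I = J" using ab cd by (auto simp: doubleton_eq_iff)
    finally show ?thesis using True ab by (cases "I = J") auto
  next
    case False
    then show ?thesis using IJ half_square_zero[of "nths f I" "nths f J" h] by (auto simp: length_nths_subset)
  qed
qed

lemma diag_form_eq:
  assumes "diag_form f \<eta> c" "f \<in> lists T" "\<And>xs ys. xs \<in> lists T \<Longrightarrow> ys \<in> lists T \<Longrightarrow> \<omega> xs ys = \<eta> xs ys"
  shows "diag_form f \<omega> c"
  using assms(1) assms(3)[OF in_lists_nths[OF assms(2)] in_lists_nths[OF assms(2)]]
  by (simp add: diag_form_def)

lemma bilinear_fd_inner:
  assumes "f differentiable at p"
  shows "bilinear (\<lambda>x y. fd f p x \<bullet> y)"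
proof -
  have l: "linear (fd f p)" using assms by (rule linear_fd)
  show ?thesis unfolding bilinear_def
    by (intro conjI allI linearI)
      (simp_all add: inner_add_right inner_add_left linear_add[OF l] linear_cmul[OF l])
qed

lemma bilinear_scale:
  fixes c :: real
  assumes h: "bilinear h"
  shows "bilinear (\<lambda>x y. h x y / c)"
  unfolding bilinear_def
  by (intro conjI allI linearI)
    (simp_all add: bilinear_ladd[OF h] bilinear_radd[OF h] bilinear_lmul[OF h] bilinear_rmul[OF h] add_divide_distrib)

text \<open>Dividing by \<open>norm (N p)\<close> normalises the second fundamental form, which is
  thereby determined up to sign; the square forgets the sign. The denominator
  \<open>N p \<bullet> N p\<close> of the Gauss equation is split between the two factors.\<close>

lemma curvature_form_half_square:
  assumes M: "embedded_hypersurface M" and n: "local_normal M U N" and p: "p \<in> M" "p \<in> U"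
    and "xs \<in> lists (tangent_space M p)" "ys \<in> lists (tangent_space M p)"
  shows "curvature_form M p xs ys = half_square (\<lambda>x y. fd N p x \<bullet> y / norm (N p)) xs ys"
proof (cases "length xs = 2 \<and> length ys = 2")
  case True
  then obtain x y z w where xy: "xs = [x, y]" "ys = [z, w]" by (auto simp: numeral_2_eq_2 length_Suc_conv)
  then have t: "x \<in> tangent_space M p" "y \<in> tangent_space M p" "w \<in> tangent_space M p" "z \<in> tangent_space M p"
    using assms(5,6) by auto
  have "curvature M p x y w \<bullet> z =
     ((fd N p y \<bullet> w) * (fd N p x \<bullet> z) - (fd N p x \<bullet> w) * (fd N p y \<bullet> z)) / (norm (N p) * norm (N p))"
    using gauss_equation[OF M n p t] by (simp add: power2_norm_eq_inner flip: power2_eq_square)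
  then show ?thesis unfolding xy curvature_form_def half_square_def
    by (simp add: diff_divide_distrib mult.commute)
next
  case False
  then show ?thesis using half_square_zero[of xs ys]
    by (auto simp: curvature_form_def split: list.splits)
qed

text \<open>Evaluating the double star needs both conclusions: alternation, to pass to the unknown
  basis inside the star, and the diagonal entries.\<close>

lemma thorpe_form_diag:
  assumes M: "embedded_hypersurface M" and n: "local_normal M U N" and p: "p \<in> M" "p \<in> U"
    and f: "orthonormal_basis (tangent_space M p) f"
      "\<And>i j. i < length f \<Longrightarrow> j < length f \<Longrightarrow> i \<noteq> j \<Longrightarrow> fd N p (f ! i) \<bullet> (f ! j) = 0"
    and r: "2 * k \<le> r"
  defines "\<mu> \<equiv> \<lambda>i. fd N p (f ! i) \<bullet> (f ! i) / norm (N p)"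
  shows "double_alt (tangent_space M p) (thorpe_form r k M p)"
    and "\<exists>a>0. diag_form f (thorpe_form r k M p) (\<lambda>I. if card I = r then a * esym (2 * k) \<mu> I else 0)"
proof -
  let ?T = "tangent_space M p"
  let ?h = "\<lambda>x y. fd N p x \<bullet> y / norm (N p)"
  have sub: "subspace ?T" by (rule subspace_tangent_space[OF M p(1)])
  have d: "N differentiable at p" using local_normalD(2)[OF n] p(2) smooth_on_differentiable by blast
  have bil: "bilinear ?h" by (intro bilinear_scale bilinear_fd_inner d)
  have sym: "?h x y = ?h y x" for x y using local_normalD(4)[OF n p(2)] by simp
  have fT: "f \<in> lists ?T" using f(1) by (auto simp: orthonormal_basis_def intro: span_base)
  have orthonormal_list: "orthonormal_list f" using f(1) by (simp add: orthonormal_basis_iff)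
  note eq = curvature_form_half_square[OF M n p]
  have "double_alt ?T (curvature_form M p)"
    by (rule double_alt_cong[OF sub eq double_alt_half_square[OF bil sym]])
  then show "double_alt ?T (thorpe_form r k M p)"
    unfolding thorpe_form_def by (intro double_alt_dmult double_alt_dpower double_alt_metric)
  have "diag_form f (half_square ?h) (\<lambda>I. if card I = 2 then \<Prod>i\<in>I. ?h (f ! i) (f ! i) else 0)"
    by (rule diag_form_half_square) (simp add: f(2))
  then have "diag_form f (curvature_form M p) (\<lambda>I. if card I = 2 then \<Prod>i\<in>I. \<mu> i else 0)"
    unfolding \<mu>_def by (rule diag_form_eq[OF _ fT eq])
  from diag_form_thorpe[OF orthonormal_list this, of "r - 2 * k" k]
  show "\<exists>a>0. diag_form f (thorpe_form r k M p) (\<lambda>I. if card I = r then a * esym (2 * k) \<mu> I else 0)"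
    using r by (simp add: thorpe_form_def)
qed

lemma principal_basis:
  assumes M: "embedded_hypersurface M" and n: "local_normal M U N" and p: "p \<in> M" "p \<in> U"
  obtains f where "orthonormal_basis (tangent_space M p) f" "length f = DIM('a::euclidean_space) - 1"
    "\<And>i j. i < length f \<Longrightarrow> j < length f \<Longrightarrow> i \<noteq> j \<Longrightarrow> fd N p (f ! i) \<bullet> (f ! j :: 'a) = 0"
proof -
  have d: "N differentiable at p" using local_normalD(2)[OF n] p(2) smooth_on_differentiable by blast
  obtain f where f: "orthonormal_basis (tangent_space M p) f"
    "\<forall>x\<in>set f. \<forall>y\<in>set f. x \<noteq> y \<longrightarrow> fd N p x \<bullet> y = 0"
    using spectral_bilinear[OF bilinear_fd_inner[OF d] local_normalD(4)[OF n p(2)] subspace_tangent_space[OF M p(1)]]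
    by blast
  have "length f = dim (tangent_space M p)" using f(1) by (rule length_orthonormal_basis)
  also have "\<dots> = DIM('a) - 1"
    using local_normalD(5)[OF n p] local_normalD(3)[OF n p(2)] dim_hyperplane by simp
  finally have len: "length f = DIM('a) - 1" .
  have "distinct f" using f(1) by (simp add: orthonormal_basis_def)
  then have "fd N p (f ! i) \<bullet> (f ! j) = 0" if "i < length f" "j < length f" "i \<noteq> j" for i j
    using f(2) that by (simp add: nth_eq_iff_index_eq)
  then show ?thesis using that f(1) len by blast
qed

lemma orthonormal_basis_nth:
  assumes "orthonormal_basis T f" "i < length f"
  shows "f ! i \<in> T" "f ! i \<noteq> 0" "f ! i \<bullet> f ! i = 1"
proof -
  have "f ! i \<in> set f" using assms(2) by simp
  then have "f ! i \<in> span (set f)" "norm (f ! i) = 1" using assms(1) by (auto simp: orthonormal_basis_def span_base)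
  then show "f ! i \<in> T" "f ! i \<noteq> 0" "f ! i \<bullet> f ! i = 1" using assms(1) by (auto simp: orthonormal_basis_def norm_eq_1)
qed

text \<open>Here \<open>s = 1\<close> stands for the Thorpe and \<open>s = -1\<close> for the anti-Thorpe equation.\<close>

lemma thorpe_diag_entries:
  assumes M: "embedded_hypersurface M" and n: "local_normal M U N" and p: "p \<in> M" "p \<in> U"
    and dim: "DIM('a::euclidean_space) = 2 * r + 1" and r: "2 * k \<le> r"
    and th: "\<And>xs ys :: 'a list. xs \<in> lists (tangent_space M p) \<Longrightarrow> ys \<in> lists (tangent_space M p) \<Longrightarrow>
      double_hodge (tangent_space M p) (thorpe_form r k M p) xs ys = s * thorpe_form r k M p xs ys"
    and f: "orthonormal_basis (tangent_space M p) f" "length f = 2 * r"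
      "\<And>i j. i < length f \<Longrightarrow> j < length f \<Longrightarrow> i \<noteq> j \<Longrightarrow> fd N p (f ! i) \<bullet> (f ! j) = 0"
    and I: "I \<subseteq> {..<2 * r}" "card I = r"
  shows "esym (2 * k) (\<lambda>i. fd N p (f ! i) \<bullet> (f ! i)) ({..<2 * r} - I) =
    s * esym (2 * k) (\<lambda>i. fd N p (f ! i) \<bullet> (f ! i)) I"
proof -
  let ?\<nu> = "\<lambda>i. fd N p (f ! i) \<bullet> (f ! i)"
  define \<mu> where "\<mu> i = ?\<nu> i / norm (N p)" for i
  note 1 = thorpe_form_diag(1)[OF M n p f(1,3) r]
  obtain a where a: "a > 0" "diag_form f (thorpe_form r k M p) (\<lambda>I. if card I = r then a * esym (2 * k) \<mu> I else 0)"
    using thorpe_form_diag(2)[OF M n p f(1,3) r] unfolding \<mu>_def by blast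
  have fT: "f \<in> lists (tangent_space M p)" using f(1) by (auto simp: orthonormal_basis_def intro: span_base)
  have I': "I \<subseteq> {..<length f}" using I f by simp
  have c: "card ({..<2 * r} - I) = r" using I by (simp add: card_Diff_subset finite_subset)
  have "a * esym (2 * k) \<mu> ({..<2 * r} - I) = s * (a * esym (2 * k) \<mu> I)"
    using double_hodge_nths[OF f(1) 1 a(2) I' I'] diag_formD[OF a(2) I' I'] c I(2)
      th[OF in_lists_nths[OF fT, of I] in_lists_nths[OF fT, of I]] f(2) by auto
  then have *: "esym (2 * k) \<mu> ({..<2 * r} - I) = s * esym (2 * k) \<mu> I" using a(1) by simp
  have N: "norm (N p) \<noteq> 0" using local_normalD(3)[OF n p(2)] by simp
  \<comment> \<open>Both sides are homogeneous of degree \<open>2 * k\<close>, so the length of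
    \<open>N p\<close> can be put back.\<close>
  have "?\<nu> = (\<lambda>i. norm (N p) * \<mu> i)" using N by (auto simp: \<mu>_def)
  then show ?thesis using * by (simp only: esym_scale) simp
qed

text \<open>Definiteness gives all principal curvatures the sign of \<open>s\<close>, so
  complementary index sets force them to agree. A bilinear form that is a multiple of the metric on
  a basis is one on the span. The bound on \<open>s * \<kappa>\<close> records that the common value
  is nonzero.\<close>

lemma thorpe_imp_umbilic:
  assumes M: "embedded_hypersurface M" and n: "local_normal M U N" and p: "p \<in> M" "p \<in> U"
    and dim: "DIM('a::euclidean_space) = 2 * r + 1" and r: "2 * k \<le> r" "0 < k"
    and th: "thorpe r k (M :: 'a set)"
    and def: "\<And>x. x \<in> tangent_space M p \<Longrightarrow> x \<noteq> 0 \<Longrightarrow> s * (fd N p x \<bullet> x) > 0"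
  obtains \<kappa> where "s * \<kappa> > 0"
    "\<And>x y. x \<in> tangent_space M p \<Longrightarrow> y \<in> tangent_space M p \<Longrightarrow> fd N p x \<bullet> y = \<kappa> * (x \<bullet> y)"
proof -
  obtain f where f: "orthonormal_basis (tangent_space M p) f" "length f = DIM('a) - 1"
    "\<And>i j. i < length f \<Longrightarrow> j < length f \<Longrightarrow> i \<noteq> j \<Longrightarrow> fd N p (f ! i) \<bullet> (f ! j) = 0"
    using principal_basis[OF M n p] by blast
  have len: "length f = 2 * r" using f(2) dim by simp
  have th': "double_hodge (tangent_space M p) (thorpe_form r k M p) xs ys = 1 * thorpe_form r k M p xs ys"
    if "xs \<in> lists (tangent_space M p)" "ys \<in> lists (tangent_space M p)" for xs ys
    using th that p(1) unfolding thorpe_def by simp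
  define \<nu> where "\<nu> i = fd N p (f ! i) \<bullet> (f ! i)" for i
  have pos: "s * \<nu> i > 0" if "i < 2 * r" for i
    using def orthonormal_basis_nth[OF f(1)] that len unfolding \<nu>_def by simp
  have eq: "\<nu> i = \<nu> l" if "i < 2 * r" "l < 2 * r" for i l
  proof (rule complementary_esym_imp_equal[of r s \<nu> "2 * k", OF pos _ _ _ that])
    fix I assume "I \<subseteq> {..<2 * r}" "card I = r"
    then show "esym (2 * k) \<nu> ({..<2 * r} - I) = esym (2 * k) \<nu> I"
      using thorpe_diag_entries[OF M n p dim r(1) th' f(1) len f(3)] unfolding \<nu>_def by simp
  qed (use r in simp_all)
  have r0: "0 < 2 * r" using r by simp
  have basis: "fd N p x \<bullet> y = \<nu> 0 * (x \<bullet> y)" if xy: "x \<in> set f" "y \<in> set f" for x y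
  proof -
    obtain i j where i: "i < length f" "x = f ! i" and j: "j < length f" "y = f ! j"
      using xy by (auto simp: in_set_conv_nth)
    show ?thesis
    proof (cases "i = j")
      case True
      then show ?thesis using i j eq[of i 0] len r0 orthonormal_basis_nth(3)[OF f(1) i(1)] by (simp add: \<nu>_def)
    next
      case False
      then show ?thesis using i j f(3)[of i j] orthonormal_list_nth[of f i j] f(1) by (simp add: orthonormal_basis_iff)
    qed
  qed
  have d: "N differentiable at p" using local_normalD(2)[OF n] p(2) smooth_on_differentiable by blast
  have sp: "tangent_space M p = span (set f)" using f(1) by (simp add: orthonormal_basis_def)
  have lin1: "linear (\<lambda>x. fd N p x \<bullet> y)" "linear (\<lambda>x. \<nu> 0 * (x \<bullet> y))" for y
    using linear_fd[OF d] by (auto intro!: linearI simp: linear_add linear_cmul inner_add_left algebra_simps)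
  have lin2: "linear (\<lambda>y. fd N p x \<bullet> y)" "linear (\<lambda>y. \<nu> 0 * (x \<bullet> y))" for x
    by (auto intro!: linearI simp: inner_add_right algebra_simps)
  have half: "fd N p x \<bullet> y = \<nu> 0 * (x \<bullet> y)" if "x \<in> span (set f)" "y \<in> set f" for x y
    by (rule linear_eq_on_span[OF lin1 _ that(1)]) (rule basis[OF _ that(2)])
  have "fd N p x \<bullet> y = \<nu> 0 * (x \<bullet> y)" if "x \<in> span (set f)" "y \<in> span (set f)" for x y
    by (rule linear_eq_on_span[OF lin2 _ that(2)]) (rule half[OF that(1)])
  then show ?thesis using that pos[OF r0] sp by simp
qed

lemma anti_thorpe_not_definite:
  assumes M: "embedded_hypersurface M" and n: "local_normal M U N" and p: "p \<in> M" "p \<in> U"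
    and dim: "DIM('a::euclidean_space) = 2 * r + 1" and r: "2 * k \<le> r"
    and th: "anti_thorpe r k (M :: 'a set)"
    and def: "\<And>x. x \<in> tangent_space M p \<Longrightarrow> x \<noteq> 0 \<Longrightarrow> s * (fd N p x \<bullet> x) > 0"
  shows False
proof -
  obtain f where f: "orthonormal_basis (tangent_space M p) f" "length f = DIM('a) - 1"
    "\<And>i j. i < length f \<Longrightarrow> j < length f \<Longrightarrow> i \<noteq> j \<Longrightarrow> fd N p (f ! i) \<bullet> (f ! j) = 0"
    using principal_basis[OF M n p] by blast
  have len: "length f = 2 * r" using f(2) dim by simp
  have th': "double_hodge (tangent_space M p) (thorpe_form r k M p) xs ys = - 1 * thorpe_form r k M p xs ys"
    if "xs \<in> lists (tangent_space M p)" "ys \<in> lists (tangent_space M p)" for xs ys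
    using th that p(1) unfolding anti_thorpe_def by simp
  define \<nu> where "\<nu> i = fd N p (f ! i) \<bullet> (f ! i)" for i
  have pos: "s * \<nu> i > 0" if "i < 2 * r" for i
    using def orthonormal_basis_nth[OF f(1)] that len unfolding \<nu>_def by simp
  let ?I = "{..<r}"
  have I: "?I \<subseteq> {..<2 * r}" "card ?I = r" by auto
  have "esym (2 * k) \<nu> ({..<2 * r} - ?I) = - 1 * esym (2 * k) \<nu> ?I"
    using thorpe_diag_entries[OF M n p dim r th' f(1) len f(3) I] unfolding \<nu>_def .
  \<comment> \<open>Scaling by \<open>s\<close> multiplies both terms by the same power and makes
    all arguments positive, so two positive numbers would add up to zero.\<close>
  then have "esym (2 * k) (\<lambda>i. s * \<nu> i) ({..<2 * r} - ?I) + esym (2 * k) (\<lambda>i. s * \<nu> i) ?I = 0"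
    by (simp add: esym_scale)
  moreover have "esym (2 * k) (\<lambda>i. s * \<nu> i) ?I > 0"
    by (rule esym_pos) (use pos r in auto)
  moreover have "esym (2 * k) (\<lambda>i. s * \<nu> i) ({..<2 * r} - ?I) > 0"
    by (rule esym_pos) (use pos r in \<open>auto simp: card_Diff_subset\<close>)
  ultimately show False by linarith
qed

text \<open>With equal principal curvatures the entry at an index set depends on its size only, and
  in dimension \<open>2 * r\<close> the complement of an \<open>r\<close>-set is again an
  \<open>r\<close>-set.\<close>

lemma umbilic_imp_thorpe_at:
  assumes M: "embedded_hypersurface M" and n: "local_normal M U N" and p: "p \<in> M" "p \<in> U"
    and dim: "DIM('a::euclidean_space) = 2 * r + 1" and r: "2 * k \<le> r"
    and umb: "\<And>x y :: 'a. x \<in> tangent_space M p \<Longrightarrow> y \<in> tangent_space M p \<Longrightarrow> fd N p x \<bullet> y = \<kappa> * (x \<bullet> y)"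
    and xs: "xs \<in> lists (tangent_space M p)" and ys: "ys \<in> lists (tangent_space M p)"
  shows "double_hodge (tangent_space M p) (thorpe_form r k M p) xs ys = thorpe_form r k M p xs ys"
proof -
  obtain f where f: "orthonormal_basis (tangent_space M p) f" "length f = DIM('a) - 1"
    "\<And>i j. i < length f \<Longrightarrow> j < length f \<Longrightarrow> i \<noteq> j \<Longrightarrow> fd N p (f ! i) \<bullet> (f ! j) = 0"
    using principal_basis[OF M n p] by blast
  have len: "length f = 2 * r" using f(2) dim by simp
  define \<mu> where "\<mu> i = fd N p (f ! i) \<bullet> (f ! i) / norm (N p)" for i
  note 1 = thorpe_form_diag(1)[OF M n p f(1,3) r]
  obtain a where a: "diag_form f (thorpe_form r k M p) (\<lambda>I. if card I = r then a * esym (2 * k) \<mu> I else 0)"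
    using thorpe_form_diag(2)[OF M n p f(1,3) r] unfolding \<mu>_def by blast
  have mu: "\<mu> i = \<kappa> / norm (N p)" if "i < length f" for i
    using umb orthonormal_basis_nth[OF f(1) that] by (simp add: \<mu>_def)
  have es: "esym (2 * k) \<mu> A = real (card A choose (2 * k)) * (\<kappa> / norm (N p)) ^ (2 * k)" if A: "A \<subseteq> {..<length f}" for A
  proof -
    have "esym (2 * k) \<mu> A = esym (2 * k) (\<lambda>i. \<kappa> / norm (N p)) A"
      unfolding esym_def using A mu by (intro sum.cong prod.cong) auto
    moreover have "finite A" using A finite_subset by blast
    ultimately show ?thesis by (simp add: esym_const)
  qed
  show ?thesis
  proof (rule double_alt_double_hodge_diag[OF f(1) 1 a _ xs ys])
    fix A assume A: "A \<subseteq> {..<length f}"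
    then have c: "card ({..<length f} - A) = 2 * r - card A"
      using len by (simp add: card_Diff_subset finite_subset)
    have "card A \<le> 2 * r" using card_mono[OF _ A] len by simp
    then have iff: "card ({..<length f} - A) = r \<longleftrightarrow> card A = r" using c by auto
    show "(if card ({..<length f} - A) = r then a * esym (2 * k) \<mu> ({..<length f} - A) else 0) =
      (if card A = r then a * esym (2 * k) \<mu> A else 0)"
      using iff es[OF A] es[of "{..<length f} - A"] by auto
  qed
qed

section \<open>Definite points of a compact hypersurface\<close>

text \<open>If \<open>c\<close> were positive, \<open>g'\<close> would be positive just to the right
  of 0, and \<open>g\<close> would exceed \<open>g 0\<close> there.\<close>

lemma second_derivative_at_max:
  fixes g g' :: "real \<Rightarrow> real"
  assumes "\<epsilon> > 0" and der: "\<And>t. t \<in> {-\<epsilon><..<\<epsilon>} \<Longrightarrow> (g has_real_derivative g' t) (at t)"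
    and max: "\<And>t. t \<in> {-\<epsilon><..<\<epsilon>} \<Longrightarrow> g t \<le> g 0"
    and snd: "(g' has_real_derivative c) (at 0)"
  shows "g' 0 = 0" "c \<le> 0"
proof -
  show g0: "g' 0 = 0"
  proof (rule DERIV_local_max[OF der assms(1)])
    show "\<forall>y. \<bar>0 - y\<bar> < \<epsilon> \<longrightarrow> g y \<le> g 0"
    proof (intro allI impI)
      fix y :: real assume "\<bar>0 - y\<bar> < \<epsilon>"
      then show "g y \<le> g 0" by (intro max) auto
    qed
  qed (use assms(1) in simp)
  show "c \<le> 0"
  proof (rule ccontr)
    assume "\<not> c \<le> 0"
    then obtain d where d: "d > 0" "\<And>h. h > 0 \<Longrightarrow> h < d \<Longrightarrow> g' 0 < g' (0 + h)"
      using DERIV_pos_inc_right[OF snd] by auto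
    define h where "h = min d \<epsilon> / 2"
    have h: "0 < h" "h < d" "h < \<epsilon>" using d(1) assms(1) by (auto simp: h_def)
    have "\<exists>z. 0 < z \<and> z < h \<and> g h - g 0 = (h - 0) * g' z"
      by (rule MVT2[OF h(1)]) (use der h in auto)
    then obtain z where z: "0 < z" "z < h" "g h - g 0 = h * g' z" by auto
    have "g' z > 0" using d(2)[of z] z h g0 by simp
    then have "g h > g 0" using z h by (metis diff_gt_0_iff_gt mult_pos_pos)
    then show False using max[of h] h by auto
  qed
qed

text \<open>The component of \<open>m\<close> orthogonal to \<open>n\<close> is, by assumption,
  orthogonal to \<open>m\<close> and therefore to itself.\<close>

lemma hyperplane_subset_imp_parallel:
  fixes n m :: "'a::euclidean_space"
  assumes "n \<noteq> 0" "\<And>v. n \<bullet> v = 0 \<Longrightarrow> m \<bullet> v = 0"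
  shows "m = ((m \<bullet> n) / (n \<bullet> n)) *\<^sub>R n"
proof -
  let ?w = "nproj n m"
  have "n \<bullet> ?w = 0" by (rule nproj_orthogonal[OF assms(1)])
  moreover from this have "m \<bullet> ?w = 0" by (rule assms(2))
  ultimately have "?w \<bullet> ?w = 0" by (simp add: nproj_inner)
  then show ?thesis by (simp add: nproj_def)
qed

lemma tangent_curveE:
  assumes "v \<in> tangent_space M p"
  obtains \<epsilon> and \<gamma> :: "real \<Rightarrow> 'a::euclidean_space" where "\<epsilon> > 0" "smooth_on {-\<epsilon><..<\<epsilon>} \<gamma>"
    "\<gamma> ` {-\<epsilon><..<\<epsilon>} \<subseteq> M" "\<gamma> 0 = p" "(\<gamma> has_vector_derivative v) (at 0)"
  using assms unfolding tangent_space_def mem_Collect_eq by (elim exE conjE) (rule that; assumption)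

lemma has_vector_derivative_fd:
  fixes \<gamma> :: "real \<Rightarrow> 'a::real_normed_vector"
  assumes "\<gamma> differentiable at t"
  shows "(\<gamma> has_vector_derivative fd \<gamma> t 1) (at t)"
proof -
  have "(\<gamma> has_derivative fd \<gamma> t) (at t)" using assms frechet_derivative_works by blast
  moreover have "fd \<gamma> t = (\<lambda>s. s *\<^sub>R fd \<gamma> t 1)"
  proof
    show "fd \<gamma> t s = s *\<^sub>R fd \<gamma> t 1" for s
      using linear_cmul[OF linear_fd[OF assms], of s 1] by simp
  qed
  ultimately show ?thesis unfolding has_vector_derivative_def by (rule back_subst)
qed

lemma curve_velocity_tangent:
  fixes \<gamma> :: "real \<Rightarrow> 'a::euclidean_space"
  assumes "smooth_on {-\<epsilon><..<\<epsilon>} \<gamma>" "\<gamma> ` {-\<epsilon><..<\<epsilon>} \<subseteq> M" "t \<in> {-\<epsilon><..<\<epsilon>}"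
  shows "fd \<gamma> t 1 \<in> tangent_space M (\<gamma> t)"
proof -
  \<comment> \<open>\<open>tangent_space\<close> takes velocities at time 0, so the curve is shifted
    by \<open>t\<close>; this radius keeps the shifted interval inside the old one.\<close>
  define \<epsilon>' where "\<epsilon>' = \<epsilon> - \<bar>t\<bar>"
  have e: "\<epsilon>' > 0" using assms(3) by (auto simp: \<epsilon>'_def)
  let ?l = "\<lambda>s::real. t + s *\<^sub>R 1"
  have im: "?l ` {-\<epsilon>'<..<\<epsilon>'} \<subseteq> {-\<epsilon><..<\<epsilon>}" by (auto simp: \<epsilon>'_def)
  have "smooth_on {-\<epsilon>'<..<\<epsilon>'} (\<lambda>s. \<gamma> (?l s))"
    by (rule smooth_on_compose[OF _ im affine_line_smooth assms(1)]) auto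
  moreover have "(\<lambda>s. \<gamma> (?l s)) ` {-\<epsilon>'<..<\<epsilon>'} \<subseteq> M" using im assms(2) by blast
  moreover have "((\<lambda>s. \<gamma> (?l s)) has_vector_derivative fd \<gamma> t 1) (at 0)"
  proof -
    have "(\<gamma> has_vector_derivative fd \<gamma> t 1) (at (?l 0))"
      using has_vector_derivative_fd[OF smooth_on_differentiable[OF assms(1,3)]] by simp
    moreover have "(?l has_vector_derivative 1) (at 0)"
      by (auto intro!: derivative_eq_intros)
    ultimately have "((\<gamma> \<circ> ?l) has_vector_derivative (1 *\<^sub>R fd \<gamma> t 1)) (at 0)"
      by (intro vector_diff_chain_at)
    then show ?thesis by (simp add: o_def)
  qed
  ultimately show ?thesis unfolding tangent_space_def mem_Collect_eq using e
    by (intro exI[of _ \<epsilon>'] exI[of _ "\<lambda>s. \<gamma> (?l s)"] conjI) simp_all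
qed

text \<open>Differentiate $|\gamma|^2$ twice and $N\cdot\gamma' = 0$ once along curves in \<open>M\<close>.\<close>

lemma definite_at_max_norm:
  assumes M: "embedded_hypersurface M" and n: "local_normal M U N" and p: "p \<in> M" "p \<in> U"
    and max: "\<And>q. q \<in> M \<Longrightarrow> norm q \<le> norm p" and dim: "DIM('a::euclidean_space) \<ge> 2"
  shows "\<exists>s. \<forall>x \<in> tangent_space M (p::'a). x \<noteq> 0 \<longrightarrow> s * (fd N p x \<bullet> x) > 0"
proof -
  have T: "tangent_space M p = {v. N p \<bullet> v = 0}" and N0: "N p \<noteq> 0"
    using local_normalD[OF n] p by blast+
  \<comment> \<open>Here \<open>a\<close> is the acceleration at time 0 of a curve with velocity
    \<open>v\<close>. The inequality is the second-order condition at the maximum, the last equation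
    the derivative of tangency.\<close>
  have key: "p \<bullet> v = 0 \<and> (\<exists>a. v \<bullet> v + p \<bullet> a \<le> 0 \<and> fd N p v \<bullet> v + N p \<bullet> a = 0)"
    if v: "v \<in> tangent_space M p" for v
  proof -
    obtain \<epsilon> and \<gamma> :: "real \<Rightarrow> 'a" where \<gamma>: "\<epsilon> > 0" "smooth_on {-\<epsilon><..<\<epsilon>} \<gamma>"
      "\<gamma> ` {-\<epsilon><..<\<epsilon>} \<subseteq> M" "\<gamma> 0 = p" "(\<gamma> has_vector_derivative v) (at 0)"
      using v by (rule tangent_curveE)
    let ?S = "{-\<epsilon><..<\<epsilon>}"
    define \<gamma>' where "\<gamma>' t = fd \<gamma> t 1" for t
    have s': "smooth_on ?S \<gamma>'" unfolding \<gamma>'_def[abs_def] by (rule smooth_on_fd[OF \<gamma>(2)])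
    have z: "0 \<in> ?S" using \<gamma>(1) by simp
    have d\<gamma>: "(\<gamma> has_vector_derivative \<gamma>' t) (at t)" if "t \<in> ?S" for t
      unfolding \<gamma>'_def by (rule has_vector_derivative_fd[OF smooth_on_differentiable[OF \<gamma>(2) that]])
    have v0: "\<gamma>' 0 = v" using vector_derivative_unique_at[OF d\<gamma>[OF z] \<gamma>(5)] .
    define a where "a = fd \<gamma>' 0 1"
    have d\<gamma>': "(\<gamma>' has_vector_derivative a) (at 0)"
      unfolding a_def by (rule has_vector_derivative_fd[OF smooth_on_differentiable[OF s' z]])
    have inner_der: "((\<lambda>t. f t \<bullet> g t) has_real_derivative (f t \<bullet> g' + f' \<bullet> g t)) (at t)"
      if "(f has_vector_derivative f') (at t)" "(g has_vector_derivative g') (at t)" for f g :: "real \<Rightarrow> 'a" and f' g' t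
      using bounded_bilinear.has_vector_derivative[OF bounded_bilinear_inner that]
      by (simp add: has_real_derivative_iff_has_vector_derivative)
    have g1: "((\<lambda>t. \<gamma> t \<bullet> \<gamma> t) has_real_derivative (2 * (\<gamma> t \<bullet> \<gamma>' t))) (at t)" if "t \<in> ?S" for t
      using inner_der[OF d\<gamma>[OF that] d\<gamma>[OF that]] by (simp add: inner_commute)
    have g2: "((\<lambda>t. 2 * (\<gamma> t \<bullet> \<gamma>' t)) has_real_derivative (2 * (p \<bullet> a + v \<bullet> v))) (at 0)"
      using DERIV_cmult[OF inner_der[OF d\<gamma>[OF z] d\<gamma>'], of 2] v0 \<gamma>(4) by simp
    have mx: "\<gamma> t \<bullet> \<gamma> t \<le> \<gamma> 0 \<bullet> \<gamma> 0" if "t \<in> ?S" for t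
    proof -
      have "\<gamma> t \<in> M" using \<gamma>(3) that by blast
      from max[OF this] show ?thesis using \<gamma>(4) by (simp add: norm_le)
    qed
    note m = second_derivative_at_max[OF \<gamma>(1) g1 mx g2]
    have "open U" "smooth_on U N" using local_normalD[OF n] by blast+
    have "continuous_on ?S \<gamma>" using smooth_on_continuous[OF \<gamma>(2)] .
    then have op: "open (?S \<inter> \<gamma> -` U)" by (intro continuous_open_preimage \<open>open U\<close>) auto
    have zin: "0 \<in> ?S \<inter> \<gamma> -` U" using z \<gamma>(4) p by simp
    have "(N has_derivative fd N p) (at (\<gamma> 0))"
      using smooth_on_has_derivative[OF \<open>smooth_on U N\<close> p(2)] \<gamma>(4) by simp
    then have dN: "((\<lambda>t. N (\<gamma> t)) has_vector_derivative fd N p v) (at 0)"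
      using vector_derivative_diff_chain_within[of \<gamma> v 0 UNIV N "fd N p"] \<gamma>(5)
      by (simp add: o_def has_derivative_at_withinI)
    have zero: "N (\<gamma> t) \<bullet> \<gamma>' t = 0" if "t \<in> ?S \<inter> \<gamma> -` U" for t
    proof -
      have "\<gamma>' t \<in> tangent_space M (\<gamma> t)"
        unfolding \<gamma>'_def by (rule curve_velocity_tangent[OF \<gamma>(2,3)]) (use that in simp)
      moreover have "\<gamma> t \<in> M" "\<gamma> t \<in> U" using \<gamma>(3) that by auto
      ultimately show ?thesis using local_normalD(5)[OF n] by simp
    qed
    have "((\<lambda>t. N (\<gamma> t) \<bullet> \<gamma>' t) has_real_derivative (N p \<bullet> a + fd N p v \<bullet> v)) (at 0)"
      using inner_der[OF dN d\<gamma>'] v0 \<gamma>(4) by simp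
    moreover have "((\<lambda>t. N (\<gamma> t) \<bullet> \<gamma>' t) has_real_derivative 0) (at 0)"
    proof -
      have "((\<lambda>t. 0) has_real_derivative 0) (at 0)" by simp
      then show ?thesis
        by (rule has_field_derivative_transform_within_open[OF _ op zin]) (simp add: zero)
    qed
    ultimately have "N p \<bullet> a + fd N p v \<bullet> v = 0" by (rule DERIV_unique)
    moreover have "p \<bullet> v = 0" using m(1) v0 \<gamma>(4) by simp
    moreover have "v \<bullet> v + p \<bullet> a \<le> 0" using m(2) by simp
    ultimately show ?thesis by (auto simp: add.commute)
  qed
  \<comment> \<open>As \<open>p\<close> is orthogonal to the tangent space, it is this multiple of
    \<open>N p\<close>. Hence both relations of \<open>key\<close> contain the acceleration only
    through \<open>N p \<bullet> a\<close>, which can be eliminated; \<open>\<mu>\<close> is the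
    required \<open>s\<close>.\<close>
  define \<mu> where "\<mu> = (p \<bullet> N p) / (N p \<bullet> N p)"
  have pN: "p = \<mu> *\<^sub>R N p"
    unfolding \<mu>_def by (rule hyperplane_subset_imp_parallel[OF N0]) (use key T in blast)
  have "\<mu> * (fd N p x \<bullet> x) > 0" if x: "x \<in> tangent_space M p" "x \<noteq> 0" for x
  proof -
    obtain a where a: "x \<bullet> x + p \<bullet> a \<le> 0" "fd N p x \<bullet> x + N p \<bullet> a = 0" using key[OF x(1)] by blast
    have "p \<bullet> a = \<mu> * (N p \<bullet> a)" by (subst pN) simp
    also have "N p \<bullet> a = - (fd N p x \<bullet> x)" using a(2) by simp
    finally have "x \<bullet> x \<le> \<mu> * (fd N p x \<bullet> x)" using a(1) by simp
    moreover have "x \<bullet> x > 0" using x(2) by simp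
    ultimately show ?thesis by linarith
  qed
  then show ?thesis by blast
qed

lemma exists_definite_point:
  assumes "embedded_hypersurface M" "compact M" "M \<noteq> {}" "DIM('a::euclidean_space) \<ge> 2"
  obtains p U N s where "(p::'a) \<in> M" "p \<in> U" "local_normal M U N"
    "\<And>x. x \<in> tangent_space M p \<Longrightarrow> x \<noteq> 0 \<Longrightarrow> s * (fd N p x \<bullet> x) > 0"
proof -
  have "continuous_on M norm" by (intro continuous_intros)
  from continuous_attains_sup[OF assms(2,3) this]
  obtain p where p: "p \<in> M" "\<And>q. q \<in> M \<Longrightarrow> norm q \<le> norm p" by blast
  obtain U N where U: "p \<in> U" "local_normal M U N" using local_normal_exists[OF assms(1) p(1)] by blast
  obtain s where "\<forall>x \<in> tangent_space M p. x \<noteq> 0 \<longrightarrow> s * (fd N p x \<bullet> x) > 0"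
    using definite_at_max_norm[OF assms(1) U(2) p(1) U(1) p(2) assms(4)] by blast
  then show ?thesis using that[OF p(1) U] by blast
qed

section \<open>Local constancy and openness of definiteness\<close>

text \<open>In a slice chart a small piece of \<open>M\<close> is the convex intersection of a ball
  with \<open>H\<close>. Along the image of the segment from \<open>\<phi> p\<close> to
  \<open>\<phi> q\<close> the function \<open>C\<close> has derivative zero.\<close>

lemma locally_constant:
  fixes C :: "'a::euclidean_space \<Rightarrow> 'b::real_normed_vector"
  assumes M: "embedded_hypersurface M" and p: "p \<in> M" "p \<in> W" and W: "open W" and C: "smooth_on W C"
    and zero: "\<And>q v. q \<in> M \<Longrightarrow> q \<in> W \<Longrightarrow> v \<in> tangent_space M q \<Longrightarrow> fd C q v = 0"
  shows "\<exists>W'. open W' \<and> p \<in> W' \<and> W' \<subseteq> W \<and> (\<forall>q\<in>M \<inter> W'. C q = C p)"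
proof -
  obtain U V H \<phi> \<psi> where c: "slice_chart M U V H \<phi> \<psi>" and pU: "p \<in> U"
    using embedded_hypersurface_chart[OF M p(1)] by blast
  note inv = slice_chart_inv[OF c]
  have s: "open U" "open V" "smooth_on U \<phi>" "smooth_on V \<psi>" "subspace H"
    using c by (auto simp: slice_chart_def)
  have "open (V \<inter> \<psi> -` W)" using smooth_on_continuous[OF s(4)] s(2) W by (intro continuous_open_preimage)
  moreover have "\<phi> p \<in> V \<inter> \<psi> -` W" using inv(1,2)[OF pU] p by simp
  ultimately obtain e where e: "e > 0" "ball (\<phi> p) e \<subseteq> V \<inter> \<psi> -` W" unfolding open_contains_ball by blast
  define W' where "W' = U \<inter> \<phi> -` ball (\<phi> p) e"
  have op: "open W'" unfolding W'_def using smooth_on_continuous[OF s(3)] s(1) by (intro continuous_open_preimage) auto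
  have pW': "p \<in> W'" using pU e by (simp add: W'_def)
  have sub: "W' \<subseteq> W"
  proof
    fix q assume "q \<in> W'"
    then have "q \<in> U" "\<phi> q \<in> \<psi> -` W" using e(2) by (auto simp: W'_def)
    then show "q \<in> W" using inv(1)[of q] by simp
  qed
  have pH: "\<phi> p \<in> H" using inv(5)[of "\<phi> p"] inv(1,2)[OF pU] p by simp
  have "C q = C p" if q: "q \<in> M" "q \<in> W'" for q
  proof -
    have qU: "q \<in> U" and qb: "\<phi> q \<in> ball (\<phi> p) e" using q by (auto simp: W'_def)
    have qH: "\<phi> q \<in> H" using inv(5)[of "\<phi> q"] inv(1,2)[OF qU] q by simp
    define w where "w = \<phi> q - \<phi> p"
    have wH: "w \<in> H" unfolding w_def by (rule subspace_diff[OF s(5) qH pH])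
    let ?l = "\<lambda>t::real. \<phi> p + t *\<^sub>R w"
    have lb: "?l t \<in> ball (\<phi> p) e" if "t \<in> {0..1}" for t
    proof -
      have "norm (t *\<^sub>R w) \<le> norm w" using that by (simp add: mult_left_le_one_le)
      also have "norm w < e" using qb by (simp add: w_def dist_norm norm_minus_commute)
      finally show ?thesis by (simp add: dist_norm)
    qed
    have lV: "?l t \<in> V" "\<psi> (?l t) \<in> W" "?l t \<in> H" if "t \<in> {0..1}" for t
      using lb[OF that] e(2) pH wH s(5) by (auto simp: subspace_add subspace_mul)
    have "((\<lambda>t. C (\<psi> (?l t))) has_vector_derivative 0) (at t within {0..1})" if t: "t \<in> {0..1}" for t
    proof -
      let ?m = "\<psi> (?l t)"
      have m: "?m \<in> M" "?m \<in> W" using inv(5)[of "?l t"] lV[OF t] by auto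
      have "fd \<psi> (?l t) w \<in> tangent_space M ?m" by (rule slice_chart_tangent[OF c lV(1,3)[OF t] wH])
      then have z: "fd C ?m (fd \<psi> (?l t) w) = 0" using zero m by blast
      have "((\<lambda>t. \<psi> (?l t)) has_vector_derivative fd \<psi> (?l t) w) (at t)" by (rule slice_chart_line[OF c lV(1)[OF t]])
      moreover have "(C has_derivative fd C ?m) (at ?m)" using smooth_on_has_derivative[OF C m(2)] .
      ultimately have "((C \<circ> (\<lambda>t. \<psi> (?l t))) has_vector_derivative fd C ?m (fd \<psi> (?l t) w)) (at t)"
        using vector_derivative_diff_chain_within[of "\<lambda>t. \<psi> (?l t)" "fd \<psi> (?l t) w" t UNIV C "fd C ?m"]
        by (simp add: has_derivative_at_withinI)
      then show ?thesis unfolding z o_def by (rule has_vector_derivative_at_within)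
    qed
    then obtain k where k: "\<And>t. t \<in> {0..1} \<Longrightarrow> C (\<psi> (?l t)) = k"
      using has_vector_derivative_zero_constant[of "{0..1::real}" "\<lambda>t. C (\<psi> (?l t))"] by auto
    have "C (\<psi> (?l 1)) = C (\<psi> (?l 0))" using k[of 1] k[of 0] by simp
    then show ?thesis using inv(1)[OF qU] inv(1)[OF pU] by (simp add: w_def)
  qed
  then show ?thesis using op pW' sub by (intro exI[of _ W']) simp
qed

text \<open>Smoothness gives continuity in the base point for each fixed direction; expansion in
  \<open>Basis\<close> upgrades it to joint continuity.\<close>

lemma continuous_on_fd_inner:
  fixes N :: "'a::euclidean_space \<Rightarrow> 'a"
  assumes "open U" "smooth_on U N" "continuous_on S f" "continuous_on S g" "continuous_on S h" "f ` S \<subseteq> U"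
  shows "continuous_on S (\<lambda>z. fd N (f z) (g z) \<bullet> h z)"
proof -
  have "continuous_on S (\<lambda>z. (\<Sum>b\<in>Basis. (g z \<bullet> b) *\<^sub>R fd N (f z) b) \<bullet> h z)"
  proof (intro continuous_intros assms)
    fix b
    show "continuous_on S (\<lambda>z. fd N (f z) b)"
      by (rule continuous_on_compose2[OF smooth_on_continuous[OF smooth_on_fd[OF assms(2)]] assms(3,6)])
  qed
  moreover have "fd N (f z) (g z) \<bullet> h z = (\<Sum>b\<in>Basis. (g z \<bullet> b) *\<^sub>R fd N (f z) b) \<bullet> h z" if "z \<in> S" for z
    using fd_expand[OF smooth_on_differentiable[OF assms(2)], of "f z" "g z"] that assms(6) by (simp add: image_subset_iff)
  ultimately show ?thesis by (simp cong: continuous_on_cong)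
qed

text \<open>The tangent space moves with \<open>q\<close>, so the argument runs over all unit
  vectors of the ambient space: the set \<open>A\<close> of pairs for which the form is positive or
  the vector is not tangent is open and contains all of \<open>{p} \<times> sphere 0 1\<close>. The
  tube lemma gives a neighbourhood valid for all directions.\<close>

lemma definite_open:
  assumes n: "local_normal M U N" and p: "p \<in> M" "p \<in> U"
    and def: "\<And>x. x \<in> tangent_space M p \<Longrightarrow> x \<noteq> 0 \<Longrightarrow> s * (fd N p x \<bullet> x) > 0"
  obtains W where "open W" "p \<in> W" "W \<subseteq> U"
    "\<And>q x. q \<in> M \<Longrightarrow> q \<in> W \<Longrightarrow> x \<in> tangent_space M q \<Longrightarrow> x \<noteq> 0 \<Longrightarrow> s * (fd N q x \<bullet> x) > 0"
proof -
  have U: "open U" "smooth_on U N" using local_normalD[OF n] by blast+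
  let ?P = "U \<times> (UNIV :: 'a set)"
  have oP: "open ?P" using U(1) by (rule open_Times) simp
  have fst: "continuous_on ?P fst" "fst ` ?P \<subseteq> U" by (auto intro: continuous_on_fst continuous_on_id)
  have snd: "continuous_on ?P snd" by (auto intro: continuous_on_snd continuous_on_id)
  have c1: "continuous_on ?P (\<lambda>z. s * (fd N (fst z) (snd z) \<bullet> snd z))"
    by (intro continuous_on_mult_left continuous_on_fd_inner[OF U fst(1) snd snd fst(2)])
  have c2: "continuous_on ?P (\<lambda>z. N (fst z) \<bullet> snd z)"
    by (intro continuous_on_inner snd continuous_on_compose2[OF smooth_on_continuous[OF U(2)] fst])
  define A where "A = (?P \<inter> (\<lambda>z. s * (fd N (fst z) (snd z) \<bullet> snd z)) -` {0<..}) \<union>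
     (?P \<inter> (\<lambda>z. N (fst z) \<bullet> snd z) -` (- {0}))"
  have "open A" unfolding A_def
    by (intro open_Un continuous_open_preimage c1 c2 oP) auto
  moreover have "{p} \<times> sphere 0 1 \<subseteq> A"
  proof
    fix z :: "'a \<times> 'a" assume "z \<in> {p} \<times> sphere 0 1"
    then obtain x where x: "z = (p, x)" "norm x = 1" by auto
    show "z \<in> A"
    proof (cases "N p \<bullet> x = 0")
      case True
      then have "x \<in> tangent_space M p" using local_normalD(5)[OF n p] by simp
      moreover have "x \<noteq> 0" using x(2) by auto
      ultimately show ?thesis using def x(1) p(2) by (simp add: A_def)
    next
      case False
      then show ?thesis using x(1) p(2) by (simp add: A_def)
    qed
  qed
  ultimately obtain X where X: "p \<in> X" "open X" "X \<times> sphere 0 1 \<subseteq> A"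
    using Elementary_Topology.tube_lemma[of "sphere (0::'a) 1" A p] by auto
  have "s * (fd N q x \<bullet> x) > 0"
    if q: "q \<in> M" "q \<in> X \<inter> U" "x \<in> tangent_space M q" "x \<noteq> 0" for q x
  proof -
    have qU: "q \<in> U" using q by simp
    let ?y = "x /\<^sub>R norm x"
    have "(q, ?y) \<in> A" using X(3) q by auto
    moreover have "N q \<bullet> x = 0" using local_normalD(5)[OF n q(1) qU] q(3) by simp
    ultimately have "s * (fd N q ?y \<bullet> ?y) > 0" by (auto simp: A_def)
    moreover have "fd N q ?y = inverse (norm x) *\<^sub>R fd N q x"
      by (rule linear_cmul[OF linear_fd[OF smooth_on_differentiable[OF U(2) qU]]])
    ultimately have "s * (inverse (norm x) * inverse (norm x) * (fd N q x \<bullet> x)) > 0"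
      by (simp add: mult.assoc)
    then have "(inverse (norm x) * inverse (norm x)) * (s * (fd N q x \<bullet> x)) > 0"
      by (simp add: mult_ac)
    moreover have "inverse (norm x) * inverse (norm x) > 0" using q(4) by simp
    ultimately show ?thesis using zero_less_mult_pos by blast
  qed
  then show ?thesis using that[of "X \<inter> U"] X U(1) p(2) by auto
qed

section \<open>Umbilic hypersurfaces\<close>

lemma exists_orthogonal:
  fixes a b :: "'a::euclidean_space"
  assumes "DIM('a) \<ge> 3"
  obtains x where "x \<noteq> 0" "a \<bullet> x = 0" "b \<bullet> x = 0"
proof -
  have "dim {a, b} \<le> card {a, b}" by (rule dim_le_card') simp
  also have "\<dots> \<le> 2" by (simp add: card_insert_if)
  finally have "dim {a, b} < DIM('a)" using assms by simp
  then obtain x where x: "x \<noteq> 0" "\<And>y. y \<in> span {a, b} \<Longrightarrow> orthogonal x y"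
    using orthogonal_to_subspace_exists by blast
  have "orthogonal x a" "orthogonal x b" by (auto intro!: x(2) span_base)
  then show ?thesis using that[of x] x(1) by (simp add: orthogonal_def inner_commute)
qed

text \<open>The centre of curvature $c = p - N/\kappa$ depends on neither the sign nor the length of \<open>N\<close>.\<close>

definition umbilic_at :: "'a::euclidean_space set \<Rightarrow> 'a \<Rightarrow> 'a \<Rightarrow> bool" where
  "umbilic_at M c p \<longleftrightarrow> (\<exists>U N \<kappa>. p \<in> U \<and> local_normal M U N \<and> \<kappa> \<noteq> 0 \<and> N p = \<kappa> *\<^sub>R (p - c) \<and>
     (\<forall>x\<in>tangent_space M p. \<forall>y\<in>tangent_space M p. fd N p x \<bullet> y = \<kappa> * (x \<bullet> y)))"

text \<open>Along \<open>M\<close> two normals differ by a smooth factor \<open>l\<close>. Its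
  derivative multiplies a normal vector and is invisible to tangent ones, so
  \<open>\<kappa>'\<close> is merely scaled by \<open>l p\<close>, as is the normal itself.\<close>

lemma umbilic_at_any_normal:
  assumes "umbilic_at M c p" and p: "p \<in> M" and n: "local_normal M U N" "p \<in> U"
  shows "\<exists>\<kappa>. \<kappa> \<noteq> 0 \<and> N p = \<kappa> *\<^sub>R (p - c) \<and>
    (\<forall>x\<in>tangent_space M p. \<forall>y\<in>tangent_space M p. fd N p x \<bullet> y = \<kappa> * (x \<bullet> y))"
proof -
  obtain U' N' \<kappa>' where n': "p \<in> U'" "local_normal M U' N'" and \<kappa>': "\<kappa>' \<noteq> 0" "N' p = \<kappa>' *\<^sub>R (p - c)"
    "\<forall>x\<in>tangent_space M p. \<forall>y\<in>tangent_space M p. fd N' p x \<bullet> y = \<kappa>' * (x \<bullet> y)"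
    using assms(1) unfolding umbilic_at_def by blast
  define V where "V = U \<inter> U'"
  have V: "open V" "V \<subseteq> U" "V \<subseteq> U'" "p \<in> V"
    using local_normalD(1)[OF n(1)] local_normalD(1)[OF n'(2)] n(2) n'(1) by (auto simp: V_def)
  note m = local_normal_subset[OF n(1) V(1,2)] and m' = local_normal_subset[OF n'(2) V(1,3)]
  have s: "smooth_on V N" "smooth_on V N'" using local_normalD(2)[OF m] local_normalD(2)[OF m'] by auto
  define l where "l q = (N q \<bullet> N' q) / (N' q \<bullet> N' q)" for q
  have sl: "smooth_on V l" unfolding l_def
    by (intro smooth_on_divide smooth_on_inner s V(1)) (use local_normalD(3)[OF m'] in simp)
  have par: "N q = l q *\<^sub>R N' q" if q: "q \<in> M" "q \<in> V" for q
    unfolding l_def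
  proof (rule hyperplane_subset_imp_parallel[OF local_normalD(3)[OF m' q(2)]])
    fix v assume "N' q \<bullet> v = 0"
    then show "N q \<bullet> v = 0" using local_normalD(5)[OF m q] local_normalD(5)[OF m' q] by auto
  qed
  have d: "N differentiable at p" "N' differentiable at p" "l differentiable at p"
    using s sl V(4) smooth_on_differentiable by blast+
  have "l p \<noteq> 0" using par[OF p V(4)] local_normalD(3)[OF n] by auto
  show ?thesis
  proof (intro exI[of _ "l p * \<kappa>'"] conjI ballI)
    show "l p * \<kappa>' \<noteq> 0" using \<open>l p \<noteq> 0\<close> \<kappa>'(1) by simp
    show "N p = (l p * \<kappa>') *\<^sub>R (p - c)" using par[OF p V(4)] \<kappa>'(2) by simp
    fix x y assume x: "x \<in> tangent_space M p" and y: "y \<in> tangent_space M p"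
    have "fd N p x = fd (\<lambda>q. l q *\<^sub>R N' q) p x"
      by (rule tangent_deriv_eq[OF x d(1) differentiable_scaleR[OF d(3,2)] p V(1,4)]) (use par in auto)
    also have "\<dots> = l p *\<^sub>R fd N' p x + fd l p x *\<^sub>R N' p" by (rule fd_scaleR[OF d(3,2)])
    finally have "fd N p x \<bullet> y = l p * (fd N' p x \<bullet> y) + fd l p x * (N' p \<bullet> y)" by (simp add: inner_add_left)
    moreover have "N' p \<bullet> y = 0" using y local_normalD(5)[OF m' p V(4)] by simp
    ultimately show "fd N p x \<bullet> y = l p * \<kappa>' * (x \<bullet> y)" using \<kappa>'(3) x y by simp
  qed
qed

text \<open>For a fixed normal, one nonzero tangent vector determines the factor, and the normal
  then determines the centre.\<close>

lemma umbilic_at_center_unique: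
  assumes "umbilic_at M c p" "umbilic_at M c' p" "embedded_hypersurface M" "p \<in> M" "DIM('a::euclidean_space) \<ge> 3"
  shows "c = (c'::'a)"
proof -
  obtain U N where U: "p \<in> U" "local_normal M U N" using local_normal_exists[OF assms(3,4)] by blast
  obtain \<kappa> where k: "\<kappa> \<noteq> 0" "N p = \<kappa> *\<^sub>R (p - c)"
    "\<forall>x\<in>tangent_space M p. \<forall>y\<in>tangent_space M p. fd N p x \<bullet> y = \<kappa> * (x \<bullet> y)"
    using umbilic_at_any_normal[OF assms(1,4) U(2,1)] by blast
  obtain \<kappa>' where k': "\<kappa>' \<noteq> 0" "N p = \<kappa>' *\<^sub>R (p - c')"
    "\<forall>x\<in>tangent_space M p. \<forall>y\<in>tangent_space M p. fd N p x \<bullet> y = \<kappa>' * (x \<bullet> y)"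
    using umbilic_at_any_normal[OF assms(2,4) U(2,1)] by blast
  obtain x where x: "x \<noteq> 0" "N p \<bullet> x = 0" using exists_orthogonal[OF assms(5), of "N p" "N p"] by blast
  then have "x \<in> tangent_space M p" using local_normalD(5)[OF U(2) assms(4) U(1)] by simp
  then have "fd N p x \<bullet> x = \<kappa> * (x \<bullet> x)" "fd N p x \<bullet> x = \<kappa>' * (x \<bullet> x)" using k(3) k'(3) by blast+
  then have "\<kappa> * (x \<bullet> x) = \<kappa>' * (x \<bullet> x)" by linarith
  then have "\<kappa> = \<kappa>'" using x(1) by simp
  then show ?thesis using k k' by simp
qed

text \<open>Umbilic factors are given pointwise, without regularity. Evaluating the form on the
  tangential projection of a fixed vector \<open>x0\<close> gives a smooth function on an open set
  that agrees with them at points of \<open>M\<close>.\<close>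

lemma umbilic_curvature_function:
  assumes n: "local_normal M U N" and p: "p \<in> M" "p \<in> U" and dim: "DIM('a::euclidean_space) \<ge> 3"
  obtains W K where "open W" "(p::'a) \<in> W" "W \<subseteq> U" "smooth_on W K"
    "\<And>q \<kappa>. q \<in> M \<Longrightarrow> q \<in> W \<Longrightarrow>
      (\<And>x y. x \<in> tangent_space M q \<Longrightarrow> y \<in> tangent_space M q \<Longrightarrow> fd N q x \<bullet> y = \<kappa> * (x \<bullet> y)) \<Longrightarrow> K q = \<kappa>"
proof -
  have U: "open U" "smooth_on U N" and N0: "\<And>q. q \<in> U \<Longrightarrow> N q \<noteq> 0" using local_normalD[OF n] by blast+
  obtain x0 where x0: "x0 \<noteq> 0" "N p \<bullet> x0 = 0" using exists_orthogonal[OF dim, of "N p" "N p"] by blast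
  define X where "X q = nproj (N q) x0" for q
  have sX: "smooth_on U X" unfolding X_def[abs_def] by (intro smooth_on_nproj U N0 smooth_on_const)
  define W where "W = U \<inter> X -` (- {0})"
  have W: "open W" "W \<subseteq> U"
    unfolding W_def using smooth_on_continuous[OF sX] U(1) by (auto intro: continuous_open_preimage)
  have "p \<in> W" using x0 p(2) by (simp add: W_def X_def nproj_id)
  define K where "K q = (fd N q (X q) \<bullet> X q) / (X q \<bullet> X q)" for q
  have s: "smooth_on W X" "smooth_on W N" using sX U(2) W(2) smooth_on_subset by blast+
  have "smooth_on W K" unfolding K_def[abs_def]
    by (intro smooth_on_divide smooth_on_inner smooth_on_fd_field s W(1)) (simp add: W_def)
  moreover have "K q = \<kappa>" if q: "q \<in> M" "q \<in> W" and
    k: "\<And>x y. x \<in> tangent_space M q \<Longrightarrow> y \<in> tangent_space M q \<Longrightarrow> fd N q x \<bullet> y = \<kappa> * (x \<bullet> y)" for q \<kappa>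
  proof -
    have qU: "q \<in> U" and "X q \<noteq> 0" using q(2) by (auto simp: W_def)
    have "X q \<in> tangent_space M q"
      using local_normalD(5)[OF n q(1) qU] nproj_orthogonal[OF N0[OF qU]] by (simp add: X_def)
    then show ?thesis using k[of "X q" "X q"] \<open>X q \<noteq> 0\<close> by (simp add: K_def)
  qed
  ultimately show ?thesis using that W \<open>p \<in> W\<close> by blast
qed

text \<open>The centre of curvature $c(q) = q - N/\kappa$ of an umbilic hypersurface has $dc(v) = \mu(v) N$;
  the Codazzi argument $d^2c = 0$ forces $\mu = 0$.\<close>

lemma umbilic_center_locally_constant:
  assumes M: "embedded_hypersurface M" and n: "local_normal M U N" and p: "p \<in> M" "p \<in> U"
    and dim: "DIM('a::euclidean_space) \<ge> 3"
    and umb: "\<And>q. q \<in> M \<Longrightarrow> q \<in> U \<Longrightarrow> \<exists>\<kappa>. \<kappa> \<noteq> 0 \<and>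
      (\<forall>x\<in>tangent_space M q. \<forall>y\<in>tangent_space M q. fd N q x \<bullet> y = \<kappa> * (x \<bullet> y))"
  shows "\<exists>c W. open W \<and> (p::'a) \<in> W \<and> (\<forall>q\<in>M \<inter> W. umbilic_at M c q)"
proof -
  obtain W1 K where W1: "open W1" "p \<in> W1" "W1 \<subseteq> U" and sK1: "smooth_on W1 K" and K:
    "\<And>q \<kappa>. q \<in> M \<Longrightarrow> q \<in> W1 \<Longrightarrow>
      (\<And>x y. x \<in> tangent_space M q \<Longrightarrow> y \<in> tangent_space M q \<Longrightarrow> fd N q x \<bullet> y = \<kappa> * (x \<bullet> y)) \<Longrightarrow> K q = \<kappa>"
    using umbilic_curvature_function[OF n p dim] by blast
  have Kq: "K q \<noteq> 0 \<and> (\<forall>x\<in>tangent_space M q. \<forall>y\<in>tangent_space M q. fd N q x \<bullet> y = K q * (x \<bullet> y))"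
    if q: "q \<in> M" "q \<in> W1" for q
  proof -
    obtain \<kappa> where k: "\<kappa> \<noteq> 0" "\<forall>x\<in>tangent_space M q. \<forall>y\<in>tangent_space M q. fd N q x \<bullet> y = \<kappa> * (x \<bullet> y)"
      using umb q W1(3) by blast
    then have "K q = \<kappa>" using K[OF q] by blast
    then show ?thesis using k by simp
  qed
  define W where "W = W1 \<inter> K -` (- {0})"
  have opW: "open W" unfolding W_def
    using smooth_on_continuous[OF sK1] W1(1) by (intro continuous_open_preimage) auto
  have pW: "p \<in> W" using Kq[OF p(1) W1(2)] W1(2) by (simp add: W_def)
  have subW: "W \<subseteq> U" using W1(3) by (auto simp: W_def)
  note nW = local_normal_subset[OF n opW subW]
  have sN: "smooth_on W N" using local_normalD(2)[OF nW] .
  have N0: "N q \<noteq> 0" if "q \<in> W" for q using local_normalD(3)[OF nW that] .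
  have sK: "smooth_on W K" using sK1 smooth_on_subset[of W1 K W] by (simp add: W_def)
  define L where "L q = inverse (K q)" for q
  have sL: "smooth_on W L" unfolding L_def[abs_def] by (intro smooth_on_inverse opW sK) (simp add: W_def)
  define C where "C q = q - L q *\<^sub>R N q" for q
  have sC: "smooth_on W C" unfolding C_def[abs_def]
    by (intro smooth_on_diff smooth_on_ident smooth_on_scaleR opW sN sL)
  have tan: "tangent_space M q = {v. N q \<bullet> v = 0}" if "q \<in> M" "q \<in> W" for q
    using local_normalD(5)[OF nW that] .
  have hK: "fd N q x \<bullet> y = K q * (x \<bullet> y)" if "q \<in> M" "q \<in> W" "N q \<bullet> x = 0" "N q \<bullet> y = 0" for q x y
    using Kq[of q] tan[OF that(1,2)] that by (auto simp: W_def)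
  \<comment> \<open>The tangential part of the derivative of the centre vanishes, because the
    derivative of \<open>N\<close> is \<open>K q\<close> times the identity there and
    \<open>L\<close> is its inverse.\<close>
  have perp: "fd C q v \<bullet> w = 0" if q: "q \<in> M" "q \<in> W" and vw: "N q \<bullet> v = 0" "N q \<bullet> w = 0" for q v w
  proof -
    have d: "L differentiable at q" "N differentiable at q"
      using sL sN q(2) smooth_on_differentiable by blast+
    have "fd C q v = fd (\<lambda>x. x) q v - fd (\<lambda>q. L q *\<^sub>R N q) q v"
      unfolding C_def[abs_def] by (rule fd_diff) (use differentiable_scaleR[OF d] in simp_all)
    also have "\<dots> = v - (L q *\<^sub>R fd N q v + fd L q v *\<^sub>R N q)" by (simp add: fd_scaleR[OF d])
    finally have "fd C q v \<bullet> w = v \<bullet> w - L q * (fd N q v \<bullet> w)"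
      using vw by (simp add: inner_diff_left inner_add_left)
    also have "\<dots> = 0" using hK[OF q vw] q(2) by (simp add: L_def W_def)
    finally show ?thesis .
  qed
  have zero: "fd C q v = 0" if q: "q \<in> M" "q \<in> W" and v: "v \<in> tangent_space M q" for q v
  proof -
    have Nv: "N q \<bullet> v = 0" using v tan[OF q] by simp
    \<comment> \<open>A second tangent direction, orthogonal to \<open>v\<close>; it exists because
      the ambient dimension is at least 3.\<close>
    obtain x where x: "x \<noteq> 0" "N q \<bullet> x = 0" "v \<bullet> x = 0" using exists_orthogonal[OF dim] by blast
    \<comment> \<open>Tangent fields extending given tangent vectors at \<open>q\<close>;
      \<open>A z\<close> is the derivative of the centre along such a field and \<open>m z\<close>
      its normal coefficient.\<close>
    define F where "F z q' = nproj (N q') z" for z q'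
    define A where "A z q' = fd C q' (F z q')" for z q'
    define m where "m z q' = (A z q' \<bullet> N q') / (N q' \<bullet> N q')" for z q'
    have sF: "smooth_on W (F z)" for z unfolding F_def[abs_def]
      by (intro smooth_on_nproj opW sN N0 smooth_on_const)
    have sA: "smooth_on W (A z)" for z unfolding A_def[abs_def] by (rule smooth_on_fd_field[OF opW sC sF])
    have sm: "smooth_on W (m z)" for z unfolding m_def[abs_def]
      by (intro smooth_on_divide smooth_on_inner opW sN sA) (use N0 in simp)
    have NF: "N q' \<bullet> F z q' = 0" if "q' \<in> W" for z q'
      unfolding F_def by (rule nproj_orthogonal[OF N0[OF that]])
    have Fq: "F z q = z" if "N q \<bullet> z = 0" for z unfolding F_def by (rule nproj_id[OF that])
    have par: "A z q' = m z q' *\<^sub>R N q'" if "q' \<in> M \<inter> W" for z q'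
    proof -
      have q': "q' \<in> M" "q' \<in> W" using that by auto
      show ?thesis unfolding m_def
        by (rule hyperplane_subset_imp_parallel[OF N0[OF q'(2)]]) (unfold A_def, rule perp[OF q' NF[OF q'(2)]])
    qed
    have fdA: "fd (A z) q u \<bullet> x = m z q * K q * (u \<bullet> x)" if u: "N q \<bullet> u = 0" for z u
    proof -
      have d: "A z differentiable at q" "m z differentiable at q" "N differentiable at q"
        using sA sm sN q(2) smooth_on_differentiable by blast+
      have "u \<in> tangent_space M q" using u tan[OF q] by simp
      then have "fd (A z) q u = fd (\<lambda>q. m z q *\<^sub>R N q) q u"
        by (rule tangent_deriv_eq[OF _ d(1) differentiable_scaleR[OF d(2,3)] q(1) opW q(2)]) (rule par)
      then have "fd (A z) q u \<bullet> x = m z q * (fd N q u \<bullet> x)"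
        using x(2) by (simp add: fd_scaleR[OF d(2,3)] inner_add_left)
      then show ?thesis using hK[OF q u x(2)] by simp
    qed
    have NdF: "N q \<bullet> fd (F z) q u = - (F z q \<bullet> fd N q u)" for z u
    proof -
      have d: "F z differentiable at q" "N differentiable at q"
        using sF sN q(2) smooth_on_differentiable by blast+
      have "fd (\<lambda>q'. F z q' \<bullet> N q') q = fd (\<lambda>q'. 0) q"
        by (rule fd_cong_open[OF opW q(2)]) (use NF in \<open>simp add: inner_commute\<close>)
      then show ?thesis using fd_inner[OF d, of u] by (simp add: inner_commute)
    qed
    \<comment> \<open>The bracket of the fields extending \<open>v\<close> and \<open>x\<close>. It
      is tangent at \<open>q\<close>, so the derivative of the centre along it is orthogonal to
      \<open>x\<close>.\<close>
    define b where "b = fd (F v) q x - fd (F x) q v"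
    have "N q \<bullet> b = 0"
      using NdF[of v x] NdF[of x v] Fq[OF Nv] Fq[OF x(2)] local_normalD(4)[OF nW q(2), of x v]
      by (simp add: b_def inner_diff_right inner_commute)
    then have "fd C q b \<bullet> x = 0" by (rule perp[OF q _ x(2)])
    moreover have "fd (A v) q x - fd (A x) q v = fd C q b"
      using bracket_commutator[OF opW q(2) sC sF sF, of v x] Fq[OF Nv] Fq[OF x(2)]
      unfolding A_def[abs_def] b_def by simp
    ultimately have "fd (A v) q x \<bullet> x - fd (A x) q v \<bullet> x = 0" by (metis inner_diff_left)
    \<comment> \<open>The other term carries the factor \<open>v \<bullet> x\<close>, which is zero
      by the choice of \<open>x\<close>.\<close>
    then have "m v q * K q * (x \<bullet> x) = 0" using fdA[OF x(2)] fdA[OF Nv] x(3) by simp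
    then have "m v q = 0" using x(1) q(2) by (simp add: W_def)
    moreover have "A v q = fd C q v" using Fq[OF Nv] by (simp add: A_def)
    ultimately show ?thesis using par[of q v] q by simp
  qed
  have "\<exists>W'. open W' \<and> p \<in> W' \<and> W' \<subseteq> W \<and> (\<forall>q\<in>M \<inter> W'. C q = C p)"
    by (rule locally_constant[OF M p(1) pW opW sC zero])
  then obtain W' where W': "open W'" "p \<in> W'" "W' \<subseteq> W" "\<forall>q\<in>M \<inter> W'. C q = C p" by blast
  have "umbilic_at M (C p) q" if q: "q \<in> M" "q \<in> W'" for q
  proof -
    have qW: "q \<in> W" using q W'(3) by blast
    then have K0: "K q \<noteq> 0" by (simp add: W_def)
    have "q - L q *\<^sub>R N q = C p" using W'(4) q by (simp add: C_def)
    then have "q - C p = L q *\<^sub>R N q" by (metis add_diff_cancel_left' diff_add_cancel)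
    then have "K q *\<^sub>R (q - C p) = N q" using K0 by (simp add: L_def)
    then show ?thesis
      unfolding umbilic_at_def using nW qW K0 hK[OF q(1) qW] tan[OF q(1) qW]
      by (intro exI[of _ W] exI[of _ N] exI[of _ "K q"]) simp
  qed
  then show ?thesis using W'(1,2) by (intro exI[of _ "C p"] exI[of _ W']) simp
qed

lemma islimpt_zero:
  fixes E :: "'a::topological_space \<Rightarrow> 'b::real_normed_vector"
  assumes "continuous_on V E" "open V" "p \<in> V" "p islimpt S" "\<And>q. q \<in> S \<Longrightarrow> q \<in> V \<Longrightarrow> E q = 0"
  shows "E p = 0"
proof (rule ccontr)
  assume "E p \<noteq> 0"
  have "open (V \<inter> E -` (- {0}))" using assms(1,2) by (intro continuous_open_preimage) auto
  moreover have "p \<in> V \<inter> E -` (- {0})" using \<open>E p \<noteq> 0\<close> assms(3) by simp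
  ultimately obtain y where "y \<in> S" "y \<in> V \<inter> E -` (- {0})" using assms(4) islimptE by metis
  then show False using assms(5)[of y] by simp
qed

text \<open>With the smooth function \<open>K\<close> in place of the pointwise factors, and
  projected fields in place of tangent vectors, being umbilic is the vanishing of continuous
  functions. In the limit \<open>K p\<close> is nonzero, since
  \<open>N p = K p *\<^sub>R (p - c)\<close> and \<open>N p\<close> does not vanish.\<close>

lemma umbilic_at_closed:
  assumes M: "embedded_hypersurface M" and p: "p \<in> M" and dim: "DIM('a::euclidean_space) \<ge> 3"
    and lim: "p islimpt {q \<in> M. umbilic_at M c q}"
  shows "umbilic_at M c (p::'a)"
proof -
  let ?S = "{q \<in> M. umbilic_at M c q}"
  obtain U N where U: "p \<in> U" "local_normal M U N" using local_normal_exists[OF M p] by blast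
  obtain W K where W: "open W" "p \<in> W" "W \<subseteq> U" and sK: "smooth_on W K" and K:
    "\<And>q \<kappa>. q \<in> M \<Longrightarrow> q \<in> W \<Longrightarrow>
      (\<And>x y. x \<in> tangent_space M q \<Longrightarrow> y \<in> tangent_space M q \<Longrightarrow> fd N q x \<bullet> y = \<kappa> * (x \<bullet> y)) \<Longrightarrow> K q = \<kappa>"
    using umbilic_curvature_function[OF U(2) p U(1) dim] by blast
  note n = local_normal_subset[OF U(2) W(1,3)]
  have sN: "smooth_on W N" using local_normalD(2)[OF n] .
  have N0: "N q \<noteq> 0" if "q \<in> W" for q using local_normalD(3)[OF n that] .
  have S: "N q = K q *\<^sub>R (q - c) \<and> (\<forall>x\<in>tangent_space M q. \<forall>y\<in>tangent_space M q. fd N q x \<bullet> y = K q * (x \<bullet> y))"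
    if q: "q \<in> ?S" "q \<in> W" for q
  proof -
    have qM: "q \<in> M" and u: "umbilic_at M c q" using q by auto
    obtain \<kappa> where k: "N q = \<kappa> *\<^sub>R (q - c)"
      "\<forall>x\<in>tangent_space M q. \<forall>y\<in>tangent_space M q. fd N q x \<bullet> y = \<kappa> * (x \<bullet> y)"
      using umbilic_at_any_normal[OF u qM n q(2)] by blast
    have "K q = \<kappa>" by (rule K[OF qM q(2)]) (use k(2) in simp)
    then show ?thesis using k by simp
  qed
  have "N p - K p *\<^sub>R (p - c) = 0"
  proof (rule islimpt_zero[OF _ W(1,2) lim, of "\<lambda>q. N q - K q *\<^sub>R (q - c)"])
    show "continuous_on W (\<lambda>q. N q - K q *\<^sub>R (q - c))"
      by (intro smooth_on_continuous smooth_on_diff smooth_on_scaleR smooth_on_ident smooth_on_const sN sK W(1))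
  qed (use S in simp)
  then have Np: "N p = K p *\<^sub>R (p - c)" by simp
  then have "K p \<noteq> 0" using N0[OF W(2)] by auto
  moreover have "fd N p x \<bullet> y = K p * (x \<bullet> y)" if xy: "x \<in> tangent_space M p" "y \<in> tangent_space M p" for x y
  proof -
    define F where "F z q = nproj (N q) z" for z q
    have sF: "smooth_on W (F z)" for z unfolding F_def[abs_def]
      by (intro smooth_on_nproj W(1) sN N0 smooth_on_const)
    have "fd N p (F x p) \<bullet> F y p - K p * (F x p \<bullet> F y p) = 0"
    proof (rule islimpt_zero[OF _ W(1,2) lim, of "\<lambda>q. fd N q (F x q) \<bullet> F y q - K q * (F x q \<bullet> F y q)"])
      show "continuous_on W (\<lambda>q. fd N q (F x q) \<bullet> F y q - K q * (F x q \<bullet> F y q))"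
        by (intro smooth_on_continuous smooth_on_diff smooth_on_inner smooth_on_mult smooth_on_fd_field sF sN sK W(1))
      fix q assume q: "q \<in> ?S" "q \<in> W"
      have "F z q \<in> tangent_space M q" for z
        using local_normalD(5)[OF n _ q(2)] nproj_orthogonal[OF N0[OF q(2)]] q(1) by (simp add: F_def)
      then show "fd N q (F x q) \<bullet> F y q - K q * (F x q \<bullet> F y q) = 0" using S[OF q] by simp
    qed
    moreover have "F x p = x" "F y p = y"
      using xy local_normalD(5)[OF n p W(2)] nproj_id by (simp_all add: F_def)
    ultimately show ?thesis by simp
  qed
  ultimately show ?thesis unfolding umbilic_at_def using W(2) n Np by blast
qed

section \<open>Propagation of the umbilic property\<close>

lemma thorpe_imp_locally_umbilic:
  assumes M: "embedded_hypersurface M" and n: "local_normal M U N" and p: "p \<in> M" "p \<in> U"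
    and dim: "DIM('a::euclidean_space) = 2 * r + 1" and r: "2 * k \<le> r" "0 < k"
    and th: "thorpe r k (M :: 'a set)"
    and def: "\<And>x. x \<in> tangent_space M p \<Longrightarrow> x \<noteq> 0 \<Longrightarrow> s * (fd N p x \<bullet> x) > 0"
  shows "\<exists>c W. open W \<and> p \<in> W \<and> (\<forall>q\<in>M \<inter> W. umbilic_at M c q)"
proof -
  have dim3: "DIM('a) \<ge> 3" using dim r by simp
  obtain W where W: "open W" "p \<in> W" "W \<subseteq> U"
    "\<And>q x. q \<in> M \<Longrightarrow> q \<in> W \<Longrightarrow> x \<in> tangent_space M q \<Longrightarrow> x \<noteq> 0 \<Longrightarrow> s * (fd N q x \<bullet> x) > 0"
    using definite_open[OF n p def] by blast
  note nW = local_normal_subset[OF n W(1,3)]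
  have "\<exists>\<kappa>. \<kappa> \<noteq> 0 \<and> (\<forall>x\<in>tangent_space M q. \<forall>y\<in>tangent_space M q. fd N q x \<bullet> y = \<kappa> * (x \<bullet> y))"
    if q: "q \<in> M" "q \<in> W" for q
  proof -
    obtain \<kappa> where k: "s * \<kappa> > 0"
      "\<And>x y. x \<in> tangent_space M q \<Longrightarrow> y \<in> tangent_space M q \<Longrightarrow> fd N q x \<bullet> y = \<kappa> * (x \<bullet> y)"
      using thorpe_imp_umbilic[OF M nW q dim r th W(4)[OF q]] by blast
    then show ?thesis by (intro exI[of _ \<kappa>]) auto
  qed
  then show ?thesis by (rule umbilic_center_locally_constant[OF M nW p(1) W(2) dim3])
qed

lemma thorpe_imp_totally_umbilic:
  assumes M: "embedded_hypersurface M" "compact M" "connected M" "M \<noteq> {}"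
    and dim: "DIM('a::euclidean_space) = 2 * r + 1" and r: "2 * k \<le> r" "0 < k"
    and th: "thorpe r k (M :: 'a set)"
  obtains c where "\<And>q. q \<in> M \<Longrightarrow> umbilic_at M c q"
proof -
  have dim3: "DIM('a) \<ge> 3" using dim r by simp
  then have dim2: "DIM('a) \<ge> 2" by simp
  obtain p U N s where p: "p \<in> M" "p \<in> U" "local_normal M U N"
    "\<And>x. x \<in> tangent_space M p \<Longrightarrow> x \<noteq> 0 \<Longrightarrow> s * (fd N p x \<bullet> x) > 0"
    using exists_definite_point[OF M(1,2,4) dim2] by blast
  have "\<exists>c W. open W \<and> p \<in> W \<and> (\<forall>q\<in>M \<inter> W. umbilic_at M c q)"
    by (rule thorpe_imp_locally_umbilic[OF M(1) p(3,1,2) dim r th p(4)])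
  then obtain c W where c: "open W" "p \<in> W" "\<forall>q\<in>M \<inter> W. umbilic_at M c q" by blast
  define S where "S = {q \<in> M. umbilic_at M c q}"
  have "\<exists>T. openin (top_of_set M) T \<and> q \<in> T \<and> T \<subseteq> S" if q: "q \<in> S" for q
  proof -
    have qM: "q \<in> M" and u: "umbilic_at M c q" using q by (auto simp: S_def)
    obtain U N where U: "q \<in> U" "local_normal M U N" by (rule local_normal_exists[OF M(1) qM])
    obtain \<kappa> where k: "\<kappa> \<noteq> 0" "N q = \<kappa> *\<^sub>R (q - c)"
      "\<forall>x\<in>tangent_space M q. \<forall>y\<in>tangent_space M q. fd N q x \<bullet> y = \<kappa> * (x \<bullet> y)"
      using umbilic_at_any_normal[OF u qM U(2,1)] by blast
    \<comment> \<open>An umbilic point of nonzero factor is definite, with \<open>\<kappa>\<close>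
      itself as the sign factor, so the local result applies anew at \<open>q\<close>.\<close>
    have "\<kappa> * (fd N q x \<bullet> x) > 0" if x: "x \<in> tangent_space M q" "x \<noteq> 0" for x
    proof -
      have "\<kappa> * (fd N q x \<bullet> x) = (\<kappa> * \<kappa>) * (x \<bullet> x)" using k(3) x(1) by simp
      moreover have "(\<kappa> * \<kappa>) * (x \<bullet> x) > 0"
      proof (rule mult_pos_pos)
        show "\<kappa> * \<kappa> > 0" using k(1) not_real_square_gt_zero[of \<kappa>] by blast
      qed (use x(2) in simp)
      ultimately show ?thesis by linarith
    qed
    then have "\<exists>c W. open W \<and> q \<in> W \<and> (\<forall>q\<in>M \<inter> W. umbilic_at M c q)"
      by (rule thorpe_imp_locally_umbilic[OF M(1) U(2) qM U(1) dim r th])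
    then obtain c' W where W: "open W" "q \<in> W" "\<forall>q\<in>M \<inter> W. umbilic_at M c' q" by blast
    \<comment> \<open>The neighbourhood of \<open>q\<close> comes with a centre of its own; at
      \<open>q\<close> it has to coincide with \<open>c\<close>.\<close>
    have "umbilic_at M c' q" using W qM by blast
    then have "c' = c" by (rule umbilic_at_center_unique[OF _ u M(1) qM dim3])
    then have "M \<inter> W \<subseteq> S" using W(3) by (auto simp: S_def)
    then show ?thesis using openin_open_Int[OF W(1), of M] qM W(2) by blast
  qed
  then have "openin (top_of_set M) S" by (subst openin_subopen) blast
  moreover have "closedin (top_of_set M) S"
    unfolding closedin_limpt
  proof (intro conjI allI impI)
    show "S \<subseteq> M" by (auto simp: S_def)
    fix x assume "x islimpt S \<and> x \<in> M"
    then show "x \<in> S" using umbilic_at_closed[OF M(1) _ dim3, of x c] by (simp add: S_def)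
  qed
  ultimately have "S = {} \<or> S = M" using M(3) unfolding connected_clopen by blast
  moreover have "p \<in> S" using p(1) c by (simp add: S_def)
  ultimately show ?thesis using that[of c] by (auto simp: S_def)
qed

section \<open>Spheres\<close>

lemma has_derivative_square_distance:
  "((\<lambda>q. (q - c) \<bullet> (q - c)) has_derivative (\<lambda>v. 2 * ((q - c) \<bullet> v))) (at q)"
  by (auto intro!: derivative_eq_intros simp: inner_commute)

lemma tangent_orthogonal_radius:
  assumes "M \<subseteq> sphere c \<rho>" "q \<in> M" "v \<in> tangent_space M q"
  shows "(q - c) \<bullet> v = 0"
proof -
  have "fd (\<lambda>q. (q - c) \<bullet> (q - c)) q v = fd (\<lambda>_. \<rho>\<^sup>2) q v"
  proof (rule tangent_deriv_eq[OF assms(3) _ _ assms(2) open_UNIV UNIV_I])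
    show "(\<lambda>q. (q - c) \<bullet> (q - c)) differentiable at q"
      using has_derivative_square_distance by (rule differentiableI)
    fix x assume "x \<in> M \<inter> UNIV"
    then have "norm (x - c) = \<rho>" using assms(1) by (auto simp: dist_norm norm_minus_commute)
    then show "(x - c) \<bullet> (x - c) = \<rho>\<^sup>2" by (simp add: power2_norm_eq_inner[symmetric])
  qed simp
  then show ?thesis using fd_eqI[OF has_derivative_square_distance[of c q]] by simp
qed

text \<open>The gradient of the squared distance to \<open>c\<close> is normal to \<open>M\<close>,
  so this function is locally constant, and constant by connectedness.\<close>

lemma totally_umbilic_subset_sphere:
  assumes M: "embedded_hypersurface M" "connected M" and p: "p \<in> M"
    and umb: "\<And>q. q \<in> M \<Longrightarrow> umbilic_at M c q"
  shows "M \<subseteq> sphere c (dist c p)"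
proof -
  define C where "C q = (q - c) \<bullet> (q - c)" for q
  have sC: "smooth_on UNIV C" unfolding C_def[abs_def]
    by (intro smooth_on_inner smooth_on_diff smooth_on_ident smooth_on_const open_UNIV)
  have zero: "fd C q v = 0" if q: "q \<in> M" and v: "v \<in> tangent_space M q" for q v
  proof -
    obtain U N \<kappa> where n: "q \<in> U" "local_normal M U N" and k: "\<kappa> \<noteq> 0" "N q = \<kappa> *\<^sub>R (q - c)"
      using umb[OF q] unfolding umbilic_at_def by blast
    have "N q \<bullet> v = 0" using local_normalD(5)[OF n(2) q n(1)] v by simp
    then have "(q - c) \<bullet> v = 0" using k by simp
    moreover have "fd C q v = 2 * ((q - c) \<bullet> v)"
      unfolding C_def[abs_def] using fd_eqI[OF has_derivative_square_distance[of c q]] by simp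
    ultimately show ?thesis by simp
  qed
  have "\<forall>q\<in>M. C q = C p"
  proof (rule continuous_levelset_openin[OF M(2)])
    show "continuous_on M C" using smooth_on_continuous[OF sC] continuous_on_subset by blast
    have "\<exists>T. openin (top_of_set M) T \<and> q \<in> T \<and> T \<subseteq> {x \<in> M. C x = C p}" if q: "q \<in> {x \<in> M. C x = C p}" for q
    proof -
      have qM: "q \<in> M" using q by simp
      have "\<exists>W. open W \<and> q \<in> W \<and> W \<subseteq> UNIV \<and> (\<forall>x\<in>M \<inter> W. C x = C q)"
        by (rule locally_constant[OF M(1) qM UNIV_I open_UNIV sC zero])
      then obtain W where W: "open W" "q \<in> W" "\<forall>x\<in>M \<inter> W. C x = C q" by blast
      then have "M \<inter> W \<subseteq> {x \<in> M. C x = C p}" using q by auto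
      then show ?thesis using openin_open_Int[OF W(1), of M] qM W(2) by blast
    qed
    then show "openin (top_of_set M) {x \<in> M. C x = C p}" by (subst openin_subopen) blast
    show "\<exists>x\<in>M. C x = C p" using p by blast
  qed
  then have "norm (q - c) = norm (p - c)" if "q \<in> M" for q using that by (simp add: C_def norm_eq)
  moreover have "dist c q = norm (q - c)" for q by (simp add: dist_norm norm_minus_commute)
  ultimately show ?thesis by auto
qed

text \<open>In a slice chart the function $|q - c|^2$ is strictly monotone along the normal direction,
  so near \<open>p\<close> it takes the value $\rho^2$ only on \<open>M\<close>.\<close>

lemma sphere_locally_subset:
  assumes M: "embedded_hypersurface M" and p: "p \<in> M" and sub: "M \<subseteq> sphere c \<rho>" and \<rho>: "\<rho> > 0"
  shows "\<exists>W. open W \<and> p \<in> W \<and> sphere c \<rho> \<inter> W \<subseteq> M"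
proof -
  obtain U V H \<phi> \<psi> where ch: "slice_chart M U V H \<phi> \<psi>" and pU: "p \<in> U"
    using embedded_hypersurface_chart[OF M p] by blast
  note inv = slice_chart_inv[OF ch]
  have s: "open U" "open V" "smooth_on U \<phi>" "smooth_on V \<psi>" "subspace H" "Suc (dim H) = DIM('a)"
    using ch by (auto simp: slice_chart_def)
  obtain a where a: "a \<noteq> 0" "span H = {x. a \<bullet> x = 0}"
    using dim_eq_hyperplane[of H] s(6) by force
  have H: "H = {x. a \<bullet> x = 0}" using a s(5) by (simp add: span_eq_iff[THEN iffD2])
  define y0 where "y0 = \<phi> p"
  have y0: "y0 \<in> V" "\<psi> y0 = p" using inv(1,2)[OF pU] by (auto simp: y0_def)
  have y0H: "y0 \<in> H" using inv(5)[OF y0(1)] y0(2) p by simp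
  define G where "G y = (\<psi> y - c) \<bullet> (\<psi> y - c)" for y
  have sG: "smooth_on V G" unfolding G_def[abs_def]
    by (intro smooth_on_inner smooth_on_diff smooth_on_const s)
  have G\<rho>: "G y = \<rho>\<^sup>2 \<longleftrightarrow> \<psi> y \<in> sphere c \<rho>" for y
  proof -
    have "\<psi> y \<in> sphere c \<rho> \<longleftrightarrow> norm (\<psi> y - c) = \<rho>" by (simp add: dist_norm norm_minus_commute)
    also have "\<dots> \<longleftrightarrow> (norm (\<psi> y - c))\<^sup>2 = \<rho>\<^sup>2" using \<rho> by (simp add: power2_eq_iff_nonneg)
    finally show ?thesis by (simp add: G_def power2_norm_eq_inner)
  qed
  have dG: "G differentiable at y" if "y \<in> V" for y using smooth_on_differentiable[OF sG that] .
  have fdG: "fd G y0 u = 2 * ((p - c) \<bullet> fd \<psi> y0 u)" for u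
  proof -
    have d: "(\<lambda>y. \<psi> y - c) differentiable at y0"
      by (intro differentiable_diff smooth_on_differentiable[OF s(4) y0(1)]) simp
    have "fd (\<lambda>y. \<psi> y - c) y0 u = fd \<psi> y0 u"
      using fd_diff[OF smooth_on_differentiable[OF s(4) y0(1)], of "\<lambda>_. c" u] by simp
    then show ?thesis unfolding G_def[abs_def] using fd_inner[OF d d, of u] y0(2) by (simp add: inner_commute)
  qed
  \<comment> \<open>Otherwise the derivative of \<open>G\<close> would vanish along \<open>H\<close>
    and along \<open>a\<close>, hence in every direction, whereas the direction mapped to the radius
    \<open>p - c\<close> has derivative twice the squared radius.\<close>
  have "fd G y0 a \<noteq> 0"
  proof
    assume za: "fd G y0 a = 0"
    define u where "u = fd \<phi> p (p - c)"
    define t where "t = (a \<bullet> u) / (a \<bullet> a)"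
    define h where "h = u - t *\<^sub>R a"
    have hH: "h \<in> H" using a(1) by (simp add: H h_def t_def inner_diff_right)
    have "fd \<psi> y0 h \<in> tangent_space M p" using slice_chart_tangent[OF ch y0(1) y0H hH] y0(2) by simp
    then have zh: "fd G y0 h = 0" using fdG tangent_orthogonal_radius[OF sub p] by simp
    have l: "linear (fd G y0)" by (rule linear_fd[OF dG[OF y0(1)]])
    have "u = h + t *\<^sub>R a" by (simp add: h_def)
    then have "fd G y0 u = 0" using za zh linear_add[OF l, of h "t *\<^sub>R a"] linear_cmul[OF l, of t a] by simp
    moreover have "fd \<psi> y0 u = p - c" unfolding u_def y0_def by (rule slice_chart_fd(1)[OF ch pU])
    ultimately have "(p - c) \<bullet> (p - c) = 0" using fdG[of u] by simp
    then have "p = c" by simp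
    then show False using sub p \<rho> by auto
  qed
  moreover have "continuous_on V (\<lambda>y. fd G y a)" using smooth_on_continuous[OF smooth_on_fd[OF sG]] .
  then have "open (V \<inter> (\<lambda>y. fd G y a) -` (- {0}))" using s(2) by (intro continuous_open_preimage) auto
  ultimately obtain e where e: "e > 0" "ball y0 e \<subseteq> V \<inter> (\<lambda>y. fd G y a) -` (- {0})"
    unfolding open_contains_ball using y0(1) by blast
  define W where "W = U \<inter> \<phi> -` ball y0 e"
  have op: "open W" unfolding W_def using smooth_on_continuous[OF s(3)] s(1) by (intro continuous_open_preimage) auto
  have pW: "p \<in> W" using pU e(1) by (simp add: W_def y0_def)
  have "x \<in> M" if x: "x \<in> sphere c \<rho> \<inter> W" for x
  proof -
    have xU: "x \<in> U" and yb: "\<phi> x \<in> ball y0 e" using x by (auto simp: W_def)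
    define y where "y = \<phi> x"
    \<comment> \<open>Subtracting \<open>t *\<^sub>R a\<close> projects \<open>y\<close>
      orthogonally to \<open>H\<close>. The projection is no farther from \<open>y0\<close> than
      \<open>y\<close>, so the segment between them stays in the ball, where the derivative of
      \<open>G\<close> along \<open>a\<close> has no zero.\<close>
    define t where "t = (y \<bullet> a) / (a \<bullet> a)"
    let ?l = "\<lambda>r::real. (y - t *\<^sub>R a) + r *\<^sub>R a"
    have a0: "y0 \<bullet> a = 0" using y0H by (simp add: H inner_commute)
    have yH: "y - t *\<^sub>R a \<in> H" using a(1) by (simp add: H t_def inner_diff_right inner_commute)
    have "y - t *\<^sub>R a - y0 = nproj a (y - y0)"
      using a0 by (simp add: nproj_def t_def inner_diff_left)
    moreover have "norm (nproj a z) \<le> norm z" for z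
    proof -
      have "nproj a z \<bullet> nproj a z = z \<bullet> nproj a z" by (rule nproj_inner[OF nproj_orthogonal[OF a(1)]])
      also have "\<dots> \<le> norm z * norm (nproj a z)" by (rule norm_cauchy_schwarz)
      finally have "norm (nproj a z) * norm (nproj a z) \<le> norm z * norm (nproj a z)"
        by (simp add: power2_norm_eq_inner flip: power2_eq_square)
      then show ?thesis by (cases "nproj a z = 0") auto
    qed
    ultimately have "norm (y - t *\<^sub>R a - y0) \<le> norm (y - y0)" by metis
    then have lb: "y - t *\<^sub>R a \<in> ball y0 e"
      using yb by (simp add: dist_norm norm_minus_commute y_def)
    have yball: "y \<in> ball y0 e" using yb by (simp add: y_def)
    have seg: "?l (r * t) \<in> ball y0 e" if r: "0 \<le> r" "r \<le> 1" for r
    proof -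
      have "?l (r * t) = (1 - r) *\<^sub>R (y - t *\<^sub>R a) + r *\<^sub>R y" by (simp add: algebra_simps)
      then show ?thesis using convexD[OF convex_ball lb yball, of "1 - r" r] r by simp
    qed
    have der: "((\<lambda>r. G (?l (r * t))) has_real_derivative (t * fd G (?l (r * t)) a)) (at r)" if r: "0 \<le> r" "r \<le> 1" for r
    proof -
      have V: "?l (r * t) \<in> V" using seg[OF r] e(2) by blast
      have "((\<lambda>r. ?l (r * t)) has_vector_derivative (t *\<^sub>R a)) (at r)"
        by (auto intro!: derivative_eq_intros)
      moreover have "(G has_derivative fd G (?l (r * t))) (at (?l (r * t)))"
        using dG[OF V] frechet_derivative_works by blast
      ultimately have "((G \<circ> (\<lambda>r. ?l (r * t))) has_vector_derivative fd G (?l (r * t)) (t *\<^sub>R a)) (at r)"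
        using vector_derivative_diff_chain_within[of "\<lambda>r. ?l (r * t)" "t *\<^sub>R a" r UNIV G "fd G (?l (r * t))"]
        by (simp add: has_derivative_at_withinI)
      then show ?thesis
        using linear_cmul[OF linear_fd[OF dG[OF V]], of t a]
        by (simp add: o_def has_real_derivative_iff_has_vector_derivative)
    qed
    have "\<exists>z>0. z < 1 \<and> G (?l (1 * t)) - G (?l (0 * t)) = (1 - 0) * (t * fd G (?l (z * t)) a)"
      by (rule MVT2[of 0 1 "\<lambda>r. G (?l (r * t))"]) (use der in auto)
    then obtain z where z: "0 < z" "z < 1" "G y - G (y - t *\<^sub>R a) = t * fd G (?l (z * t)) a" by auto
    have "G y = \<rho>\<^sup>2" using G\<rho>[of y] x inv(1)[OF xU] by (simp add: y_def)
    moreover have "G (y - t *\<^sub>R a) = \<rho>\<^sup>2"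
      using G\<rho> inv(5)[of "y - t *\<^sub>R a"] yH lb e(2) sub by blast
    ultimately have "t * fd G (?l (z * t)) a = 0" using z(3) by simp
    moreover have "fd G (?l (z * t)) a \<noteq> 0" using seg[of z] z e(2) by auto
    ultimately have "t = 0" by simp
    then have "y \<in> H" using yH by simp
    then show ?thesis using inv(5)[of y] inv(1,2)[OF xU] by (simp add: y_def)
  qed
  then show ?thesis using op pW by blast
qed

text \<open>Compactness makes \<open>M\<close> closed in the sphere and
  \<open>sphere_locally_subset\<close> makes it open; the sphere is connected from ambient dimension
  2 on.\<close>

lemma compact_hypersurface_in_sphere:
  assumes M: "embedded_hypersurface M" "compact M" "M \<noteq> {}" and sub: "M \<subseteq> sphere c \<rho>" and \<rho>: "\<rho> > 0"
    and dim: "2 \<le> DIM('a::euclidean_space)"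
  shows "M = sphere (c::'a) \<rho>"
proof -
  have "closedin (top_of_set (sphere c \<rho>)) M"
    using compact_imp_closed[OF M(2)] sub by (rule closed_subset[rotated])
  moreover have "openin (top_of_set (sphere c \<rho>)) M"
  proof (subst openin_subopen, intro ballI)
    fix p assume p: "p \<in> M"
    obtain W where W: "open W" "p \<in> W" "sphere c \<rho> \<inter> W \<subseteq> M"
      using sphere_locally_subset[OF M(1) p sub \<rho>] by blast
    then show "\<exists>T. openin (top_of_set (sphere c \<rho>)) T \<and> p \<in> T \<and> T \<subseteq> M"
      using openin_open_Int[OF W(1), of "sphere c \<rho>"] p sub by blast
  qed
  ultimately have "M = {} \<or> M = sphere c \<rho>"
    using connected_sphere[OF dim, of c \<rho>] unfolding connected_clopen by blast
  then show ?thesis using M(3) by simp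
qed

lemma thorpe_imp_sphere:
  assumes M: "embedded_hypersurface M" "compact M" "connected M" "M \<noteq> {}"
    and dim: "DIM('a::euclidean_space) = 2 * r + 1" and r: "2 * k \<le> r" "0 < k"
    and th: "thorpe r k (M :: 'a set)"
  shows "\<exists>c \<rho>. \<rho> > 0 \<and> M = sphere c \<rho>"
proof -
  obtain c where c: "\<And>q. q \<in> M \<Longrightarrow> umbilic_at M c q"
    using thorpe_imp_totally_umbilic[OF M dim r th] by blast
  obtain p where p: "p \<in> M" using M(4) by blast
  obtain U N \<kappa> where n: "p \<in> U" "local_normal M U N" "N p = \<kappa> *\<^sub>R (p - c)"
    using c[OF p] unfolding umbilic_at_def by blast
  have "N p \<noteq> 0" using local_normalD(3)[OF n(2,1)] .
  then have "p \<noteq> c" using n(3) by auto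
  then have "dist c p > 0" by simp
  moreover have "M = sphere c (dist c p)"
    by (rule compact_hypersurface_in_sphere[OF M(1,2,4) totally_umbilic_subset_sphere[OF M(1,3) p c]])
      (use \<open>p \<noteq> c\<close> dim r in simp_all)
  ultimately show ?thesis by blast
qed

section \<open>The round sphere is a Thorpe hypersurface\<close>

definition inversion :: "'a::euclidean_space \<Rightarrow> 'a" where
  "inversion w = (1 / (w \<bullet> w)) *\<^sub>R w"

lemma inversion_inversion: "w \<noteq> 0 \<Longrightarrow> inversion (inversion w) = w"
  by (simp add: inversion_def)

lemma inversion_nonzero: "w \<noteq> 0 \<Longrightarrow> inversion w \<noteq> 0"
  by (simp add: inversion_def)

lemma smooth_on_inversion:
  assumes "open S" "smooth_on S f" "\<And>x. x \<in> S \<Longrightarrow> f x \<noteq> 0"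
  shows "smooth_on S (\<lambda>x. inversion (f x))"
  unfolding inversion_def
  by (intro smooth_on_scaleR smooth_on_divide smooth_on_inner smooth_on_const assms(1,2)) (use assms(3) in simp)

text \<open>Inversion in the antipode of \<open>p\<close> maps the sphere to a hyperplane.\<close>

lemma embedded_hypersurface_sphere:
  assumes \<rho>: "\<rho> > 0"
  shows "embedded_hypersurface (sphere (c::'a::euclidean_space) \<rho>)"
  unfolding embedded_hypersurface_iff
proof
  fix p assume p: "p \<in> sphere c \<rho>"
  define d where "d = p - c"
  define a where "a = c - d"
  \<comment> \<open>Inversion at \<open>a\<close> sends the sphere to the affine hyperplane of all
    \<open>z\<close> with \<open>d \<bullet> z = 1 / 2\<close>. Subtracting its point
    \<open>e\<close> gives the linear hyperplane required of a slice chart.\<close>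
  define e where "e = (1 / (2 * (d \<bullet> d))) *\<^sub>R d"
  define U where "U = - {a}"
  define V where "V = - {- e}"
  define H where "H = {y. d \<bullet> y = 0}"
  define \<phi> where "\<phi> q = inversion (q - a) - e" for q
  define \<psi> where "\<psi> y = inversion (y + e) + a" for y
  have dd: "norm d = \<rho>" using p by (simp add: d_def dist_norm norm_minus_commute)
  then have d0: "d \<noteq> 0" using \<rho> by auto
  have op: "open U" "open V" by (auto simp: U_def V_def)
  have "p - a = 2 *\<^sub>R d" by (simp add: a_def d_def scaleR_2)
  then have "p \<noteq> a" using d0 by auto
  then have pU: "p \<in> U" by (simp add: U_def)
  have s\<phi>: "smooth_on U \<phi>" unfolding \<phi>_def[abs_def]
    by (intro smooth_on_diff smooth_on_inversion smooth_on_ident smooth_on_const op) (simp add: U_def)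
  have s\<psi>: "smooth_on V \<psi>" unfolding \<psi>_def[abs_def]
    by (intro smooth_on_add smooth_on_inversion smooth_on_ident smooth_on_const op)
      (simp add: V_def eq_neg_iff_add_eq_0)
  have UV: "\<phi> q \<in> V" "\<psi> (\<phi> q) = q" if "q \<in> U" for q
    using that inversion_nonzero[of "q - a"] inversion_inversion[of "q - a"]
    by (auto simp: \<phi>_def \<psi>_def U_def V_def)
  have VU: "\<psi> y \<in> U" "\<phi> (\<psi> y) = y" if "y \<in> V" for y
    using that inversion_nonzero[of "y + e"] inversion_inversion[of "y + e"]
    by (auto simp: \<phi>_def \<psi>_def U_def V_def eq_neg_iff_add_eq_0)
  have hom: "homeomorphism U V \<phi> \<psi>"
    by (rule homeomorphismI) (use smooth_on_continuous[OF s\<phi>] smooth_on_continuous[OF s\<psi>] UV VU in auto)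
  have iff: "q \<in> sphere c \<rho> \<longleftrightarrow> \<phi> q \<in> H" if "q \<in> U" for q
  proof -
    let ?w = "q - a"
    have w0: "?w \<bullet> ?w \<noteq> 0" using that by (simp add: U_def)
    have "q \<in> sphere c \<rho> \<longleftrightarrow> norm (q - c) = norm d" by (simp add: dd dist_norm norm_minus_commute)
    also have "\<dots> \<longleftrightarrow> (q - c) \<bullet> (q - c) = d \<bullet> d" by (simp add: norm_eq)
    also have "q - c = ?w - d" by (simp add: a_def)
    also have "(?w - d) \<bullet> (?w - d) = d \<bullet> d \<longleftrightarrow> ?w \<bullet> ?w = 2 * (d \<bullet> ?w)"
      by (auto simp: inner_diff_left inner_diff_right inner_commute)
    also have "\<dots> \<longleftrightarrow> (1 / (?w \<bullet> ?w)) * (d \<bullet> ?w) = 1 / 2" using w0 by (auto simp: field_simps)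
    also have "\<dots> \<longleftrightarrow> d \<bullet> \<phi> q = 0"
      using d0 by (simp add: \<phi>_def inversion_def e_def inner_diff_right)
    finally show ?thesis by (simp add: H_def)
  qed
  have im: "\<phi> ` (sphere c \<rho> \<inter> U) = V \<inter> H"
  proof (intro equalityI subsetI)
    fix y assume "y \<in> \<phi> ` (sphere c \<rho> \<inter> U)"
    then obtain q where "q \<in> sphere c \<rho>" "q \<in> U" "y = \<phi> q" by blast
    then show "y \<in> V \<inter> H" using UV(1) iff by blast
  next
    fix y assume y: "y \<in> V \<inter> H"
    then have "\<psi> y \<in> U" "\<phi> (\<psi> y) = y" using VU by auto
    moreover from this have "\<psi> y \<in> sphere c \<rho>" using iff[of "\<psi> y"] y by simp
    ultimately show "y \<in> \<phi> ` (sphere c \<rho> \<inter> U)" by (metis IntI imageI)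
  qed
  have "subspace H" unfolding H_def by (rule subspace_hyperplane)
  moreover have "Suc (dim H) = DIM('a)" unfolding H_def using dim_hyperplane[OF d0] by simp
  ultimately have "slice_chart (sphere c \<rho>) U V H \<phi> \<psi>"
    using op hom s\<phi> s\<psi> im by (simp add: slice_chart_def)
  then show "\<exists>U V H \<phi> \<psi>. slice_chart (sphere c \<rho>) U V H \<phi> \<psi> \<and> p \<in> U" using pU by blast
qed

text \<open>Differentiating the distance only shows that tangent vectors are orthogonal to the
  radius. For the converse, the radius is compared with an abstract local normal, to which it must
  be parallel.\<close>

lemma local_normal_sphere:
  assumes \<rho>: "\<rho> > 0"
  shows "local_normal (sphere c \<rho>) (- {c}) (\<lambda>q. q - c)"
proof -
  let ?M = "sphere c \<rho>" and ?n = "\<lambda>q. q - c"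
  have fdn: "fd ?n q x = x" for q x
    using fd_diff[of "\<lambda>x. x" q "\<lambda>_. c" x] by simp
  have "tangent_space ?M q = {v. (q - c) \<bullet> v = 0}" if q: "q \<in> ?M" for q
  proof -
    obtain U N where U: "q \<in> U" "local_normal ?M U N"
      using local_normal_exists[OF embedded_hypersurface_sphere[OF \<rho>] q] by blast
    have T: "tangent_space ?M q = {v. N q \<bullet> v = 0}" and N0: "N q \<noteq> 0"
      using local_normalD(3,5)[OF U(2)] q U(1) by blast+
    define l where "l = ((q - c) \<bullet> N q) / (N q \<bullet> N q)"
    have par: "q - c = l *\<^sub>R N q"
      unfolding l_def by (rule hyperplane_subset_imp_parallel[OF N0]) (use tangent_orthogonal_radius[OF subset_refl q] T in blast)
    have "q - c \<noteq> 0" using q \<rho> by auto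
    then have "l \<noteq> 0" using par by auto
    then show ?thesis unfolding T par by simp
  qed
  then show ?thesis unfolding local_normal_def fdn
    by (auto intro!: smooth_on_diff smooth_on_ident smooth_on_const simp: inner_commute)
qed

text \<open>The radial normal field has the identity as derivative, so every point is umbilic with
  factor 1.\<close>

lemma thorpe_sphere:
  assumes \<rho>: "\<rho> > 0" and dim: "DIM('a::euclidean_space) = 2 * r + 1" and r: "2 * k \<le> r"
  shows "thorpe r k (sphere (c::'a) \<rho>)"
  unfolding thorpe_def
proof (intro ballI)
  fix p xs ys
  let ?M = "sphere c \<rho>"
  assume p: "p \<in> ?M" and xs: "xs \<in> lists (tangent_space ?M p)" and ys: "ys \<in> lists (tangent_space ?M p)"
  have "p \<in> - {c}" using p \<rho> by auto
  moreover have "fd (\<lambda>q. q - c) p x \<bullet> y = 1 * (x \<bullet> y)" for x y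
    using fd_diff[of "\<lambda>x. x" p "\<lambda>_. c" x] by simp
  ultimately show "double_hodge (tangent_space ?M p) (thorpe_form r k ?M p) xs ys = thorpe_form r k ?M p xs ys"
    using umbilic_imp_thorpe_at[OF embedded_hypersurface_sphere[OF \<rho>] local_normal_sphere[OF \<rho>] p _ dim r _ xs ys, of 1]
    by blast
qed

text \<open>Nonemptiness excludes the empty set, which satisfies the other conditions vacuously.
  Connectedness belongs to the classification because the Thorpe condition is pointwise and holds
  for disjoint unions of spheres as well.\<close>

theorem proposition1p5:
  fixes k n r :: nat
  assumes "k \<ge> 1" and "n = 2 * r" and "n \<ge> 4 * k"
    and "DIM('a::euclidean_space) = n + 1"
  shows "(\<nexists>M :: 'a set. M \<noteq> {} \<and> compact M \<and> embedded_hypersurface M \<and> anti_thorpe r k M)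
    \<and> (\<forall>M :: 'a set.
         M \<noteq> {} \<and> compact M \<and> connected M \<and> embedded_hypersurface M \<and> thorpe r k M
         \<longleftrightarrow> (\<exists>c \<rho>. \<rho> > 0 \<and> M = sphere c \<rho>))"
proof (intro conjI allI)
  have r: "2 * k \<le> r" "0 < k" and dim: "DIM('a) = 2 * r + 1" using assms by auto
  have dim2: "2 \<le> DIM('a)" using r dim by simp
  show "\<nexists>M :: 'a set. M \<noteq> {} \<and> compact M \<and> embedded_hypersurface M \<and> anti_thorpe r k M"
  proof
    assume "\<exists>M :: 'a set. M \<noteq> {} \<and> compact M \<and> embedded_hypersurface M \<and> anti_thorpe r k M"
    then obtain M :: "'a set" where M: "M \<noteq> {}" "compact M" "embedded_hypersurface M" "anti_thorpe r k M" by blast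
    obtain p U N s where "p \<in> M" "p \<in> U" "local_normal M U N"
      "\<And>x. x \<in> tangent_space M p \<Longrightarrow> x \<noteq> 0 \<Longrightarrow> s * (fd N p x \<bullet> x) > 0"
      using exists_definite_point[OF M(3,2,1) dim2] by blast
    then show False using anti_thorpe_not_definite[OF M(3) _ _ _ dim r(1) M(4)] by blast
  qed
  fix M :: "'a set"
  show "M \<noteq> {} \<and> compact M \<and> connected M \<and> embedded_hypersurface M \<and> thorpe r k M
         \<longleftrightarrow> (\<exists>c \<rho>. \<rho> > 0 \<and> M = sphere c \<rho>)" (is "?L \<longleftrightarrow> ?R")
  proof
    assume ?L
    then show ?R using thorpe_imp_sphere[OF _ _ _ _ dim r] by blast
  next
    assume ?R
    then obtain c \<rho> where M: "\<rho> > 0" "M = sphere c \<rho>" by blast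
    then show ?L
      using connected_sphere[OF dim2, of c \<rho>] embedded_hypersurface_sphere[OF M(1), of c]
        thorpe_sphere[OF M(1) dim r(1), of c] by simp
  qed
qed

end
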